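(* Let $c$ be a small category (regarded as a polynomial comonoid) and let $m$ be a familial monad on $c\text{-}\mathbf{Set}$. Then the polynomial comonoid $\begin{bmatrix} m\triangleleft_c m\\ m\end{bmatrix}$ corresponds to the category $\Theta_m^{\mathrm{op}}$, up to isomorphism of categories. Therefore $\Theta_m$ has the following universal property. For every cofunctor $a\to c$, cofunctors $\Theta_m^{\mathrm{op}}\to a$ commuting with the cofunctors to $c$ are in bijective correspondence with transformations of familial endofunctors (morphisms of $(c,c)$-bicomodules) $\varphi\colon m\to a\triangleleft_c m\triangleleft_c m$ with respect to which the counit and comultiplication of $a$, regarded as a familial comonad on $c$, commute with the unit and multiplication of the rightmost copy of $m$, i.e. such that $$(\epsilon_a\triangleleft_c m\triangleleft_c m)\circ\varphi = m\triangleleft_c\eta\colon\ m\to m\triangleleft_c m,$$ $$(\delta_a\triangleleft_c m\triangleleft_c m)\circ\varphi=(a\triangleleft_c a\triangleleft_c m\triangleleft_c\mu)\circ(a\triangleleft_c\varphi\triangleleft_c m)\circ\varphi\colon\ m\to a\triangleleft_c a\triangleleft_c m\triangleleft_c m .$$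
   Context: **Polynomials, comonoids, bicomodules.** A polynomial is a functor $p=\sum_{I\in p(1)}y^{p[I]}\colon\mathbf{Set}\to\mathbf{Set}$ (a coproduct of representables; $p(1)$ and all $p[I]$ are sets); morphisms are natural transformations. The category $\mathbf{Poly}$ is monoidal under composition $\triangleleft$ with unit $y$. Comonoids $(c,\epsilon,\delta)$ in $(\mathbf{Poly},y,\triangleleft)$ correspond to small categories: the objects are the elements of $c(1)$, $c[C]$ is the set of morphisms with source $C$, $\epsilon$ encodes identities and $\delta$ encodes codomains and composition. Comonoid homomorphisms $c\to d$ correspond to cofunctors: a function on objects $c(1)\to d(1)$ together with, for each object $C$ of $c$ with image $D$, a lift of each morphism of $d$ out of $D$ to a morphism of $c$ out of $C$, respecting codomains, identities and composites. A $(c,d)$-bicomodule is a polynomial $p$ with compatible left $c$- and right $d$-coactions $c\triangleleft p\leftarrow p\to p\triangleleft d$. Bicomodules compose by $p\triangleleft_d q=\mathrm{eq}(p\triangleleft q\rightrightarrows p\triangleleft d\triangleleft q)$, and $c$ itself (with coactions $\delta$) is the identity $(c,c)$-bicomodule. $\mathbb{C}\mathbf{at}^\sharp$ is the double category of comonoids, homomorphisms (vertical) and bicomodules (horizontal). **Familial functors.** $c\text{-}\mathbf{Set}$ denotes the category of functors $c\to\mathbf{Set}$ (copresheaves). A $(c,d)$-bicomodule $p$ amounts to a familial functor $p\colon d\text{-}\mathbf{Set}\to c\text{-}\mathbf{Set}$, $p(X)_C\cong\sum_{I\in p_C(1)}\mathrm{Hom}_{d\text{-}\mathbf{Set}}(p[I],X)$,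 where $p_{(-)}(1)\colon c\to\mathbf{Set}$ is a functor and $p[-]$ is a functor from the opposite of its category of elements to $d\text{-}\mathbf{Set}$; the carrier is $\sum_{C\in c(1)}\sum_{I\in p_C(1)}y^{p[I]}$. Morphisms of $(c,d)$-bicomodules correspond to natural transformations, and $\triangleleft_d$ corresponds to composition of functors. $(c,0)$-bicomodules are the same as $c$-copresheaves, and $p\triangleleft_d X=p(X)$. **Monads and comonads.** A monad (resp. comonad) on $c$ in $\mathbb{C}\mathbf{at}^\sharp$ is a monoid (resp. comonoid) in $(c,c)$-bicomodules under $\triangleleft_c$. A familial monad on $c\text{-}\mathbf{Set}$ is a cartesian monad $(m,\eta,\mu)$ whose underlying endofunctor is familial; it is in particular a monad on $c$ in $\mathbb{C}\mathbf{at}^\sharp$. Given a comonad $e$ on $c$, its carrier polynomial is a comonoid in $\mathbf{Poly}$ with comultiplication $e\to e\triangleleft_c e\to e\triangleleft e$ and counit $e\to c\to y$, and $e\to c$ is a comonoid homomorphism (sending elements of $e_C(1)$ to $C$). Conversely, a cofunctor $a\to c$ makes $a$ a comonad on $c$ in $\mathbb{C}\mathbf{at}^\sharp$ (a familial comonad), with counit $\epsilon_a\colon a\to c$ and comultiplication $\delta_a\colon a\to a\triangleleft_c a$. **Right coclosure.** For a $(d,e)$-bicomodule $q$, the functor $-\triangleleft_d q$ from $(c,d)$-bicomodules to $(c,e)$-bicomodules has a left adjoint, written $p\mapsto\begin{bmatrix}q\\ p\end{bmatrix}$, with carrier $\sum_{C\in c(1)}\sum_{I\in p_C(1)}y^{q\triangleleft_e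 p[I]}$ (it is the left Kan extension of $p$ along $q$). Write $L=\begin{bmatrix} m\triangleleft_c m\\ m\end{bmatrix}$ and let $u\colon m\to L\triangleleft_c m\triangleleft_c m$ be the unit of the adjunction. $L$ is a comonad on $c$: its counit $L\to c$ is adjoint to $m\triangleleft_c\eta\colon m\to m\triangleleft_c m$, and its comultiplication $L\to L\triangleleft_c L$ is adjoint to $(L\triangleleft_c L\triangleleft_c m\triangleleft_c\mu)\circ(L\triangleleft_c u\triangleleft_c m)\circ u$. The polynomial comonoid $L$ is the carrier comonoid of this comonad, with its homomorphism to $c$; this is the cofunctor $\Theta_m^{\mathrm{op}}\to c$ in the statement, which sends $M\in m_C(1)$ to $C$. **Theory category.** $\Theta_m$ is the full subcategory of $m$-algebras spanned by the free algebras $m(m[M])$ for $M\in m_C(1)$, $C\in c(1)$; equivalently the full subcategory of the Kleisli category of $m$ spanned by the $c$-copresheaves $m[M]$. Its objects are denoted by, and indexed by, the elements $M$, so that $\Theta_m(M',M)=\mathrm{Hom}_{c\text{-}\mathbf{Set}}(m[M'],m(m[M]))$. *)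

theory Defs
  imports "HOL-Library.FuncSet"
begin

section \<open>Small categories and copresheaves\<close>

record ('o, 'a) cat =
  Ob :: "'o set"
  Ar :: "'a set"
  src :: "'a \<Rightarrow> 'o"
  tgt :: "'a \<Rightarrow> 'o"
  ide :: "'o \<Rightarrow> 'a"
  cmp :: "'a \<Rightarrow> 'a \<Rightarrow> 'a"   \<comment> \<open>\<open>cmp c g f\<close> is \<open>g\<close> after \<open>f\<close>\<close>

definition category :: "('o, 'a) cat \<Rightarrow> bool" where
  "category c \<longleftrightarrow>
     (\<forall>f\<in>Ar c. src c f \<in> Ob c \<and> tgt c f \<in> Ob c) \<and>
     (\<forall>C\<in>Ob c. ide c C \<in> Ar c \<and> src c (ide c C) = C \<and> tgt c (ide c C) = C) \<and>
     (\<forall>f\<in>Ar c. \<forall>g\<in>Ar c. src c g = tgt c f \<longrightarrow>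
        cmp c g f \<in> Ar c \<and> src c (cmp c g f) = src c f \<and> tgt c (cmp c g f) = tgt c g) \<and>
     (\<forall>f\<in>Ar c. cmp c f (ide c (src c f)) = f \<and> cmp c (ide c (tgt c f)) f = f) \<and>
     (\<forall>f\<in>Ar c. \<forall>g\<in>Ar c. \<forall>h\<in>Ar c. src c g = tgt c f \<and> src c h = tgt c g \<longrightarrow>
        cmp c h (cmp c g f) = cmp c (cmp c h g) f)"

definition op_cat :: "('o, 'a) cat \<Rightarrow> ('o, 'a) cat" where
  "op_cat c = \<lparr>Ob = Ob c, Ar = Ar c, src = tgt c, tgt = src c, ide = ide c,
               cmp = (\<lambda>g f. cmp c f g)\<rparr>"

definition out :: "('o, 'a) cat \<Rightarrow> 'o \<Rightarrow> 'a set" where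
  "out c C = {f \<in> Ar c. src c f = C}"

definition cat_iso ::
  "('o, 'a) cat \<Rightarrow> ('b, 'e) cat \<Rightarrow> ('o \<Rightarrow> 'b) \<Rightarrow> ('a \<Rightarrow> 'e) \<Rightarrow> bool" where
  "cat_iso c d Ko Ka \<longleftrightarrow> category c \<and> category d \<and>
     bij_betw Ko (Ob c) (Ob d) \<and> bij_betw Ka (Ar c) (Ar d) \<and>
     (\<forall>f\<in>Ar c. src d (Ka f) = Ko (src c f) \<and> tgt d (Ka f) = Ko (tgt c f)) \<and>
     (\<forall>C\<in>Ob c. Ka (ide c C) = ide d (Ko C)) \<and>
     (\<forall>f\<in>Ar c. \<forall>g\<in>Ar c. src c g = tgt c f \<longrightarrow> Ka (cmp c g f) = cmp d (Ka g) (Ka f))"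

text \<open>
  A functor \<open>X\<close> from \<open>c\<close> to sets is given by the disjoint union \<open>els X\<close> of its values, the map
  \<open>anch X\<close> sending an element of \<open>X(C)\<close> to \<open>C\<close>, and the action \<open>act X g x\<close> of the arrows \<open>g\<close>
  with source \<open>anch X x\<close>.  Literally this is a left coaction of the comonoid \<open>c\<close> on the constant
  polynomial \<open>els X\<close>, that is, a \<open>(c, 0)\<close>-bicomodule.
\<close>

record ('x, 'o, 'a) copsh =
  els :: "'x set"
  anch :: "'x \<Rightarrow> 'o"
  act :: "'a \<Rightarrow> 'x \<Rightarrow> 'x"

definition copresheaf :: "('o, 'a) cat \<Rightarrow> ('x, 'o, 'a) copsh \<Rightarrow> bool" where
  "copresheaf c X \<longleftrightarrow>
     (\<forall>x\<in>els X. anch X x \<in> Ob c \<and> act X (ide c (anch X x)) x = x) \<and>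
     (\<forall>x\<in>els X. \<forall>g\<in>out c (anch X x).
        act X g x \<in> els X \<and> anch X (act X g x) = tgt c g \<and>
        (\<forall>h\<in>out c (tgt c g). act X (cmp c h g) x = act X h (act X g x)))"

definition natural ::
  "('o, 'a) cat \<Rightarrow> ('x, 'o, 'a) copsh \<Rightarrow> ('y, 'o, 'a) copsh \<Rightarrow> ('x \<Rightarrow> 'y) \<Rightarrow> bool" where
  "natural c X Y f \<longleftrightarrow>
     (\<forall>x\<in>els X. f x \<in> els Y \<and> anch Y (f x) = anch X x \<and>
        (\<forall>g\<in>out c (anch X x). f (act X g x) = act Y g (f x)))"

text \<open>Morphisms are made extensional, so that they are equal as functions exactly if they agree
  on \<open>els X\<close>.\<close>

definition Hom ::
  "('o, 'a) cat \<Rightarrow> ('x, 'o, 'a) copsh \<Rightarrow> ('y, 'o, 'a) copsh \<Rightarrow> ('x \<Rightarrow> 'y) set" where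
  "Hom c X Y = {f \<in> extensional (els X). natural c X Y f}"

section \<open>Polynomials\<close>

text \<open>
  The polynomial \<open>\<Sum>I. y^p[I]\<close>.  By the Yoneda lemma a natural transformation from \<open>p\<close> to \<open>q\<close> is
  a function \<open>fwd\<close> on positions together with functions \<open>bwd I\<close> from \<open>q[fwd I]\<close> to \<open>p[I]\<close>.
\<close>

record ('p, 'd) poly =
  pos :: "'p set"
  dir :: "'p \<Rightarrow> 'd set"

record ('p, 'd, 'q, 'e) lens =
  fwd :: "'p \<Rightarrow> 'q"
  bwd :: "'p \<Rightarrow> 'e \<Rightarrow> 'd"

definition is_lens ::
  "('p, 'd, 'r) poly_scheme \<Rightarrow> ('q, 'e, 's) poly_scheme \<Rightarrow> ('p, 'd, 'q, 'e) lens \<Rightarrow> bool" where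
  "is_lens p q \<phi> \<longleftrightarrow> fwd \<phi> \<in> pos p \<rightarrow>\<^sub>E pos q \<and>
     bwd \<phi> \<in> (\<Pi>\<^sub>E I\<in>pos p. dir q (fwd \<phi> I) \<rightarrow>\<^sub>E dir p I)"

text \<open>
  Composites below are not normalised outside the carriers; \<open>lens_eq p q\<close> is equality of
  morphisms from \<open>p\<close> to \<open>q\<close>, and for extensional morphisms (\<open>is_lens\<close>) it coincides with \<open>=\<close>.
\<close>

definition lens_eq ::
  "('p, 'd, 'r) poly_scheme \<Rightarrow> ('q, 'e, 's) poly_scheme \<Rightarrow>
   ('p, 'd, 'q, 'e) lens \<Rightarrow> ('p, 'd, 'q, 'e) lens \<Rightarrow> bool" where
  "lens_eq p q \<phi> \<psi> \<longleftrightarrow>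
     (\<forall>I\<in>pos p. fwd \<phi> I = fwd \<psi> I \<and> (\<forall>y\<in>dir q (fwd \<phi> I). bwd \<phi> I y = bwd \<psi> I y))"

definition restrict_lens ::
  "('p, 'd, 'r) poly_scheme \<Rightarrow> ('q, 'e, 's) poly_scheme \<Rightarrow>
   ('p, 'd, 'q, 'e) lens \<Rightarrow> ('p, 'd, 'q, 'e) lens" where
  "restrict_lens p q \<phi> = \<lparr>fwd = (\<lambda>I\<in>pos p. fwd \<phi> I),
                          bwd = (\<lambda>I\<in>pos p. \<lambda>y\<in>dir q (fwd \<phi> I). bwd \<phi> I y)\<rparr>"

definition idl :: "('p, 'd, 'p, 'd) lens" where
  "idl = \<lparr>fwd = (\<lambda>I. I), bwd = (\<lambda>I x. x)\<rparr>"

definition lcomp ::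
  "('q, 'e, 'r, 'f) lens \<Rightarrow> ('p, 'd, 'q, 'e) lens \<Rightarrow> ('p, 'd, 'r, 'f) lens" (infixr \<open>\<odot>\<close> 55) where
  "\<psi> \<odot> \<phi> = \<lparr>fwd = (\<lambda>I. fwd \<psi> (fwd \<phi> I)), bwd = (\<lambda>I z. bwd \<phi> I (bwd \<psi> (fwd \<phi> I) z))\<rparr>"

subsection \<open>The composition product and its comonoids\<close>

definition ypoly :: "(unit, unit) poly" where
  "ypoly = \<lparr>pos = UNIV, dir = (\<lambda>_. UNIV)\<rparr>"

definition pcomp ::
  "('p, 'd, 'r) poly_scheme \<Rightarrow> ('q, 'e, 's) poly_scheme \<Rightarrow> ('p \<times> ('d \<Rightarrow> 'q), 'd \<times> 'e) poly" where
  "pcomp p q = \<lparr>pos = (SIGMA I:pos p. dir p I \<rightarrow>\<^sub>E pos q),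
                dir = (\<lambda>(I, f). SIGMA x:dir p I. dir q (f x))\<rparr>"

text \<open>The composition product of \<open>\<chi>\<close>, with codomain \<open>p'\<close>, and \<open>\<psi>\<close>.\<close>

definition pcomp_map ::
  "('p', 'd', 'r) poly_scheme \<Rightarrow> ('p, 'd, 'p', 'd') lens \<Rightarrow> ('q, 'e, 'q', 'e') lens \<Rightarrow>
   ('p \<times> ('d \<Rightarrow> 'q), 'd \<times> 'e, 'p' \<times> ('d' \<Rightarrow> 'q'), 'd' \<times> 'e') lens" where
  "pcomp_map p' \<chi> \<psi> =
     \<lparr>fwd = (\<lambda>(I, f). (fwd \<chi> I, \<lambda>x\<in>dir p' (fwd \<chi> I). fwd \<psi> (f (bwd \<chi> I x)))),
      bwd = (\<lambda>(I, f) (x, y). (bwd \<chi> I x, bwd \<psi> (f (bwd \<chi> I x)) y))\<rparr>"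

definition pcomp_lunit :: "(unit \<times> (unit \<Rightarrow> 'p), unit \<times> 'd, 'p, 'd) lens" where
  "pcomp_lunit = \<lparr>fwd = (\<lambda>(_, f). f ()), bwd = (\<lambda>_ x. ((), x))\<rparr>"

definition pcomp_runit :: "('p \<times> ('d \<Rightarrow> unit), 'd \<times> unit, 'p, 'd) lens" where
  "pcomp_runit = \<lparr>fwd = fst, bwd = (\<lambda>_ x. (x, ()))\<rparr>"

definition pcomp_assoc ::
  "('p, 'd, 'r) poly_scheme \<Rightarrow> ('q, 'e, 's) poly_scheme \<Rightarrow>
   (('p \<times> ('d \<Rightarrow> 'q)) \<times> ('d \<times> 'e \<Rightarrow> 't), ('d \<times> 'e) \<times> 'f,
    'p \<times> ('d \<Rightarrow> 'q \<times> ('e \<Rightarrow> 't)), 'd \<times> ('e \<times> 'f)) lens" where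
  "pcomp_assoc p q =
     \<lparr>fwd = (\<lambda>((I, f), g). (I, \<lambda>x\<in>dir p I. (f x, \<lambda>y\<in>dir q (f x). g (x, y)))),
      bwd = (\<lambda>_ (x, y, z). ((x, y), z))\<rparr>"

record ('p, 'd) comon = "('p, 'd) poly" +
  counit :: "('p, 'd, unit, unit) lens"
  comult :: "('p, 'd, 'p \<times> ('d \<Rightarrow> 'p), 'd \<times> 'd) lens"

definition comonoid :: "('p, 'd) comon \<Rightarrow> bool" where
  "comonoid e \<longleftrightarrow>
     is_lens e ypoly (counit e) \<and> is_lens e (pcomp e e) (comult e) \<and>
     lens_eq e e (pcomp_lunit \<odot> pcomp_map ypoly (counit e) idl \<odot> comult e) idl \<and>
     lens_eq e e (pcomp_runit \<odot> pcomp_map e idl (counit e) \<odot> comult e) idl \<and>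
     lens_eq e (pcomp e (pcomp e e))
       (pcomp_assoc e e \<odot> pcomp_map (pcomp e e) (comult e) idl \<odot> comult e)
       (pcomp_map e idl (comult e) \<odot> comult e)"

definition cat_poly :: "('o, 'a) cat \<Rightarrow> ('o, 'a) poly" where
  "cat_poly c = \<lparr>pos = Ob c, dir = out c\<rparr>"

definition comonoid_of_cat :: "('o, 'a) cat \<Rightarrow> ('o, 'a) comon" where
  "comonoid_of_cat c =
     \<lparr>pos = Ob c, dir = out c,
      counit = restrict_lens (cat_poly c) ypoly
        \<lparr>fwd = (\<lambda>_. ()), bwd = (\<lambda>C _. ide c C)\<rparr>,
      comult = restrict_lens (cat_poly c) (pcomp (cat_poly c) (cat_poly c))
        \<lparr>fwd = (\<lambda>C. (C, \<lambda>f\<in>out c C. tgt c f)), bwd = (\<lambda>C (f, g). cmp c g f)\<rparr>\<rparr>"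

text \<open>The category corresponding to a comonoid.  Since the sets \<open>e[C]\<close> need not be disjoint, its
  arrows are the pairs of a position and a direction.\<close>

definition cat_of_comonoid :: "('p, 'd) comon \<Rightarrow> ('p, 'p \<times> 'd) cat" where
  "cat_of_comonoid e =
     \<lparr>Ob = pos e, Ar = (SIGMA C:pos e. dir e C), src = fst,
      tgt = (\<lambda>(C, f). snd (fwd (comult e) C) f),
      ide = (\<lambda>C. (C, bwd (counit e) C ())),
      cmp = (\<lambda>(D, g) (C, f). (C, bwd (comult e) C (f, g)))\<rparr>"

text \<open>Cofunctors (comonoid homomorphisms): \<open>fwd F\<close> is the function on objects and
  \<open>bwd F A g\<close> the lift to \<open>A\<close> of an arrow \<open>g\<close> out of \<open>fwd F A\<close>.\<close>

definition cofunctor :: "('b, 'e) cat \<Rightarrow> ('o, 'a) cat \<Rightarrow> ('b, 'e, 'o, 'a) lens \<Rightarrow> bool" where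
  "cofunctor a c F \<longleftrightarrow> is_lens (cat_poly a) (cat_poly c) F \<and>
     (\<forall>A\<in>Ob a. bwd F A (ide c (fwd F A)) = ide a A) \<and>
     (\<forall>A\<in>Ob a. \<forall>g\<in>out c (fwd F A).
        fwd F (tgt a (bwd F A g)) = tgt c g \<and>
        (\<forall>h\<in>out c (tgt c g).
           bwd F A (cmp c h g) = cmp a (bwd F (tgt a (bwd F A g)) h) (bwd F A g)))"

definition cof_of_iso ::
  "('o, 'a) cat \<Rightarrow> ('o \<Rightarrow> 'b) \<Rightarrow> ('a \<Rightarrow> 'e) \<Rightarrow> ('o, 'a, 'b, 'e) lens" where
  "cof_of_iso c Ko Ka = \<lparr>fwd = Ko, bwd = (\<lambda>C. inv_into (out c C) Ka)\<rparr>"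

definition cof_of_inv_iso ::
  "('o, 'a) cat \<Rightarrow> ('o \<Rightarrow> 'b) \<Rightarrow> ('a \<Rightarrow> 'e) \<Rightarrow> ('b, 'e, 'o, 'a) lens" where
  "cof_of_inv_iso c Ko Ka = \<lparr>fwd = inv_into (Ob c) Ko, bwd = (\<lambda>_. Ka)\<rparr>"

text \<open>The two directions of the isomorphism between the carrier of a comonoid \<open>e\<close> and that of
  \<open>cat_of_comonoid e\<close>.\<close>

definition tag :: "('p, 'p \<times> 'd, 'p, 'd) lens" where
  "tag = \<lparr>fwd = (\<lambda>C. C), bwd = (\<lambda>C f. (C, f))\<rparr>"

definition untag :: "('p, 'd, 'p, 'p \<times> 'd) lens" where
  "untag = \<lparr>fwd = (\<lambda>C. C), bwd = (\<lambda>_. snd)\<rparr>"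

section \<open>Bicomodules\<close>

text \<open>
  A \<open>(c, d)\<close>-bicomodule is a polynomial \<open>p\<close> with coactions \<open>p \<rightarrow> c \<triangleleft> p\<close> and \<open>p \<rightarrow> p \<triangleleft> d\<close>.
  Written out, the left coaction sends a position \<open>I\<close> to an object \<open>anc p I\<close> of \<open>c\<close> and to the
  positions \<open>push p g I\<close>, for \<open>g\<close> an arrow out of \<open>anc p I\<close>, with maps \<open>pull p g I\<close> from
  \<open>p[push p g I]\<close> to \<open>p[I]\<close>; the right coaction sends a direction \<open>x\<close> at \<open>I\<close> to an object
  \<open>danc p I x\<close> of \<open>d\<close> and gives directions \<open>dact p I g x\<close> for \<open>g\<close> an arrow out of \<open>danc p I x\<close>.
  In terms of the familial functor: \<open>poss p\<close> is the functor \<open>p_(-)(1)\<close> from \<open>c\<close> to sets, and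
  \<open>dirs p\<close>, with \<open>pull p\<close>, is the functor \<open>p[-]\<close> from the opposite of its category of elements
  to \<open>d\<close>-copresheaves.
\<close>

record ('p, 'd, 'co, 'ca, 'do, 'da) bimod = "('p, 'd) poly" +
  anc :: "'p \<Rightarrow> 'co"
  push :: "'ca \<Rightarrow> 'p \<Rightarrow> 'p"
  pull :: "'ca \<Rightarrow> 'p \<Rightarrow> 'd \<Rightarrow> 'd"
  danc :: "'p \<Rightarrow> 'd \<Rightarrow> 'do"
  dact :: "'p \<Rightarrow> 'da \<Rightarrow> 'd \<Rightarrow> 'd"

definition poss :: "('p, 'd, 'co, 'ca, 'do, 'da) bimod \<Rightarrow> ('p, 'co, 'ca) copsh" where
  "poss p = \<lparr>els = pos p, anch = anc p, act = push p\<rparr>"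

definition dirs :: "('p, 'd, 'co, 'ca, 'do, 'da) bimod \<Rightarrow> 'p \<Rightarrow> ('d, 'do, 'da) copsh" where
  "dirs p I = \<lparr>els = dir p I, anch = danc p I, act = dact p I\<rparr>"

definition bicomodule ::
  "('co, 'ca) cat \<Rightarrow> ('do, 'da) cat \<Rightarrow> ('p, 'd, 'co, 'ca, 'do, 'da) bimod \<Rightarrow> bool" where
  "bicomodule c d p \<longleftrightarrow>
     copresheaf c (poss p) \<and> (\<forall>I\<in>pos p. copresheaf d (dirs p I)) \<and>
     (\<forall>I\<in>pos p. \<forall>x\<in>dir p I. pull p (ide c (anc p I)) I x = x) \<and>
     (\<forall>I\<in>pos p. \<forall>g\<in>out c (anc p I).
        natural d (dirs p (push p g I)) (dirs p I) (pull p g I) \<and>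
        (\<forall>h\<in>out c (tgt c g). \<forall>x\<in>dir p (push p h (push p g I)).
           pull p (cmp c h g) I x = pull p g I (pull p h (push p g I) x)))"

text \<open>Morphisms of bicomodules are morphisms of polynomials commuting with both coactions.\<close>

definition bimod_hom ::
  "('co, 'ca) cat \<Rightarrow> ('do, 'da) cat \<Rightarrow> ('p, 'd, 'co, 'ca, 'do, 'da) bimod \<Rightarrow>
   ('q, 'e, 'co, 'ca, 'do, 'da) bimod \<Rightarrow> ('p, 'd, 'q, 'e) lens \<Rightarrow> bool" where
  "bimod_hom c d p q \<phi> \<longleftrightarrow>
     is_lens p q \<phi> \<and> natural c (poss p) (poss q) (fwd \<phi>) \<and>
     (\<forall>I\<in>pos p. natural d (dirs q (fwd \<phi> I)) (dirs p I) (bwd \<phi> I)) \<and>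
     (\<forall>I\<in>pos p. \<forall>g\<in>out c (anc p I). \<forall>y\<in>dir q (push q g (fwd \<phi> I)).
        bwd \<phi> I (pull q g (fwd \<phi> I) y) = pull p g I (bwd \<phi> (push p g I) y))"

text \<open>
  A transformation of familial functors is cartesian iff its maps on directions are invertible:
  the naturality square at \<open>X \<rightarrow> 1\<close> is a pullback iff, for all \<open>I\<close>, precomposition with \<open>bwd \<phi> I\<close>
  is a bijection from \<open>Hom(p[I], X)\<close> to \<open>Hom(q[fwd \<phi> I], X)\<close>.  This form avoids a quantification
  over copresheaves \<open>X\<close> of all types.
\<close>

definition cartesian ::
  "('p, 'd, 'r) poly_scheme \<Rightarrow> ('q, 'e, 's) poly_scheme \<Rightarrow> ('p, 'd, 'q, 'e) lens \<Rightarrow> bool" where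
  "cartesian p q \<phi> \<longleftrightarrow> (\<forall>I\<in>pos p. bij_betw (bwd \<phi> I) (dir q (fwd \<phi> I)) (dir p I))"

definition unit_bimod :: "('o, 'a) cat \<Rightarrow> ('o, 'a, 'o, 'a, 'o, 'a) bimod" where
  "unit_bimod c =
     \<lparr>pos = Ob c, dir = out c, anc = (\<lambda>C. C), push = (\<lambda>g C. tgt c g),
      pull = (\<lambda>g C h. cmp c h g), danc = (\<lambda>C. tgt c), dact = (\<lambda>C g h. cmp c g h)\<rparr>"

subsection \<open>Composition of bicomodules\<close>

text \<open>
  The equalizer of the two maps from \<open>p \<triangleleft> q\<close> to \<open>p \<triangleleft> d \<triangleleft> q\<close>.  On positions it consists of the
  \<open>(I, f)\<close> at which the two maps agree, that is, for which \<open>f\<close> is a morphism of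
  \<open>d\<close>-copresheaves.  Equalizers of polynomials are coequalizers on directions: the two maps send
  the direction \<open>(x, g, y)\<close> of \<open>p \<triangleleft> d \<triangleleft> q\<close> to the two components of the pairs in \<open>glue\<close>, and
  the directions are the classes of the equivalence relation generated by \<open>glue\<close>.
\<close>

definition glue ::
  "('do, 'da) cat \<Rightarrow> ('p, 'x, 'co, 'ca, 'do, 'da) bimod \<Rightarrow> ('q, 'y, 'do, 'da, 'eo, 'ea) bimod \<Rightarrow>
   'p \<times> ('x \<Rightarrow> 'q) \<Rightarrow> (('x \<times> 'y) \<times> ('x \<times> 'y)) set" where
  "glue d p q = (\<lambda>(I, f).
     {((x, pull q g (f x) y), (dact p I g x, y)) | x g y.
        x \<in> dir p I \<and> g \<in> out d (danc p I x) \<and> y \<in> dir q (f (dact p I g x))})"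

definition cls ::
  "('do, 'da) cat \<Rightarrow> ('p, 'x, 'co, 'ca, 'do, 'da) bimod \<Rightarrow> ('q, 'y, 'do, 'da, 'eo, 'ea) bimod \<Rightarrow>
   'p \<times> ('x \<Rightarrow> 'q) \<Rightarrow> 'x \<times> 'y \<Rightarrow> ('x \<times> 'y) set" where
  "cls d p q J z = (glue d p q J \<union> (glue d p q J)\<inverse>)\<^sup>* `` {z}"

text \<open>The value on a class \<open>K\<close> of the function induced by \<open>k\<close>, which is constant on \<open>K\<close> in all
  uses below.\<close>

definition on_class :: "('z \<Rightarrow> 'w) \<Rightarrow> 'z set \<Rightarrow> 'w" where
  "on_class k K = the_elem (k ` K)"

definition bicomp ::
  "('p, 'x, 'co, 'ca, 'do, 'da) bimod \<Rightarrow> ('do, 'da) cat \<Rightarrow> ('q, 'y, 'do, 'da, 'eo, 'ea) bimod \<Rightarrow>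
   ('p \<times> ('x \<Rightarrow> 'q), ('x \<times> 'y) set, 'co, 'ca, 'eo, 'ea) bimod"
  (\<open>_ \<triangleleft>\<^bsub>_\<^esub> _\<close> [66, 0, 65] 65) where
  "p \<triangleleft>\<^bsub>d\<^esub> q =
     \<lparr>pos = (SIGMA I:pos p. Hom d (dirs p I) (poss q)),
      dir = (\<lambda>(I, f). cls d p q (I, f) ` (SIGMA x:dir p I. dir q (f x))),
      anc = (\<lambda>(I, f). anc p I),
      push = (\<lambda>g (I, f). (push p g I, \<lambda>x\<in>dir p (push p g I). f (pull p g I x))),
      pull = (\<lambda>g (I, f). on_class (\<lambda>(x, y). cls d p q (I, f) (pull p g I x, y))),
      danc = (\<lambda>(I, f). on_class (\<lambda>(x, y). danc q (f x) y)),
      dact = (\<lambda>(I, f) h. on_class (\<lambda>(x, y). cls d p q (I, f) (x, dact q (f x) h y)))\<rparr>"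

text \<open>The horizontal composite of \<open>\<chi>\<close>, from \<open>p\<close> to \<open>p'\<close>, and \<open>\<psi>\<close>, with domain \<open>q\<close>.\<close>

definition bicomp_map ::
  "('do, 'da) cat \<Rightarrow> ('p, 'x, 'co, 'ca, 'do, 'da) bimod \<Rightarrow> ('p', 'x', 'co, 'ca, 'do, 'da) bimod \<Rightarrow>
   ('q, 'y, 'do, 'da, 'eo, 'ea) bimod \<Rightarrow> ('p, 'x, 'p', 'x') lens \<Rightarrow> ('q, 'y, 'q', 'y') lens \<Rightarrow>
   ('p \<times> ('x \<Rightarrow> 'q), ('x \<times> 'y) set, 'p' \<times> ('x' \<Rightarrow> 'q'), ('x' \<times> 'y') set) lens" where
  "bicomp_map d p p' q \<chi> \<psi> =
     \<lparr>fwd = (\<lambda>(I, f). (fwd \<chi> I, \<lambda>x\<in>dir p' (fwd \<chi> I). fwd \<psi> (f (bwd \<chi> I x)))),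
      bwd = (\<lambda>(I, f). on_class (\<lambda>(x, y).
               cls d p q (I, f) (bwd \<chi> I x, bwd \<psi> (f (bwd \<chi> I x)) y)))\<rparr>"

text \<open>\<open>p \<triangleleft> \<psi>\<close> for \<open>\<psi>\<close> with domain \<open>q\<close>, and \<open>\<chi> \<triangleleft> q\<close> for \<open>\<chi>\<close> from \<open>p\<close> to \<open>p'\<close>.\<close>

abbreviation whisk_l where
  "whisk_l d p q \<psi> \<equiv> bicomp_map d p p q idl \<psi>"

abbreviation whisk_r where
  "whisk_r d p p' \<chi> q \<equiv> bicomp_map d p p' q \<chi> idl"

text \<open>The structure isomorphisms
  \<open>(p \<triangleleft> q) \<triangleleft> r \<cong> p \<triangleleft> (q \<triangleleft> r)\<close>, \<open>c \<triangleleft> p \<cong> p\<close>, \<open>p \<cong> c \<triangleleft> p\<close> and \<open>p \<cong> p \<triangleleft> d\<close>, in this direction.\<close>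

definition bi_assoc ::
  "('do, 'da) cat \<Rightarrow> ('eo, 'ea) cat \<Rightarrow> ('p, 'x, 'co, 'ca, 'do, 'da) bimod \<Rightarrow>
   ('q, 'y, 'do, 'da, 'eo, 'ea) bimod \<Rightarrow> ('r, 'z, 'eo, 'ea, 'fo, 'fa) bimod \<Rightarrow>
   (('p \<times> ('x \<Rightarrow> 'q)) \<times> (('x \<times> 'y) set \<Rightarrow> 'r), (('x \<times> 'y) set \<times> 'z) set,
    'p \<times> ('x \<Rightarrow> 'q \<times> ('y \<Rightarrow> 'r)), ('x \<times> ('y \<times> 'z) set) set) lens" where
  "bi_assoc d e p q r =
     \<lparr>fwd = (\<lambda>((I, f), g).
        (I, \<lambda>x\<in>dir p I. (f x, \<lambda>y\<in>dir q (f x). g (cls d p q (I, f) (x, y))))),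
      bwd = (\<lambda>((I, f), g). on_class (\<lambda>(x, K). on_class (\<lambda>(y, z).
        cls e (p \<triangleleft>\<^bsub>d\<^esub> q) r ((I, f), g) (cls d p q (I, f) (x, y), z)) K))\<rparr>"

definition bi_lunit ::
  "('o, 'a) cat \<Rightarrow> ('p, 'x, 'o, 'a, 'do, 'da) bimod \<Rightarrow>
   ('o \<times> ('a \<Rightarrow> 'p), ('a \<times> 'x) set, 'p, 'x) lens" where
  "bi_lunit c p =
     \<lparr>fwd = (\<lambda>(C, f). f (ide c C)),
      bwd = (\<lambda>(C, f) x. cls c (unit_bimod c) p (C, f) (ide c C, x))\<rparr>"

definition bi_lunit_inv ::
  "('o, 'a) cat \<Rightarrow> ('p, 'x, 'o, 'a, 'do, 'da) bimod \<Rightarrow>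
   ('p, 'x, 'o \<times> ('a \<Rightarrow> 'p), ('a \<times> 'x) set) lens" where
  "bi_lunit_inv c p =
     \<lparr>fwd = (\<lambda>I. (anc p I, \<lambda>g\<in>out c (anc p I). push p g I)),
      bwd = (\<lambda>I. on_class (\<lambda>(g, x). pull p g I x))\<rparr>"

definition bi_runit_inv ::
  "('p, 'x, 'co, 'ca, 'o, 'a) bimod \<Rightarrow>
   ('p, 'x, 'p \<times> ('x \<Rightarrow> 'o), ('x \<times> 'a) set) lens" where
  "bi_runit_inv p =
     \<lparr>fwd = (\<lambda>I. (I, \<lambda>x\<in>dir p I. danc p I x)),
      bwd = (\<lambda>I. on_class (\<lambda>(x, g). dact p I g x))\<rparr>"

subsection \<open>Familial functors\<close>

text \<open>The copresheaf \<open>p(X)\<close> has \<open>\<Sum>I. Hom(p[I], X)\<close> as its set of elements.\<close>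

definition app ::
  "('do, 'da) cat \<Rightarrow> ('p, 'd, 'co, 'ca, 'do, 'da) bimod \<Rightarrow> ('x, 'do, 'da) copsh \<Rightarrow>
   ('p \<times> ('d \<Rightarrow> 'x), 'co, 'ca) copsh" where
  "app d p X =
     \<lparr>els = (SIGMA I:pos p. Hom d (dirs p I) X),
      anch = (\<lambda>(I, h). anc p I),
      act = (\<lambda>g (I, h). (push p g I, \<lambda>x\<in>dir p (push p g I). h (pull p g I x)))\<rparr>"

definition app_map ::
  "('p, 'd, 'co, 'ca, 'do, 'da) bimod \<Rightarrow> ('x \<Rightarrow> 'y) \<Rightarrow> 'p \<times> ('d \<Rightarrow> 'x) \<Rightarrow> 'p \<times> ('d \<Rightarrow> 'y)" where
  "app_map p f = (\<lambda>(I, h). (I, \<lambda>x\<in>dir p I. f (h x)))"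

text \<open>The component, from \<open>p(X)\<close> to \<open>q(X)\<close>, of the natural transformation given by \<open>\<phi>\<close>.\<close>

definition component ::
  "('q, 'e, 'co, 'ca, 'do, 'da) bimod \<Rightarrow> ('p, 'd, 'q, 'e) lens \<Rightarrow>
   'p \<times> ('d \<Rightarrow> 'x) \<Rightarrow> 'q \<times> ('e \<Rightarrow> 'x)" where
  "component q \<phi> = (\<lambda>(I, h). (fwd \<phi> I, \<lambda>y\<in>dir q (fwd \<phi> I). h (bwd \<phi> I y)))"

text \<open>The isomorphism from \<open>(p \<triangleleft> q)(X)\<close> to \<open>p(q(X))\<close>, and its inverse.\<close>

definition app_comp ::
  "('do, 'da) cat \<Rightarrow> ('p, 'd, 'co, 'ca, 'do, 'da) bimod \<Rightarrow> ('q, 'e, 'do, 'da, 'eo, 'ea) bimod \<Rightarrow>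
   ('p \<times> ('d \<Rightarrow> 'q)) \<times> (('d \<times> 'e) set \<Rightarrow> 'x) \<Rightarrow> 'p \<times> ('d \<Rightarrow> 'q \<times> ('e \<Rightarrow> 'x))" where
  "app_comp d p q = (\<lambda>((I, f), h).
     (I, \<lambda>x\<in>dir p I. (f x, \<lambda>y\<in>dir q (f x). h (cls d p q (I, f) (x, y)))))"

definition app_comp_inv ::
  "('do, 'da) cat \<Rightarrow> ('p, 'd, 'co, 'ca, 'do, 'da) bimod \<Rightarrow> ('q, 'e, 'do, 'da, 'eo, 'ea) bimod \<Rightarrow>
   'p \<times> ('d \<Rightarrow> 'q \<times> ('e \<Rightarrow> 'x)) \<Rightarrow> ('p \<times> ('d \<Rightarrow> 'q)) \<times> (('d \<times> 'e) set \<Rightarrow> 'x)" where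
  "app_comp_inv d p q = (\<lambda>(I, k). let J = (I, \<lambda>x\<in>dir p I. fst (k x)) in
     (J, \<lambda>K\<in>dir (p \<triangleleft>\<^bsub>d\<^esub> q) J. on_class (\<lambda>(x, y). snd (k x) y) K))"

subsection \<open>Monads and comonads\<close>

definition familial_monad ::
  "('o, 'a) cat \<Rightarrow> ('i, 'd, 'o, 'a, 'o, 'a) bimod \<Rightarrow> ('o, 'a, 'i, 'd) lens \<Rightarrow>
   ('i \<times> ('d \<Rightarrow> 'i), ('d \<times> 'd) set, 'i, 'd) lens \<Rightarrow> bool" where
  "familial_monad c m \<eta> \<mu> \<longleftrightarrow>
     bicomodule c c m \<and>
     bimod_hom c c (unit_bimod c) m \<eta> \<and> bimod_hom c c (m \<triangleleft>\<^bsub>c\<^esub> m) m \<mu> \<and>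
     lens_eq m m (\<mu> \<odot> whisk_r c (unit_bimod c) m \<eta> m \<odot> bi_lunit_inv c m) idl \<and>
     lens_eq m m (\<mu> \<odot> whisk_l c m (unit_bimod c) \<eta> \<odot> bi_runit_inv m) idl \<and>
     lens_eq ((m \<triangleleft>\<^bsub>c\<^esub> m) \<triangleleft>\<^bsub>c\<^esub> m) m
       (\<mu> \<odot> whisk_r c (m \<triangleleft>\<^bsub>c\<^esub> m) m \<mu> m)
       (\<mu> \<odot> whisk_l c m (m \<triangleleft>\<^bsub>c\<^esub> m) \<mu> \<odot> bi_assoc c c m m m) \<and>
     cartesian (unit_bimod c) m \<eta> \<and> cartesian (m \<triangleleft>\<^bsub>c\<^esub> m) m \<mu>"

text \<open>
  The carrier comonoid of a comonad \<open>(e, \<epsilon>, \<delta>)\<close> on \<open>c\<close>: counit \<open>e \<rightarrow> c \<rightarrow> y\<close> and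
  comultiplication \<open>e \<rightarrow> e \<triangleleft>\<^bsub>c\<^esub> e \<rightarrow> e \<triangleleft> e\<close>, the last map being the inclusion of the equalizer.
\<close>

definition equalizer_incl ::
  "('do, 'da) cat \<Rightarrow> ('p, 'x, 'co, 'ca, 'do, 'da) bimod \<Rightarrow> ('q, 'y, 'do, 'da, 'eo, 'ea) bimod \<Rightarrow>
   ('p \<times> ('x \<Rightarrow> 'q), ('x \<times> 'y) set, 'p \<times> ('x \<Rightarrow> 'q), 'x \<times> 'y) lens" where
  "equalizer_incl d p q = \<lparr>fwd = (\<lambda>J. J), bwd = cls d p q\<rparr>"

definition carrier_comonoid ::
  "('o, 'a) cat \<Rightarrow> ('p, 'd, 'o, 'a, 'o, 'a) bimod \<Rightarrow> ('p, 'd, 'o, 'a) lens \<Rightarrow>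
   ('p, 'd, 'p \<times> ('d \<Rightarrow> 'p), ('d \<times> 'd) set) lens \<Rightarrow> ('p, 'd) comon" where
  "carrier_comonoid c e \<epsilon> \<delta> =
     \<lparr>pos = pos e, dir = dir e,
      counit = restrict_lens e ypoly (counit (comonoid_of_cat c) \<odot> \<epsilon>),
      comult = restrict_lens e (pcomp e e) (equalizer_incl c e e \<odot> \<delta>)\<rparr>"

text \<open>The comonad on \<open>c\<close> given by a cofunctor \<open>\<alpha>\<close> from \<open>a\<close> to \<open>c\<close>; its counit is \<open>\<alpha>\<close> itself.\<close>

definition cof_bimod ::
  "('b, 'e) cat \<Rightarrow> ('b, 'e, 'o, 'a) lens \<Rightarrow> ('b, 'e, 'o, 'a, 'o, 'a) bimod" where
  "cof_bimod a \<alpha> =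
     \<lparr>pos = Ob a, dir = out a, anc = fwd \<alpha>,
      push = (\<lambda>g A. tgt a (bwd \<alpha> A g)),
      pull = (\<lambda>g A h. cmp a h (bwd \<alpha> A g)),
      danc = (\<lambda>A h. fwd \<alpha> (tgt a h)),
      dact = (\<lambda>A g h. cmp a (bwd \<alpha> (tgt a h) g) h)\<rparr>"

definition cof_counit :: "('b, 'e, 'o, 'a) lens \<Rightarrow> ('b, 'e, 'o, 'a) lens" where
  "cof_counit \<alpha> = \<alpha>"

definition cof_comult :: "('b, 'e) cat \<Rightarrow> ('b, 'e, 'b \<times> ('e \<Rightarrow> 'b), ('e \<times> 'e) set) lens" where
  "cof_comult a =
     \<lparr>fwd = (\<lambda>A. (A, \<lambda>h\<in>out a A. tgt a h)), bwd = (\<lambda>A. on_class (\<lambda>(h, k). cmp a k h))\<rparr>"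

subsection \<open>The right coclosure\<close>

text \<open>For \<open>q\<close> a \<open>(d, e)\<close>-bicomodule and \<open>p\<close> a \<open>(c, e)\<close>-bicomodule, the left adjoint of
  \<open>- \<triangleleft>\<^bsub>d\<^esub> q\<close> at \<open>p\<close>, with the unit of the adjunction.\<close>

definition coclosure ::
  "('eo, 'ea) cat \<Rightarrow> ('q, 'y, 'do, 'da, 'eo, 'ea) bimod \<Rightarrow> ('p, 'x, 'co, 'ca, 'eo, 'ea) bimod \<Rightarrow>
   ('p, 'q \<times> ('y \<Rightarrow> 'x), 'co, 'ca, 'do, 'da) bimod" where
  "coclosure e q p =
     \<lparr>pos = pos p, dir = (\<lambda>I. els (app e q (dirs p I))), anc = anc p, push = push p,
      pull = (\<lambda>g I. app_map q (pull p g I)),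
      danc = (\<lambda>I. anch (app e q (dirs p I))),
      dact = (\<lambda>I. act (app e q (dirs p I)))\<rparr>"

definition coclosure_unit ::
  "('eo, 'ea) cat \<Rightarrow> ('q, 'y, 'do, 'da, 'eo, 'ea) bimod \<Rightarrow> ('p, 'x, 'co, 'ca, 'eo, 'ea) bimod \<Rightarrow>
   ('p, 'x, 'p \<times> ('q \<times> ('y \<Rightarrow> 'x) \<Rightarrow> 'q), (('q \<times> ('y \<Rightarrow> 'x)) \<times> 'y) set) lens" where
  "coclosure_unit e q p =
     \<lparr>fwd = (\<lambda>I. (I, \<lambda>z\<in>dir (coclosure e q p) I. fst z)),
      bwd = (\<lambda>I. on_class (\<lambda>((J, h), y). h y))\<rparr>"

section \<open>The comonad of a familial monad\<close>

text \<open>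
  The two conditions on a transformation \<open>\<phi>: m \<rightarrow> a \<triangleleft> m \<triangleleft> m\<close>, for a \<open>(c, c)\<close>-bicomodule \<open>a\<close> with
  maps \<open>\<epsilon>: a \<rightarrow> c\<close> and \<open>\<delta>: a \<rightarrow> a \<triangleleft> a\<close>:
  \<open>(\<epsilon> \<triangleleft> m \<triangleleft> m) \<circ> \<phi> = m \<triangleleft> \<eta>\<close> and \<open>(\<delta> \<triangleleft> m \<triangleleft> m) \<circ> \<phi> = (a \<triangleleft> a \<triangleleft> m \<triangleleft> \<mu>) \<circ> (a \<triangleleft> \<phi> \<triangleleft> m) \<circ> \<phi>\<close>.
  Iterated composites are bracketed to the right.
\<close>

definition counit_condition where
  "counit_condition c m \<eta> a \<epsilon> \<phi> \<longleftrightarrow>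
     lens_eq m (m \<triangleleft>\<^bsub>c\<^esub> m)
       (bi_lunit c (m \<triangleleft>\<^bsub>c\<^esub> m) \<odot> whisk_r c a (unit_bimod c) \<epsilon> (m \<triangleleft>\<^bsub>c\<^esub> m) \<odot> \<phi>)
       (whisk_l c m (unit_bimod c) \<eta> \<odot> bi_runit_inv m)"

definition comult_condition where
  "comult_condition c m \<mu> a \<delta> \<phi> \<longleftrightarrow>
     lens_eq m (a \<triangleleft>\<^bsub>c\<^esub> a \<triangleleft>\<^bsub>c\<^esub> m \<triangleleft>\<^bsub>c\<^esub> m)
       (bi_assoc c c a a (m \<triangleleft>\<^bsub>c\<^esub> m) \<odot> whisk_r c a (a \<triangleleft>\<^bsub>c\<^esub> a) \<delta> (m \<triangleleft>\<^bsub>c\<^esub> m) \<odot> \<phi>)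
       (whisk_l c a (a \<triangleleft>\<^bsub>c\<^esub> m \<triangleleft>\<^bsub>c\<^esub> m \<triangleleft>\<^bsub>c\<^esub> m)
          (whisk_l c a (m \<triangleleft>\<^bsub>c\<^esub> m \<triangleleft>\<^bsub>c\<^esub> m) (whisk_l c m (m \<triangleleft>\<^bsub>c\<^esub> m) \<mu>)) \<odot>
        whisk_l c a (a \<triangleleft>\<^bsub>c\<^esub> (m \<triangleleft>\<^bsub>c\<^esub> m) \<triangleleft>\<^bsub>c\<^esub> m)
          (whisk_l c a ((m \<triangleleft>\<^bsub>c\<^esub> m) \<triangleleft>\<^bsub>c\<^esub> m) (bi_assoc c c m m m)) \<odot>
        whisk_l c a ((a \<triangleleft>\<^bsub>c\<^esub> m \<triangleleft>\<^bsub>c\<^esub> m) \<triangleleft>\<^bsub>c\<^esub> m) (bi_assoc c c a (m \<triangleleft>\<^bsub>c\<^esub> m) m) \<odot>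
        whisk_l c a (m \<triangleleft>\<^bsub>c\<^esub> m) (whisk_r c m (a \<triangleleft>\<^bsub>c\<^esub> m \<triangleleft>\<^bsub>c\<^esub> m) \<phi> m) \<odot>
        \<phi>)"

definition Lan ::
  "('o, 'a) cat \<Rightarrow> ('i, 'd, 'o, 'a, 'o, 'a) bimod \<Rightarrow>
   ('i, ('i \<times> ('d \<Rightarrow> 'i)) \<times> (('d \<times> 'd) set \<Rightarrow> 'd), 'o, 'a, 'o, 'a) bimod" where
  "Lan c m = coclosure c (m \<triangleleft>\<^bsub>c\<^esub> m) m"

definition Lan_unit where
  "Lan_unit c m = coclosure_unit c (m \<triangleleft>\<^bsub>c\<^esub> m) m"

text \<open>The unique maps \<open>\<epsilon>: L \<rightarrow> c\<close> and \<open>\<delta>: L \<rightarrow> L \<triangleleft> L\<close> adjoint to \<open>m \<triangleleft> \<eta>\<close> and to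
  \<open>(L \<triangleleft> L \<triangleleft> m \<triangleleft> \<mu>) \<circ> (L \<triangleleft> u \<triangleleft> m) \<circ> u\<close>, where the map adjoint to \<open>\<psi>: L \<rightarrow> r\<close> is
  \<open>(\<psi> \<triangleleft> m \<triangleleft> m) \<circ> u\<close>.\<close>

definition Lan_counit where
  "Lan_counit c m \<eta> = (THE \<epsilon>. bimod_hom c c (Lan c m) (unit_bimod c) \<epsilon> \<and>
     counit_condition c m \<eta> (Lan c m) \<epsilon> (Lan_unit c m))"

definition Lan_comult where
  "Lan_comult c m \<mu> = (THE \<delta>. bimod_hom c c (Lan c m) (Lan c m \<triangleleft>\<^bsub>c\<^esub> Lan c m) \<delta> \<and>
     comult_condition c m \<mu> (Lan c m) \<delta> (Lan_unit c m))"

definition Lan_comonoid where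
  "Lan_comonoid c m \<eta> \<mu> = carrier_comonoid c (Lan c m) (Lan_counit c m \<eta>) (Lan_comult c m \<mu>)"

section \<open>The theory category\<close>

definition unit_at ::
  "('o, 'a) cat \<Rightarrow> ('i, 'd, 'o, 'a, 'o, 'a) bimod \<Rightarrow> ('o, 'a, 'i, 'd) lens \<Rightarrow>
   ('x, 'o, 'a) copsh \<Rightarrow> 'x \<Rightarrow> 'i \<times> ('d \<Rightarrow> 'x)" where
  "unit_at c m \<eta> X x = component m \<eta> (anch X x, \<lambda>g\<in>out c (anch X x). act X g x)"

definition mult_at ::
  "('o, 'a) cat \<Rightarrow> ('i, 'd, 'o, 'a, 'o, 'a) bimod \<Rightarrow>
   ('i \<times> ('d \<Rightarrow> 'i), ('d \<times> 'd) set, 'i, 'd) lens \<Rightarrow>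
   'i \<times> ('d \<Rightarrow> 'i \<times> ('d \<Rightarrow> 'x)) \<Rightarrow> 'i \<times> ('d \<Rightarrow> 'x)" where
  "mult_at c m \<mu> z = component m \<mu> (app_comp_inv c m m z)"

text \<open>The full subcategory of the Kleisli category of \<open>m\<close> on the copresheaves \<open>m[M]\<close>.  An arrow
  \<open>(M', M, k)\<close> from \<open>M'\<close> to \<open>M\<close> consists of a morphism \<open>k\<close> from \<open>m[M']\<close> to \<open>m(m[M])\<close>.\<close>

definition Theta ::
  "('o, 'a) cat \<Rightarrow> ('i, 'd, 'o, 'a, 'o, 'a) bimod \<Rightarrow> ('o, 'a, 'i, 'd) lens \<Rightarrow>
   ('i \<times> ('d \<Rightarrow> 'i), ('d \<times> 'd) set, 'i, 'd) lens \<Rightarrow>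
   ('i, 'i \<times> 'i \<times> ('d \<Rightarrow> 'i \<times> ('d \<Rightarrow> 'd))) cat" where
  "Theta c m \<eta> \<mu> =
     \<lparr>Ob = pos m,
      Ar = {(M', M, k). M' \<in> pos m \<and> M \<in> pos m \<and>
              k \<in> Hom c (dirs m M') (app c m (dirs m M))},
      src = (\<lambda>(M', M, k). M'), tgt = (\<lambda>(M', M, k). M),
      ide = (\<lambda>M. (M, M, \<lambda>x\<in>dir m M. unit_at c m \<eta> (dirs m M) x)),
      cmp = (\<lambda>(M1', M1, k) (M2', M2, l).
              (M2', M1, \<lambda>x\<in>dir m M2'. mult_at c m \<mu> (app_map m k (l x))))\<rparr>"

text \<open>
  The functor from the category corresponding to the comonoid \<open>L\<close> to the opposite of \<open>Theta\<close>,
  on arrows; it is the identity on objects.  An arrow out of \<open>M\<close> is an element \<open>z\<close> of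
  \<open>(m \<triangleleft> m)(m[M])\<close>, hence of \<open>m(m(m[M]))\<close>, that is, some \<open>M'\<close> with a morphism from \<open>m[M']\<close> to
  \<open>m(m[M])\<close>.
\<close>

definition Theta_arr where
  "Theta_arr c m = (\<lambda>(M, z). let (M', k) = app_comp c m m z in (M', M, k))"

text \<open>The cofunctor from the opposite of \<open>Theta\<close> to \<open>c\<close>: the counit of \<open>L\<close>, transported along
  this isomorphism.\<close>

definition Theta_proj where
  "Theta_proj c m \<eta> \<mu> =
     restrict_lens (cat_poly (op_cat (Theta c m \<eta> \<mu>))) (cat_poly c)
       (Lan_counit c m \<eta> \<odot> tag \<odot>
        cof_of_inv_iso (cat_of_comonoid (Lan_comonoid c m \<eta> \<mu>)) (\<lambda>M. M) (Theta_arr c m))"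

text \<open>The map of bicomodules from \<open>L\<close> to \<open>a\<close> underlying a cofunctor \<open>F\<close> from the opposite of
  \<open>Theta\<close> to \<open>a\<close>, and the transformation \<open>(F \<triangleleft> m \<triangleleft> m) \<circ> u\<close> adjoint to it.\<close>

definition Theta_transpose where
  "Theta_transpose c m \<eta> \<mu> a \<alpha> F =
     restrict_lens m (cof_bimod a \<alpha> \<triangleleft>\<^bsub>c\<^esub> m \<triangleleft>\<^bsub>c\<^esub> m)
       (whisk_r c (Lan c m) (cof_bimod a \<alpha>)
          (F \<odot> cof_of_iso (cat_of_comonoid (Lan_comonoid c m \<eta> \<mu>)) (\<lambda>M. M) (Theta_arr c m) \<odot> untag)
          (m \<triangleleft>\<^bsub>c\<^esub> m) \<odot> Lan_unit c m)"

end

theory Submission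
  imports Defs
begin

text \<open>
  By Yoneda, a morphism of bicomodules is determined by the components of its natural transformation
  at the identities of the copresheaves \<open>p[I]\<close>.  Since \<open>(p \<triangleleft> q)(X)\<close> is naturally \<open>p(q(X))\<close>, evaluating
  components turns whiskering into functor application and makes the associators invisible.  The
  adjunction between \<open>- \<triangleleft> (m \<triangleleft> m)\<close> and the coclosure replaces \<open>\<phi>: m \<rightarrow> a \<triangleleft> m \<triangleleft> m\<close> by \<open>\<psi>: L \<rightarrow> a\<close>,
  and the directions of \<open>L\<close> at \<open>M\<close>, the elements of \<open>m(m(m[M]))\<close>, are exactly the Kleisli arrows
  \<open>m[M'] \<rightarrow> m(m[M])\<close>.  Evaluated in this way, the counit condition says that \<open>\<psi>\<close> lifts identities to
  identities, and the comultiplication condition that it lifts composites to Kleisli composites and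
  respects codomains.  For \<open>a = L\<close> and \<open>\<psi>\<close> the identity this determines the comonad structure of
  \<open>L\<close> to be that of the opposite theory category; for a cofunctor \<open>a \<rightarrow> c\<close> it says that \<open>\<psi>\<close> is a
  cofunctor over \<open>c\<close>.
\<close>

section \<open>Copresheaves and bicomodules\<close>

text \<open>The directions of \<open>p \<triangleleft> q\<close> are classes of a generated
  equivalence relation, and the composites in the two conditions nest such classes several deep;
  unfolding them would need a well-definedness argument at each level. So each structure map is
  checked on representatives once, against the natural transformation that it should induce. After
  that only nested elements, such as those of \<open>a(a(m(m(m[M]))))\<close>, are compared.
  Composites of lenses are not normalised. Maps of bicomodules are therefore handled up to
  \<open>lens_eq\<close> and without the extensionality in \<open>is_lens\<close>;
  \<open>restrict_lens\<close> restores it where lenses are compared as functions. The counit and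
  comultiplication of \<open>L\<close> are definite descriptions, so existence has to be shown as
  well as uniqueness. The witness is the comonad of the cofunctor from the opposite theory category
  to \<open>c\<close>, carried over to \<open>L\<close> along a bijection \<tau> on directions.
  Coassociativity of \<open>L\<close> is thus never computed with classes; it comes from
  associativity of Kleisli composition.\<close>

lemma poss_simps [simp]:
  "els (poss p) = pos p" "anch (poss p) = anc p" "act (poss p) = push p"
  by (simp_all add: poss_def)

lemma dirs_simps [simp]:
  "els (dirs p I) = dir p I" "anch (dirs p I) = danc p I" "act (dirs p I) = dact p I"
  by (simp_all add: dirs_def)

lemma restrict_eq_iff: "restrict f S = restrict g S \<longleftrightarrow> (\<forall>x\<in>S. f x = g x)"
  by (auto simp: fun_eq_iff restrict_def)

lemma copresheafD:
  assumes "copresheaf c X" "x \<in> els X"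
  shows "anch X x \<in> Ob c" "act X (ide c (anch X x)) x = x"
    and "g \<in> out c (anch X x) \<Longrightarrow> act X g x \<in> els X"
    and "g \<in> out c (anch X x) \<Longrightarrow> anch X (act X g x) = tgt c g"
    and "g \<in> out c (anch X x) \<Longrightarrow> h \<in> out c (tgt c g) \<Longrightarrow>
           act X (cmp c h g) x = act X h (act X g x)"
  using assms unfolding copresheaf_def by blast+

lemma naturalD:
  assumes "natural c X Y f" "x \<in> els X"
  shows "f x \<in> els Y" "anch Y (f x) = anch X x"
    and "g \<in> out c (anch X x) \<Longrightarrow> f (act X g x) = act Y g (f x)"
  using assms unfolding natural_def by blast+

lemma naturalI:
  assumes "\<And>x. x \<in> els X \<Longrightarrow> f x \<in> els Y" "\<And>x. x \<in> els X \<Longrightarrow> anch Y (f x) = anch X x"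
    and "\<And>x g. x \<in> els X \<Longrightarrow> g \<in> out c (anch X x) \<Longrightarrow> f (act X g x) = act Y g (f x)"
  shows "natural c X Y f"
  using assms unfolding natural_def by blast

lemma natural_comp:
  assumes "natural c X Y f" "natural c Y Z g"
  shows "natural c X Z (\<lambda>x. g (f x))"
  by (rule naturalI) (use assms in \<open>simp_all add: naturalD\<close>)

lemma natural_id: "natural c X X (\<lambda>x. x)"
  by (simp add: natural_def)

lemma natural_cong:
  assumes "copresheaf c X" "\<And>x. x \<in> els X \<Longrightarrow> f x = f' x"
  shows "natural c X Y f \<longleftrightarrow> natural c X Y f'"
  using assms unfolding natural_def by (simp add: copresheafD(3))

lemma natural_restrict:
  "copresheaf c X \<Longrightarrow> natural c X Y (restrict f (els X)) \<longleftrightarrow> natural c X Y f"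
  by (rule natural_cong) simp_all

lemma Hom_natural: "f \<in> Hom c X Y \<Longrightarrow> natural c X Y f"
  by (simp add: Hom_def)

lemmas HomD = naturalD [OF Hom_natural]

lemma Hom_restrict_eq: "f \<in> Hom c X Y \<Longrightarrow> restrict f (els X) = f"
  by (simp add: Hom_def extensional_restrict)

lemma Hom_dirs_restrict_eq: "f \<in> Hom c (dirs p I) Y \<Longrightarrow> restrict f (dir p I) = f"
  using Hom_restrict_eq [of f c "dirs p I"] by simp

lemma restrict_Hom:
  "copresheaf c X \<Longrightarrow> natural c X Y f \<Longrightarrow> restrict f (els X) \<in> Hom c X Y"
  by (simp add: Hom_def natural_restrict)

lemma Hom_dirsD:
  assumes "f \<in> Hom d (dirs p I) Y" "x \<in> dir p I"
  shows "f x \<in> els Y" "anch Y (f x) = danc p I x"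
    and "g \<in> out d (danc p I x) \<Longrightarrow> f (dact p I g x) = act Y g (f x)"
  using HomD [OF assms(1)] assms(2) by simp_all

lemma Hom_dirs_eqI:
  assumes "f \<in> Hom d (dirs p I) Y" "f' \<in> Hom d (dirs p I) Y" "\<And>x. x \<in> dir p I \<Longrightarrow> f x = f' x"
  shows "f = f'"
  using assms by (auto simp: Hom_def intro: extensionalityI)

lemma dirs_restrict_Hom:
  "copresheaf d (dirs p I) \<Longrightarrow> natural d (dirs p I) Y f \<Longrightarrow> restrict f (dir p I) \<in> Hom d (dirs p I) Y"
  using restrict_Hom [of d "dirs p I"] by simp

lemma category_out:
  assumes "category c"
  shows "C \<in> Ob c \<Longrightarrow> ide c C \<in> out c C" "C \<in> Ob c \<Longrightarrow> tgt c (ide c C) = C"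
    and "g \<in> out c C \<Longrightarrow> tgt c g \<in> Ob c"
    and "g \<in> out c C \<Longrightarrow> h \<in> out c (tgt c g) \<Longrightarrow> cmp c h g \<in> out c C"
    and "g \<in> out c C \<Longrightarrow> h \<in> out c (tgt c g) \<Longrightarrow> tgt c (cmp c h g) = tgt c h"
    and "g \<in> out c C \<Longrightarrow> cmp c g (ide c C) = g"
    and "g \<in> out c C \<Longrightarrow> cmp c (ide c (tgt c g)) g = g"
    and "g \<in> out c C \<Longrightarrow> h \<in> out c (tgt c g) \<Longrightarrow> k \<in> out c (tgt c h) \<Longrightarrow>
           cmp c k (cmp c h g) = cmp c (cmp c k h) g"
  using assms unfolding category_def out_def by auto

locale bicom =
  fixes c :: "('co, 'ca) cat" and d :: "('do, 'da) cat"
    and p :: "('p, 'x, 'co, 'ca, 'do, 'da) bimod"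
  assumes category_left: "category c" and category_right: "category d"
    and bicomodule: "bicomodule c d p"
begin

lemmas out_left = category_out [OF category_left]
lemmas out_right = category_out [OF category_right]

lemma copresheaf_poss: "copresheaf c (poss p)"
  and copresheaf_dirs: "I \<in> pos p \<Longrightarrow> copresheaf d (dirs p I)"
  using bicomodule by (simp_all add: bicomodule_def)

lemma natural_pull:
  "I \<in> pos p \<Longrightarrow> g \<in> out c (anc p I) \<Longrightarrow> natural d (dirs p (push p g I)) (dirs p I) (pull p g I)"
  using bicomodule by (simp add: bicomodule_def)

lemma push_simps [simp]:
  assumes "I \<in> pos p"
  shows "anc p I \<in> Ob c" "push p (ide c (anc p I)) I = I"
    and "g \<in> out c (anc p I) \<Longrightarrow> push p g I \<in> pos p"
    and "g \<in> out c (anc p I) \<Longrightarrow> anc p (push p g I) = tgt c g"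
    and "g \<in> out c (anc p I) \<Longrightarrow> h \<in> out c (tgt c g) \<Longrightarrow>
           push p (cmp c h g) I = push p h (push p g I)"
  using copresheafD [OF copresheaf_poss] assms by simp_all

lemma dact_simps [simp]:
  assumes "I \<in> pos p" "x \<in> dir p I"
  shows "danc p I x \<in> Ob d" "dact p I (ide d (danc p I x)) x = x"
    and "g \<in> out d (danc p I x) \<Longrightarrow> dact p I g x \<in> dir p I"
    and "g \<in> out d (danc p I x) \<Longrightarrow> danc p I (dact p I g x) = tgt d g"
    and "g \<in> out d (danc p I x) \<Longrightarrow> h \<in> out d (tgt d g) \<Longrightarrow>
           dact p I (cmp d h g) x = dact p I h (dact p I g x)"
  using copresheafD [OF copresheaf_dirs [OF assms(1)]] assms(2) by simp_all

lemma pull_simps [simp]: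
  assumes "I \<in> pos p" "g \<in> out c (anc p I)" "x \<in> dir p (push p g I)"
  shows "pull p g I x \<in> dir p I" "danc p I (pull p g I x) = danc p (push p g I) x"
    and "h \<in> out d (danc p (push p g I) x) \<Longrightarrow>
           pull p g I (dact p (push p g I) h x) = dact p I h (pull p g I x)"
  using naturalD [OF natural_pull [OF assms(1,2)]] assms(3) by simp_all

lemma ide_out [simp]:
  "I \<in> pos p \<Longrightarrow> ide c (anc p I) \<in> out c (anc p I)"
  "I \<in> pos p \<Longrightarrow> x \<in> dir p I \<Longrightarrow> ide d (danc p I x) \<in> out d (danc p I x)"
  by (simp_all add: out_left out_right)

lemma pull_ide [simp]: "I \<in> pos p \<Longrightarrow> x \<in> dir p I \<Longrightarrow> pull p (ide c (anc p I)) I x = x"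
  using bicomodule by (simp add: bicomodule_def)

lemma pull_cmp [simp]:
  "I \<in> pos p \<Longrightarrow> g \<in> out c (anc p I) \<Longrightarrow> h \<in> out c (tgt c g) \<Longrightarrow>
   x \<in> dir p (push p h (push p g I)) \<Longrightarrow>
   pull p (cmp c h g) I x = pull p g I (pull p h (push p g I) x)"
  using bicomodule by (simp add: bicomodule_def)

lemma pull_Hom:
  assumes "I \<in> pos p" "g \<in> out c (anc p I)" "h \<in> Hom d (dirs p I) X"
  shows "(\<lambda>x\<in>dir p (push p g I). h (pull p g I x)) \<in> Hom d (dirs p (push p g I)) X"
  using natural_comp [OF natural_pull [OF assms(1,2)] Hom_natural [OF assms(3)]] assms
  by (intro dirs_restrict_Hom copresheaf_dirs) simp_all

lemma comp_Hom:
  assumes "I \<in> pos p" "h \<in> Hom d (dirs p I) X" "natural d X Y f"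
  shows "(\<lambda>x\<in>dir p I. f (h x)) \<in> Hom d (dirs p I) Y"
  using natural_comp [OF Hom_natural [OF assms(2)] assms(3)] assms(1)
  by (intro dirs_restrict_Hom copresheaf_dirs)

lemma id_Hom: "I \<in> pos p \<Longrightarrow> (\<lambda>x\<in>dir p I. x) \<in> Hom d (dirs p I) (dirs p I)"
  by (intro dirs_restrict_Hom copresheaf_dirs natural_id)

lemma copresheaf_app: "copresheaf c (app d p X)"
  unfolding copresheaf_def
proof (intro ballI conjI)
  fix z assume "z \<in> els (app d p X)"
  then obtain I h where z: "z = (I, h)" "I \<in> pos p" "h \<in> Hom d (dirs p I) X"
    by (auto simp: app_def)
  show "anch (app d p X) z \<in> Ob c"
    using z by (simp add: app_def)
  show "act (app d p X) (ide c (anch (app d p X) z)) z = z"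
    using z by (auto simp: app_def Hom_dirs_restrict_eq cong: restrict_cong)
  fix g assume "g \<in> out c (anch (app d p X) z)"
  then have g: "g \<in> out c (anc p I)"
    using z by (simp add: app_def)
  show "act (app d p X) g z \<in> els (app d p X)"
    using z g pull_Hom by (simp add: app_def)
  show "anch (app d p X) (act (app d p X) g z) = tgt c g"
    using z g by (simp add: app_def)
  fix h assume "h \<in> out c (tgt c g)"
  then show "act (app d p X) (cmp c h g) z = act (app d p X) h (act (app d p X) g z)"
    using z g by (auto simp: app_def cong: restrict_cong)
qed

end

lemma els_app: "els (app d p X) = (SIGMA I:pos p. Hom d (dirs p I) X)"
  and anch_app [simp]: "anch (app d p X) (I, h) = anc p I"
  and act_app: "act (app d p X) g (I, h) =
    (push p g I, \<lambda>x\<in>dir p (push p g I). h (pull p g I x))"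
  by (simp_all add: app_def)

lemma mem_app_iff [simp]: "(I, h) \<in> els (app d p X) \<longleftrightarrow> I \<in> pos p \<and> h \<in> Hom d (dirs p I) X"
  by (simp add: els_app)

lemma app_elE:
  assumes "z \<in> els (app d p X)"
  obtains I h where "z = (I, h)" "I \<in> pos p" "h \<in> Hom d (dirs p I) X"
  using assms by (auto simp: els_app)

lemma app_map_Pair [simp]: "app_map p f (I, h) = (I, \<lambda>x\<in>dir p I. f (h x))"
  by (simp add: app_map_def)

lemma (in bicom) natural_app_map:
  assumes "natural d X Y f"
  shows "natural c (app d p X) (app d p Y) (app_map p f)"
  by (rule naturalI; elim app_elE)
    (auto simp: act_app comp_Hom [OF _ _ assms] cong: restrict_cong)

lemma app_map_comp: "app_map p f (app_map p g z) = app_map p (\<lambda>x. f (g x)) z"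
  by (cases z) (simp cong: restrict_cong)

lemma app_map_cong:
  assumes "z \<in> els (app d p X)" "\<And>x. x \<in> els X \<Longrightarrow> f x = f' x"
  shows "app_map p f z = app_map p f' z"
  using assms by (auto simp: els_app Hom_dirsD cong: restrict_cong)

lemma app_map_id: "z \<in> els (app d p X) \<Longrightarrow> app_map p (\<lambda>x. x) z = z"
  by (auto simp: els_app Hom_dirs_restrict_eq)

text \<open>The universal element of Yoneda: the identity of \<open>p[I]\<close>, in
  \<open>p(p[I])\<close>. Every \<open>(I, h)\<close> in \<open>p(X)\<close> is its image under
  \<open>app_map p h\<close>.\<close>

abbreviation gen where "gen p I \<equiv> (I, \<lambda>x\<in>dir p I. x)"

lemma (in bicom) gen_mem: "I \<in> pos p \<Longrightarrow> gen p I \<in> els (app d p (dirs p I))"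
  by (simp add: id_Hom)

section \<open>Maps of bicomodules\<close>

text \<open>\<open>bimod_hom\<close> without the extensionality of \<open>is_lens\<close>, so that
  it is closed under \<open>\<odot>\<close> and invariant under \<open>lens_eq\<close>; composites
  of lenses have arbitrary values outside the carriers.\<close>

definition bimod_map ::
  "('co, 'ca) cat \<Rightarrow> ('do, 'da) cat \<Rightarrow> ('p, 'd, 'co, 'ca, 'do, 'da) bimod \<Rightarrow>
   ('q, 'e, 'co, 'ca, 'do, 'da) bimod \<Rightarrow> ('p, 'd, 'q, 'e) lens \<Rightarrow> bool" where
  "bimod_map c d p q \<phi> \<longleftrightarrow>
     natural c (poss p) (poss q) (fwd \<phi>) \<and>
     (\<forall>I\<in>pos p. natural d (dirs q (fwd \<phi> I)) (dirs p I) (bwd \<phi> I)) \<and>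
     (\<forall>I\<in>pos p. \<forall>g\<in>out c (anc p I). \<forall>y\<in>dir q (push q g (fwd \<phi> I)).
        bwd \<phi> I (pull q g (fwd \<phi> I) y) = pull p g I (bwd \<phi> (push p g I) y))"

lemma bimod_hom_iff: "bimod_hom c d p q \<phi> \<longleftrightarrow> is_lens p q \<phi> \<and> bimod_map c d p q \<phi>"
  by (simp add: bimod_hom_def bimod_map_def)

lemma bimod_mapI:
  assumes "\<And>I. I \<in> pos p \<Longrightarrow> fwd \<phi> I \<in> pos q"
    and "\<And>I. I \<in> pos p \<Longrightarrow> anc q (fwd \<phi> I) = anc p I"
    and "\<And>I g. I \<in> pos p \<Longrightarrow> g \<in> out c (anc p I) \<Longrightarrow> fwd \<phi> (push p g I) = push q g (fwd \<phi> I)"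
    and "\<And>I y. I \<in> pos p \<Longrightarrow> y \<in> dir q (fwd \<phi> I) \<Longrightarrow> bwd \<phi> I y \<in> dir p I"
    and "\<And>I y. I \<in> pos p \<Longrightarrow> y \<in> dir q (fwd \<phi> I) \<Longrightarrow>
           danc p I (bwd \<phi> I y) = danc q (fwd \<phi> I) y"
    and "\<And>I y g. I \<in> pos p \<Longrightarrow> y \<in> dir q (fwd \<phi> I) \<Longrightarrow> g \<in> out d (danc q (fwd \<phi> I) y) \<Longrightarrow>
           bwd \<phi> I (dact q (fwd \<phi> I) g y) = dact p I g (bwd \<phi> I y)"
    and "\<And>I g y. I \<in> pos p \<Longrightarrow> g \<in> out c (anc p I) \<Longrightarrow> y \<in> dir q (push q g (fwd \<phi> I)) \<Longrightarrow>
           bwd \<phi> I (pull q g (fwd \<phi> I) y) = pull p g I (bwd \<phi> (push p g I) y)"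
  shows "bimod_map c d p q \<phi>"
  using assms unfolding bimod_map_def natural_def by simp

locale bimap = p: bicom c d p + q: bicom c d q
  for c :: "('co, 'ca) cat" and d :: "('do, 'da) cat"
    and p :: "('p, 'x, 'co, 'ca, 'do, 'da) bimod"
    and q :: "('q, 'y, 'co, 'ca, 'do, 'da) bimod" +
  fixes \<phi> :: "('p, 'x, 'q, 'y) lens"
  assumes bimod_map: "bimod_map c d p q \<phi>"
begin

lemma fwd_simps [simp]:
  assumes "I \<in> pos p"
  shows "fwd \<phi> I \<in> pos q" "anc q (fwd \<phi> I) = anc p I"
    and "g \<in> out c (anc p I) \<Longrightarrow> fwd \<phi> (push p g I) = push q g (fwd \<phi> I)"
  using bimod_map assms by (auto simp: bimod_map_def natural_def)

lemma natural_bwd: "I \<in> pos p \<Longrightarrow> natural d (dirs q (fwd \<phi> I)) (dirs p I) (bwd \<phi> I)"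
  using bimod_map by (auto simp: bimod_map_def)

lemma bwd_simps [simp]:
  assumes "I \<in> pos p" "y \<in> dir q (fwd \<phi> I)"
  shows "bwd \<phi> I y \<in> dir p I" "danc p I (bwd \<phi> I y) = danc q (fwd \<phi> I) y"
    and "g \<in> out d (danc q (fwd \<phi> I) y) \<Longrightarrow>
           bwd \<phi> I (dact q (fwd \<phi> I) g y) = dact p I g (bwd \<phi> I y)"
  using naturalD [OF natural_bwd [OF assms(1)]] assms(2) by simp_all

lemma bwd_pull [simp]:
  "I \<in> pos p \<Longrightarrow> g \<in> out c (anc p I) \<Longrightarrow> y \<in> dir q (push q g (fwd \<phi> I)) \<Longrightarrow>
   bwd \<phi> I (pull q g (fwd \<phi> I) y) = pull p g I (bwd \<phi> (push p g I) y)"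
  using bimod_map by (simp add: bimod_map_def)

lemma natural_fwd: "natural c (poss p) (poss q) (fwd \<phi>)"
  using bimod_map by (simp add: bimod_map_def)

lemma bwd_Hom:
  assumes "I \<in> pos p" "h \<in> Hom d (dirs p I) X"
  shows "(\<lambda>y\<in>dir q (fwd \<phi> I). h (bwd \<phi> I y)) \<in> Hom d (dirs q (fwd \<phi> I)) X"
  using natural_comp [OF natural_bwd [OF assms(1)] Hom_natural [OF assms(2)]] assms(1)
  by (intro dirs_restrict_Hom q.copresheaf_dirs) simp_all

end

lemma component_Pair [simp]:
  "component q \<phi> (I, h) = (fwd \<phi> I, \<lambda>y\<in>dir q (fwd \<phi> I). h (bwd \<phi> I y))"
  by (simp add: component_def)

text \<open>The compatibilities of \<open>fwd\<close> with \<open>push\<close> and of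
  \<open>bwd\<close> with \<open>pull\<close> are the two coordinates of naturality over
  \<open>c\<close>.\<close>

lemma (in bimap) natural_component: "natural c (app d p X) (app d q X) (component q \<phi>)"
proof (rule naturalI; elim app_elE)
  fix z I h assume z: "z = (I, h)" "I \<in> pos p" "h \<in> Hom d (dirs p I) X"
  then show "component q \<phi> z \<in> els (app d q X)" "anch (app d q X) (component q \<phi> z) = anch (app d p X) z"
    by (simp_all add: bwd_Hom)
  fix g assume "g \<in> out c (anch (app d p X) z)"
  then have g: "g \<in> out c (anc p I)"
    using z by simp
  have "bwd \<phi> (push p g I) y \<in> dir p (push p g I)" if "y \<in> dir q (push q g (fwd \<phi> I))" for y
    using bwd_simps(1) [of "push p g I" y] z g that by simp
  then show "component q \<phi> (act (app d p X) g z) = act (app d q X) g (component q \<phi> z)"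
    using z g by (simp add: act_app cong: restrict_cong)
qed

lemma (in bimap) component_app_map:
  "z \<in> els (app d p X) \<Longrightarrow> component q \<phi> (app_map p f z) = app_map q f (component q \<phi> z)"
  by (auto simp: els_app cong: restrict_cong)

lemma component_cong:
  assumes "lens_eq p q \<phi> \<psi>" "z \<in> els (app d p X)"
  shows "component q \<phi> z = component q \<psi> z"
  using assms by (auto simp: els_app lens_eq_def cong: restrict_cong)

text \<open>The component of \<phi> is \<open>undefined\<close> outside
  \<open>dir q (fwd \<phi> I)\<close>; the premise keeps the values of \<open>bwd \<psi>\<close>
  inside that set.\<close>

lemma component_lcomp:
  assumes "\<And>I y. I \<in> pos p \<Longrightarrow> y \<in> dir r (fwd \<psi> (fwd \<phi> I)) \<Longrightarrow> bwd \<psi> (fwd \<phi> I) y \<in> dir q (fwd \<phi> I)"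
    and "z \<in> els (app d p X)"
  shows "component r (\<psi> \<odot> \<phi>) z = component r \<psi> (component q \<phi> z)"
  using assms by (auto simp: els_app lcomp_def cong: restrict_cong)

lemma component_idl: "z \<in> els (app d p X) \<Longrightarrow> component p idl z = z"
  by (auto simp: els_app idl_def Hom_dirs_restrict_eq)

lemma bimapI: "bicom c d p \<Longrightarrow> bicom c d q \<Longrightarrow> bimod_map c d p q \<phi> \<Longrightarrow> bimap c d p q \<phi>"
  by (intro bimap.intro bimap_axioms.intro)

text \<open>By Yoneda, it suffices to look at the components of a lens at the identities.\<close>

lemma bimap_componentI:
  assumes "bicom c d p" "bicom c d q"
    and bwd: "\<And>I y. I \<in> pos p \<Longrightarrow> y \<in> dir q (fwd \<phi> I) \<Longrightarrow> bwd \<phi> I y \<in> dir p I"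
    and nat: "\<And>I. I \<in> pos p \<Longrightarrow> natural c (app d p (dirs p I)) (app d q (dirs p I)) (component q \<phi>)"
  shows "bimap c d p q \<phi>"
proof (intro bimapI assms(1,2) bimod_mapI)
  interpret p: bicom c d p by fact
  fix I assume I: "I \<in> pos p"
  then have i: "gen p I \<in> els (app d p (dirs p I))" using p.id_Hom by simp
  note n = naturalD [OF nat [OF I] i, unfolded component_Pair]
  show fwd: "fwd \<phi> I \<in> pos q" "anc q (fwd \<phi> I) = anc p I" using n by simp_all
  \<comment> \<open>The component at the identity reads
    \<open>(\<lambda>x\<in>dir p I. x) (bwd \<phi> I y)\<close>, which is known to be
    \<open>bwd \<phi> I y\<close> only inside \<open>dir p I\<close>; hence the separate assumption
    \<open>bwd\<close>.\<close>
  have b: "(\<lambda>y\<in>dir q (fwd \<phi> I). (\<lambda>x\<in>dir p I. x) (bwd \<phi> I y)) \<in> Hom d (dirs q (fwd \<phi> I)) (dirs p I)"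
    using n(1) by simp
  {
    fix y assume y: "y \<in> dir q (fwd \<phi> I)"
    note b' = Hom_dirsD [OF b y] and yp = bwd [OF I y]
    show "bwd \<phi> I y \<in> dir p I" by (rule yp)
    show "danc p I (bwd \<phi> I y) = danc q (fwd \<phi> I) y" using b'(2) y yp by simp
    fix g assume "g \<in> out d (danc q (fwd \<phi> I) y)"
    moreover from this have "dact q (fwd \<phi> I) g y \<in> dir q (fwd \<phi> I)"
      using bicom.dact_simps(3) [OF assms(2) fwd(1) y] by simp
    ultimately show "bwd \<phi> I (dact q (fwd \<phi> I) g y) = dact p I g (bwd \<phi> I y)"
      using b'(3) [of g] y yp bwd [OF I] by simp
  }
  fix g assume g: "g \<in> out c (anc p I)"
  \<comment> \<open>Naturality at the identity along \<open>g\<close>: the first coordinates give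
    compatibility with \<open>push\<close>, the second ones compatibility with
    \<open>pull\<close>.\<close>
  note n3 = n(3) [of g, unfolded act_app component_Pair prod.inject anch_app, OF g]
  show push: "fwd \<phi> (push p g I) = push q g (fwd \<phi> I)" using n3 by simp
  fix y assume y: "y \<in> dir q (push q g (fwd \<phi> I))"
  then have "bwd \<phi> (push p g I) y \<in> dir p (push p g I)"
    using bwd [of "push p g I" y] I g by (simp add: push)
  moreover have "pull q g (fwd \<phi> I) y \<in> dir q (fwd \<phi> I)"
    using bicom.pull_simps(1) [OF assms(2) fwd(1)] g y fwd(2) by simp
  ultimately show "bwd \<phi> I (pull q g (fwd \<phi> I) y) = pull p g I (bwd \<phi> (push p g I) y)"
    using fun_cong [OF conjunct2 [OF n3], of y] y I g bwd [OF I] by (simp add: push)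
qed

lemma bimap_idl: "bicom c d p \<Longrightarrow> bimap c d p p idl"
  by (intro bimapI bimod_mapI) (simp_all add: idl_def)

text \<open>Components see only the values on the carriers, and by \<open>bimap_componentI\<close>
  their naturality suffices.\<close>

lemma bimap_cong:
  assumes \<phi>: "bimap c d p q \<phi>" and eq: "lens_eq p q \<phi> \<psi>"
  shows "bimap c d p q \<psi>"
proof -
  interpret \<phi>: bimap c d p q \<phi> by fact
  show ?thesis
  proof (intro bimap_componentI \<phi>.p.bicom_axioms \<phi>.q.bicom_axioms)
    fix I assume I: "I \<in> pos p"
    show "bwd \<psi> I y \<in> dir p I" if "y \<in> dir q (fwd \<psi> I)" for y
      using eq I that \<phi>.bwd_simps(1) [OF I, of y] by (simp add: lens_eq_def)
    show "natural c (app d p (dirs p I)) (app d q (dirs p I)) (component q \<psi>)"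
      by (rule iffD1 [OF natural_cong], rule \<phi>.p.copresheaf_app, erule component_cong [OF eq],
          rule \<phi>.natural_component)
  qed
qed

lemma bimap_component_mem:
  "bimap c d p q \<phi> \<Longrightarrow> z \<in> els (app d p X) \<Longrightarrow> component q \<phi> z \<in> els (app d q X)"
  by (rule naturalD(1) [OF bimap.natural_component])

lemma component_bimap_lcomp:
  assumes "bimap c d p q \<phi>" "bimap c d q r \<psi>" "z \<in> els (app d p X)"
  shows "component r (\<psi> \<odot> \<phi>) z = component r \<psi> (component q \<phi> z)"
proof -
  interpret \<phi>: bimap c d p q \<phi> by fact
  interpret \<psi>: bimap c d q r \<psi> by fact
  show ?thesis by (rule component_lcomp [OF _ assms(3)]) simp
qed

lemma bimap_lcomp:
  assumes "bimap c d p q \<phi>" "bimap c d q r \<psi>"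
  shows "bimap c d p r (\<psi> \<odot> \<phi>)"
proof -
  interpret \<phi>: bimap c d p q \<phi> by fact
  interpret \<psi>: bimap c d q r \<psi> by fact
  show ?thesis
  proof (intro bimap_componentI \<phi>.p.bicom_axioms \<psi>.q.bicom_axioms)
    fix I assume I: "I \<in> pos p"
    show "bwd (\<psi> \<odot> \<phi>) I y \<in> dir p I" if "y \<in> dir r (fwd (\<psi> \<odot> \<phi>) I)" for y
      using I that by (simp add: lcomp_def)
    show "natural c (app d p (dirs p I)) (app d r (dirs p I)) (component r (\<psi> \<odot> \<phi>))"
      by (rule iffD2 [OF natural_cong], rule \<phi>.p.copresheaf_app, erule component_bimap_lcomp [OF assms],
          rule natural_comp [OF \<phi>.natural_component \<psi>.natural_component])
  qed
qed

section \<open>Extensional normal forms of lenses\<close>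

lemma is_lens_restrict_lens:
  assumes "\<And>I. I \<in> pos p \<Longrightarrow> fwd \<phi> I \<in> pos q"
    and "\<And>I y. I \<in> pos p \<Longrightarrow> y \<in> dir q (fwd \<phi> I) \<Longrightarrow> bwd \<phi> I y \<in> dir p I"
  shows "is_lens p q (restrict_lens p q \<phi>)"
  using assms by (auto simp: is_lens_def restrict_lens_def PiE_def Pi_def extensional_def)

lemma restrict_lens_eq: "lens_eq p q \<phi> (restrict_lens p q \<phi>)" "lens_eq p q (restrict_lens p q \<phi>) \<phi>"
  by (simp_all add: lens_eq_def restrict_lens_def)

lemma lens_eq_sym: "lens_eq p q \<phi> \<psi> \<Longrightarrow> lens_eq p q \<psi> \<phi>"
  by (simp add: lens_eq_def)

lemma lens_eq_trans: "lens_eq p q \<phi> \<psi> \<Longrightarrow> lens_eq p q \<psi> \<chi> \<Longrightarrow> lens_eq p q \<phi> \<chi>"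
  by (simp add: lens_eq_def)

text \<open>Serves where lenses are compared as functions: uniqueness of the counit and the
  comultiplication of \<open>L\<close>, and the final bijection.\<close>

lemma is_lens_eqI:
  assumes "is_lens p q \<phi>" "is_lens p q \<psi>" "lens_eq p q \<phi> \<psi>"
  shows "\<phi> = \<psi>"
proof -
  have f: "fwd \<phi> = fwd \<psi>"
    using assms by (auto simp: is_lens_def lens_eq_def intro: PiE_ext)
  have "bwd \<phi> I = bwd \<psi> I" if "I \<in> pos p" for I
  proof (rule PiE_ext)
    show "bwd \<phi> I \<in> dir q (fwd \<psi> I) \<rightarrow>\<^sub>E dir p I" "bwd \<psi> I \<in> dir q (fwd \<psi> I) \<rightarrow>\<^sub>E dir p I"
      using assms that by (auto simp: is_lens_def f dest: PiE_mem)
  qed (use assms that in \<open>simp add: lens_eq_def f\<close>)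
  then have "bwd \<phi> = bwd \<psi>"
    using assms by (auto simp: is_lens_def f intro: PiE_ext)
  then show ?thesis using f by simp
qed

lemma bimod_hom_restrict_lens:
  assumes "bimap c d p q \<phi>"
  shows "bimod_hom c d p q (restrict_lens p q \<phi>)"
proof -
  interpret \<phi>: bimap c d p q \<phi> by fact
  show ?thesis
    unfolding bimod_hom_iff
    using bimap.bimod_map [OF bimap_cong [OF assms restrict_lens_eq(1)]]
    by (simp add: is_lens_restrict_lens)
qed

lemma bimap_hom: "bicom c d p \<Longrightarrow> bicom c d q \<Longrightarrow> bimod_hom c d p q \<phi> \<Longrightarrow> bimap c d p q \<phi>"
  by (simp add: bimapI bimod_hom_iff)

text \<open>Yoneda: at the identity of \<open>p[I]\<close> the component is
  \<open>fwd \<phi> I\<close> with the restriction of \<open>bwd \<phi> I\<close>. The two premises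
  keep the values of \<open>bwd\<close> in the domain of that identity.\<close>

lemma lens_eq_iff_component:
  "lens_eq p q \<phi> \<psi> \<longleftrightarrow>
     (\<forall>I\<in>pos p. component q \<phi> (gen p I) = component q \<psi> (gen p I))"
  if "\<And>I y. I \<in> pos p \<Longrightarrow> y \<in> dir q (fwd \<phi> I) \<Longrightarrow> bwd \<phi> I y \<in> dir p I"
    and "\<And>I y. I \<in> pos p \<Longrightarrow> y \<in> dir q (fwd \<psi> I) \<Longrightarrow> bwd \<psi> I y \<in> dir p I"
  using that by (auto simp: lens_eq_def restrict_def fun_eq_iff split: if_splits)

lemma lens_eq_bimap_iff:
  assumes "bimap c d p q \<phi>" "bimap c d p q \<psi>"
  shows "lens_eq p q \<phi> \<psi> \<longleftrightarrow>
    (\<forall>I\<in>pos p. component q \<phi> (gen p I) = component q \<psi> (gen p I))"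
  by (rule lens_eq_iff_component [OF bimap.bwd_simps(1) [OF assms(1)] bimap.bwd_simps(1) [OF assms(2)]])

section \<open>Composition of bicomodules\<close>

lemma rtrancl_Image_eq:
  assumes "sym R" "(a, b) \<in> R\<^sup>*"
  shows "R\<^sup>* `` {a} = R\<^sup>* `` {b}"
proof -
  have "(b, a) \<in> R\<^sup>*"
    using sym_rtrancl [OF assms(1)] assms(2) by (rule symD)
  then show ?thesis
    using assms(2) by (blast intro: rtrancl_trans)
qed

lemma cls_glue:
  assumes "x \<in> dir p I" "g \<in> out d (danc p I x)" "y \<in> dir q (f (dact p I g x))"
  shows "cls d p q (I, f) (x, pull q g (f x) y) = cls d p q (I, f) (dact p I g x, y)"
proof -
  have "((x, pull q g (f x) y), (dact p I g x, y)) \<in> glue d p q (I, f)"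
    unfolding glue_def using assms by blast
  then show ?thesis
    unfolding cls_def by (intro rtrancl_Image_eq sym_Un_converse r_into_rtrancl UnI1)
qed

text \<open>A class is swept out by zigzags of generators, so constancy of \<open>k\<close> is an
  induction along them. The predicate \<open>P\<close> is an invariant of the class: it carries a
  side condition under which \<open>k\<close> respects a generator, as for the right action on a
  composite.\<close>

lemma on_class_cls_inv:
  assumes "\<And>x g y. x \<in> dir p I \<Longrightarrow> g \<in> out d (danc p I x) \<Longrightarrow> y \<in> dir q (f (dact p I g x)) \<Longrightarrow>
      P (x, pull q g (f x) y) \<longleftrightarrow> P (dact p I g x, y)"
    and "\<And>x g y. x \<in> dir p I \<Longrightarrow> g \<in> out d (danc p I x) \<Longrightarrow> y \<in> dir q (f (dact p I g x)) \<Longrightarrow>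
      P (dact p I g x, y) \<Longrightarrow> k (x, pull q g (f x) y) = k (dact p I g x, y)"
    and "P z"
  shows "on_class k (cls d p q (I, f) z) = k z"
proof -
  let ?R = "glue d p q (I, f) \<union> (glue d p q (I, f))\<inverse>"
  have glue: "(P a \<longleftrightarrow> P b) \<and> (P b \<longrightarrow> k a = k b)" if "(a, b) \<in> glue d p q (I, f)" for a b
  proof -
    obtain x g y where *: "a = (x, pull q g (f x) y)" "b = (dact p I g x, y)" "x \<in> dir p I"
      "g \<in> out d (danc p I x)" "y \<in> dir q (f (dact p I g x))"
      using \<open>(a, b) \<in> glue d p q (I, f)\<close> unfolding glue_def by blast
    show ?thesis
      unfolding *(1,2) using assms(1,2) [OF *(3,4,5)] by blast
  qed
  have "P z' \<and> k z' = k z" if "(z, z') \<in> ?R\<^sup>*" for z'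
    using that
  proof (induction rule: rtrancl_induct)
    case base
    then show ?case using assms(3) by simp
  next
    case (step a b)
    from \<open>(a, b) \<in> ?R\<close> have "(P a \<longleftrightarrow> P b) \<and> (P b \<longrightarrow> k a = k b)"
      using glue [of a b] glue [of b a] by (metis UnE converseD)
    then show ?case using step.IH by simp
  qed
  then have "k ` cls d p q (I, f) z = {k z}"
    unfolding cls_def by blast
  then show ?thesis by (simp add: on_class_def)
qed

lemmas on_class_cls = on_class_cls_inv [where P = "\<lambda>_. True", simplified]

lemma pos_bicomp [simp]:
  "(I, f) \<in> pos (p \<triangleleft>\<^bsub>d\<^esub> q) \<longleftrightarrow> I \<in> pos p \<and> f \<in> Hom d (dirs p I) (poss q)"
  by (simp add: bicomp_def)

lemma poss_bicomp: "poss (p \<triangleleft>\<^bsub>d\<^esub> q) = app d p (poss q)"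
  by (simp add: poss_def app_def bicomp_def)

lemma anc_bicomp [simp]: "anc (p \<triangleleft>\<^bsub>d\<^esub> q) (I, f) = anc p I"
  by (simp add: bicomp_def)

lemma push_bicomp [simp]:
  "push (p \<triangleleft>\<^bsub>d\<^esub> q) g (I, f) = (push p g I, \<lambda>x\<in>dir p (push p g I). f (pull p g I x))"
  by (simp add: bicomp_def)

lemma cls_mem_dir [simp]:
  "x \<in> dir p I \<Longrightarrow> y \<in> dir q (f x) \<Longrightarrow> cls d p q (I, f) (x, y) \<in> dir (p \<triangleleft>\<^bsub>d\<^esub> q) (I, f)"
  by (auto simp: bicomp_def)

lemma dir_bicompE:
  assumes "K \<in> dir (p \<triangleleft>\<^bsub>d\<^esub> q) (I, f)"
  obtains x y where "x \<in> dir p I" "y \<in> dir q (f x)" "K = cls d p q (I, f) (x, y)"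
  using assms by (auto simp: bicomp_def)

lemma pos_bicompE:
  assumes "J \<in> pos (p \<triangleleft>\<^bsub>d\<^esub> q)"
  obtains I f where "J = (I, f)" "I \<in> pos p" "f \<in> Hom d (dirs p I) (poss q)"
  using assms by (auto simp: bicomp_def)

locale bicom2 = p: bicom c d p + q: bicom d e q
  for c :: "('co, 'ca) cat" and d :: "('do, 'da) cat" and e :: "('eo, 'ea) cat"
    and p :: "('p, 'x, 'co, 'ca, 'do, 'da) bimod"
    and q :: "('q, 'y, 'do, 'da, 'eo, 'ea) bimod"
begin

abbreviation pq where "pq \<equiv> p \<triangleleft>\<^bsub>d\<^esub> q"

lemma pos_fun:
  assumes "f \<in> Hom d (dirs p I) (poss q)" "x \<in> dir p I"
  shows "f x \<in> pos q" "anc q (f x) = danc p I x"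
    and "g \<in> out d (danc p I x) \<Longrightarrow> f (dact p I g x) = push q g (f x)"
  using Hom_dirsD [OF assms] by simp_all

lemma cls_push:
  assumes "f \<in> Hom d (dirs p I) (poss q)" "x \<in> dir p I" "g \<in> out d (danc p I x)"
    "y \<in> dir q (push q g (f x))"
  shows "cls d p q (I, f) (dact p I g x, y) = cls d p q (I, f) (x, pull q g (f x) y)"
  using cls_glue [OF assms(2,3), of y q f] assms by (simp add: pos_fun [OF assms(1,2)])

text \<open>\<open>J\<close> is a variable with an equation, so that the rule can be used with the
  pushed position in any of its forms.\<close>

lemma pull_bicomp:
  assumes "I \<in> pos p" "f \<in> Hom d (dirs p I) (poss q)" "g \<in> out c (anc p I)"
    and J: "J = (push p g I, \<lambda>x\<in>dir p (push p g I). f (pull p g I x))"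
  shows "pull pq g (I, f) (cls d p q J (x, y)) = cls d p q (I, f) (pull p g I x, y)"
proof -
  have "pull pq g (I, f) (cls d p q J (x, y)) =
      on_class (\<lambda>(x, y). cls d p q (I, f) (pull p g I x, y)) (cls d p q J (x, y))"
    by (simp add: bicomp_def)
  also have "\<dots> = (\<lambda>(x, y). cls d p q (I, f) (pull p g I x, y)) (x, y)"
    unfolding J
  proof (rule on_class_cls)
    fix x h y assume *: "x \<in> dir p (push p g I)" "h \<in> out d (danc p (push p g I) x)"
      "y \<in> dir q ((\<lambda>x\<in>dir p (push p g I). f (pull p g I x)) (dact p (push p g I) h x))"
    then have "cls d p q (I, f) (pull p g I x, pull q h (f (pull p g I x)) y) =
        cls d p q (I, f) (dact p I h (pull p g I x), y)"
      using assms(1,3) by (intro cls_glue) simp_all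
    then show "(case (x, pull q h ((\<lambda>x\<in>dir p (push p g I). f (pull p g I x)) x) y) of
          (x, y) \<Rightarrow> cls d p q (I, f) (pull p g I x, y)) =
        (case (dact p (push p g I) h x, y) of (x, y) \<Rightarrow> cls d p q (I, f) (pull p g I x, y))"
      using assms(1,3) * by simp
  qed
  finally show ?thesis by simp
qed

lemma danc_bicomp [simp]:
  assumes "I \<in> pos p" "f \<in> Hom d (dirs p I) (poss q)"
  shows "danc pq (I, f) (cls d p q (I, f) (x, y)) = danc q (f x) y"
proof -
  have "danc pq (I, f) (cls d p q (I, f) (x, y)) =
      on_class (\<lambda>(x, y). danc q (f x) y) (cls d p q (I, f) (x, y))"
    by (simp add: bicomp_def)
  also have "\<dots> = (\<lambda>(x, y). danc q (f x) y) (x, y)"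
    by (rule on_class_cls) (simp add: pos_fun [OF assms(2)])
  finally show ?thesis by simp
qed

lemma dact_bicomp [simp]:
  assumes "I \<in> pos p" "f \<in> Hom d (dirs p I) (poss q)" "h \<in> out e (danc q (f x) y)"
  shows "dact pq (I, f) h (cls d p q (I, f) (x, y)) = cls d p q (I, f) (x, dact q (f x) h y)"
proof -
  have "dact pq (I, f) h (cls d p q (I, f) (x, y)) =
      on_class (\<lambda>(x, y). cls d p q (I, f) (x, dact q (f x) h y)) (cls d p q (I, f) (x, y))"
    by (simp add: bicomp_def)
  also have "\<dots> = (\<lambda>(x, y). cls d p q (I, f) (x, dact q (f x) h y)) (x, y)"
  \<comment> \<open>The invariant says that \<open>h\<close> starts at the anchor of the second
    direction; under this condition \<open>pull q g\<close> is known to commute with the action of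
    \<open>h\<close>.\<close>
  proof (rule on_class_cls_inv [where P = "\<lambda>(x, y). h \<in> out e (danc q (f x) y)"])
    fix x g y assume *: "x \<in> dir p I" "g \<in> out d (danc p I x)" "y \<in> dir q (f (dact p I g x))"
    show "(case (x, pull q g (f x) y) of (x, y) \<Rightarrow> h \<in> out e (danc q (f x) y)) =
        (case (dact p I g x, y) of (x, y) \<Rightarrow> h \<in> out e (danc q (f x) y))"
      using * by (simp add: pos_fun [OF assms(2)])
    assume "case (dact p I g x, y) of (x, y) \<Rightarrow> h \<in> out e (danc q (f x) y)"
    moreover have "cls d p q (I, f) (x, pull q g (f x) (dact q (f (dact p I g x)) h y)) =
        cls d p q (I, f) (dact p I g x, dact q (f (dact p I g x)) h y)"
      using * calculation assms by (intro cls_glue q.dact_simps) (simp_all add: pos_fun [OF assms(2)])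
    ultimately show "(case (x, pull q g (f x) y) of (x, y) \<Rightarrow> cls d p q (I, f) (x, dact q (f x) h y)) =
        (case (dact p I g x, y) of (x, y) \<Rightarrow> cls d p q (I, f) (x, dact q (f x) h y))"
      using * by (simp add: pos_fun [OF assms(2)])
  qed (use assms in simp)
  finally show ?thesis by simp
qed

lemma pull_Hom_poss:
  assumes "I \<in> pos p" "f \<in> Hom d (dirs p I) (poss q)" "g \<in> out c (anc p I)"
  shows "(\<lambda>x\<in>dir p (push p g I). f (pull p g I x)) \<in> Hom d (dirs p (push p g I)) (poss q)"
  using assms by (simp add: p.pull_Hom)

text \<open>On positions the composite is \<open>p\<close> applied to the copresheaf
  \<open>poss q\<close>. On directions every class has a representative \<open>(x, y)\<close>;
  \<open>pull\<close> acts on \<open>x\<close> and \<open>dact\<close> on \<open>y\<close>, so the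
  laws are those of \<open>p\<close> and of \<open>q\<close>.\<close>

lemma bicomodule_bicomp: "bicomodule c e pq"
  unfolding bicomodule_def
proof (intro conjI ballI)
  show "copresheaf c (poss pq)"
    unfolding poss_bicomp by (rule p.copresheaf_app)
next
  fix J assume "J \<in> pos pq"
  then obtain I f where J: "J = (I, f)" "I \<in> pos p" "f \<in> Hom d (dirs p I) (poss q)"
    by (rule pos_bicompE)
  note f = pos_fun [OF J(3)]
  show "copresheaf e (dirs pq J)"
    unfolding copresheaf_def
  proof (intro conjI ballI)
    fix K assume "K \<in> els (dirs pq J)"
    then have "K \<in> dir pq (I, f)" by (simp add: J)
    then obtain x y where K: "x \<in> dir p I" "y \<in> dir q (f x)" "K = cls d p q (I, f) (x, y)"
      by (rule dir_bicompE)
    note y = q.dact_simps [OF f(1) [OF K(1)] K(2)]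
    show "anch (dirs pq J) K \<in> Ob e"
      using J K y by simp
    show "act (dirs pq J) (ide e (anch (dirs pq J) K)) K = K"
      using J K y by (simp add: danc_bicomp [OF J(2,3)]) (subst dact_bicomp; simp add: f q.out_right)
    fix g assume "g \<in> out e (anch (dirs pq J) K)"
    then have g: "g \<in> out e (danc q (f x) y)" using J K by simp
    show "act (dirs pq J) g K \<in> els (dirs pq J)"
      "anch (dirs pq J) (act (dirs pq J) g K) = tgt e g"
      using J K g y by simp_all
    fix h assume h: "h \<in> out e (tgt e g)"
    have hg: "cmp e h g \<in> out e (danc q (f x) y)"
      using g h by (rule q.out_right)
    show "act (dirs pq J) (cmp e h g) K =
        act (dirs pq J) h (act (dirs pq J) g K)"
      using J K g h y hg by simp
  qed
  {
    fix K assume "K \<in> dir pq J"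
    then obtain x y where K: "x \<in> dir p I" "y \<in> dir q (f x)" "K = cls d p q (I, f) (x, y)"
      unfolding J by (rule dir_bicompE)
    show "pull pq (ide c (anc pq J)) J K = K"
      unfolding J K anc_bicomp
      by (subst pull_bicomp) (use J K in \<open>simp_all add: Hom_dirs_restrict_eq cong: restrict_cong\<close>)
  }
  fix g assume "g \<in> out c (anc pq J)"
  then have g: "g \<in> out c (anc p I)" by (simp add: J)
  have f': "(\<lambda>x\<in>dir p (push p g I). f (pull p g I x)) \<in> Hom d (dirs p (push p g I)) (poss q)"
    using J g by (simp add: pull_Hom_poss)
  note pull = pull_bicomp [OF J(2,3) g refl]
  show "natural e (dirs pq (push pq g J)) (dirs pq J) (pull pq g J)"
  proof (rule naturalI; unfold J(1) push_bicomp dirs_simps; erule dir_bicompE)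
    fix K x y
    let ?f = "\<lambda>x\<in>dir p (push p g I). f (pull p g I x)"
    assume K: "K = cls d p q (push p g I, ?f) (x, y)"
      and x: "x \<in> dir p (push p g I)" and y: "y \<in> dir q (?f x)"
    show "pull pq g (I, f) K \<in> dir pq (I, f)"
      "danc pq (I, f) (pull pq g (I, f) K) =
       danc pq (push p g I, ?f) K"
      unfolding K pull using J g f' x y by simp_all
    fix h assume "h \<in> out e (danc pq (push p g I, ?f) K)"
    then have h: "h \<in> out e (danc q (?f x) y)"
      unfolding K using J g f' by simp
    show "pull pq g (I, f) (dact pq (push p g I, ?f) h K) =
        dact pq (I, f) h (pull pq g (I, f) K)"
    proof -
      have "dact pq (push p g I, ?f) h K = cls d p q (push p g I, ?f) (x, dact q (?f x) h y)"
        unfolding K using J g f' h by (intro dact_bicomp) simp_all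
      then show ?thesis
        unfolding K using h x J g by (simp add: pull)
    qed
  qed
  fix h K assume h: "h \<in> out c (tgt c g)"
    and "K \<in> dir pq (push pq h (push pq g J))"
  let ?f = "\<lambda>x\<in>dir p (push p g I). f (pull p g I x)"
  let ?f' = "\<lambda>x\<in>dir p (push p h (push p g I)). ?f (pull p h (push p g I) x)"
  from \<open>K \<in> _\<close> obtain x y where x: "x \<in> dir p (push p h (push p g I))"
    and K: "K = cls d p q (push p h (push p g I), ?f') (x, y)"
    unfolding J push_bicomp by (rule dir_bicompE)
  have hg: "cmp c h g \<in> out c (anc p I)"
    using g h by (rule p.out_left)
  have "pull pq h (push p g I, ?f) K =
      cls d p q (push p g I, ?f) (pull p h (push p g I) x, y)"
    unfolding K using J g h f' by (intro pull_bicomp) simp_all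
  moreover have "pull pq (cmp c h g) (I, f) K =
      cls d p q (I, f) (pull p (cmp c h g) I x, y)"
    unfolding K using J g h hg by (intro pull_bicomp) (simp_all cong: restrict_cong)
  ultimately show "pull pq (cmp c h g) J K =
      pull pq g J (pull pq h (push pq g J) K)"
    using J g h x by (simp add: pull)
qed

end

sublocale bicom2 \<subseteq> pq: bicom c e "p \<triangleleft>\<^bsub>d\<^esub> q"
  by (intro bicom.intro p.category_left q.category_right bicomodule_bicomp)

section \<open>Composition of familial functors\<close>

context bicom2
begin

lemma app_comp_Pair:
  "app_comp d p q ((I, f), h) =
     (I, \<lambda>x\<in>dir p I. (f x, \<lambda>y\<in>dir q (f x). h (cls d p q (I, f) (x, y))))"
  by (simp add: app_comp_def)

lemma app_comp_inner_Hom: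
  assumes "I \<in> pos p" "f \<in> Hom d (dirs p I) (poss q)" "h \<in> Hom e (dirs pq (I, f)) X"
    and x: "x \<in> dir p I"
  shows "(\<lambda>y\<in>dir q (f x). h (cls d p q (I, f) (x, y))) \<in> Hom e (dirs q (f x)) X"
proof (rule dirs_restrict_Hom)
  note f = pos_fun [OF assms(2)]
  note h = Hom_dirsD [OF assms(3)]
  show "copresheaf e (dirs q (f x))"
    using x by (simp add: q.copresheaf_dirs f)
  show "natural e (dirs q (f x)) X (\<lambda>y. h (cls d p q (I, f) (x, y)))"
  proof (rule naturalI)
    fix y g assume *: "y \<in> els (dirs q (f x))" "g \<in> out e (anch (dirs q (f x)) y)"
    have "h (dact pq (I, f) g (cls d p q (I, f) (x, y))) = act X g (h (cls d p q (I, f) (x, y)))"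
      using assms * by (intro h) simp_all
    then show "h (cls d p q (I, f) (x, act (dirs q (f x)) g y)) = act X g (h (cls d p q (I, f) (x, y)))"
      using assms * by simp
  qed (use assms h in simp_all)
qed

text \<open>Naturality in \<open>x\<close> is the gluing relation: moving \<open>x\<close> along
  \<open>g\<close> amounts to pulling \<open>y\<close> back along \<open>g\<close> inside the
  class.\<close>

lemma app_comp_outer_Hom:
  assumes "I \<in> pos p" "f \<in> Hom d (dirs p I) (poss q)" "h \<in> Hom e (dirs pq (I, f)) X"
  shows "(\<lambda>x\<in>dir p I. (f x, \<lambda>y\<in>dir q (f x). h (cls d p q (I, f) (x, y))))
     \<in> Hom d (dirs p I) (app e q X)"
proof (rule dirs_restrict_Hom)
  note f = pos_fun [OF assms(2)]
  show "copresheaf d (dirs p I)"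
    using assms by (simp add: p.copresheaf_dirs)
  show "natural d (dirs p I) (app e q X) (\<lambda>x. (f x, \<lambda>y\<in>dir q (f x). h (cls d p q (I, f) (x, y))))"
  proof (rule naturalI)
    fix x g assume *: "x \<in> els (dirs p I)" "g \<in> out d (anch (dirs p I) x)"
    then show "(f (act (dirs p I) g x), \<lambda>y\<in>dir q (f (act (dirs p I) g x)). h (cls d p q (I, f) (act (dirs p I) g x, y))) =
        act (app e q X) g (f x, \<lambda>y\<in>dir q (f x). h (cls d p q (I, f) (x, y)))"
      using assms by (auto simp: act_app f cls_push cong: restrict_cong)
  qed (use assms f in \<open>simp_all add: app_comp_inner_Hom\<close>)
qed

lemma natural_app_comp:
  "natural c (app e pq X) (app d p (app e q X)) (app_comp d p q)"
proof (rule naturalI; elim app_elE; erule pos_bicompE; simp only: app_comp_Pair anch_app anc_bicomp)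
  fix I f h assume I: "I \<in> pos p" "f \<in> Hom d (dirs p I) (poss q)"
    and h: "h \<in> Hom e (dirs pq (I, f)) X"
  then show "(I, \<lambda>x\<in>dir p I. (f x, \<lambda>y\<in>dir q (f x). h (cls d p q (I, f) (x, y)))) \<in> els (app d p (app e q X))"
    by (simp add: app_comp_outer_Hom)
  fix g assume g: "g \<in> out c (anc p I)"
  then show "app_comp d p q (act (app e pq X) g ((I, f), h)) =
      act (app d p (app e q X)) g (I, \<lambda>x\<in>dir p I. (f x, \<lambda>y\<in>dir q (f x). h (cls d p q (I, f) (x, y))))"
    using I by (simp add: app_comp_Pair act_app pull_bicomp cong: restrict_cong)
qed

lemma app_comp_app_map:
  assumes "z \<in> els (app e pq X)"
  shows "app_comp d p q (app_map pq k z) = app_map p (app_map q k) (app_comp d p q z)"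
  using assms by (auto elim!: app_elE pos_bicompE simp: app_comp_Pair cong: restrict_cong)

lemma app_comp_inv_Pair:
  "app_comp_inv d p q (I, k) = ((I, \<lambda>x\<in>dir p I. fst (k x)),
     \<lambda>K\<in>dir pq (I, \<lambda>x\<in>dir p I. fst (k x)). on_class (\<lambda>(x, y). snd (k x) y) K)"
  by (simp add: app_comp_inv_def Let_def)

text \<open>Uncurrying is constant on classes because \<open>k\<close> is natural: acting by
  \<open>g\<close> on an element of \<open>q(X)\<close> precomposes it with \<open>pull q g\<close>,
  which is the other side of a generator.\<close>

lemma on_class_inner:
  assumes "I \<in> pos p" and k: "k \<in> Hom d (dirs p I) (app e q X)"
  shows "on_class (\<lambda>(x, y). snd (k x) y) (cls d p q (I, \<lambda>x\<in>dir p I. fst (k x)) (x, y)) = snd (k x) y"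
proof -
  have "on_class (\<lambda>(x, y). snd (k x) y) (cls d p q (I, \<lambda>x\<in>dir p I. fst (k x)) (x, y)) =
      (\<lambda>(x, y). snd (k x) y) (x, y)"
  proof (rule on_class_cls, unfold prod.case)
    fix x g y assume *: "x \<in> dir p I" "g \<in> out d (danc p I x)"
      "y \<in> dir q ((\<lambda>x\<in>dir p I. fst (k x)) (dact p I g x))"
    have "k (dact p I g x) = act (app e q X) g (k x)"
      using * Hom_dirsD [OF k] by simp
    moreover obtain J l where "k x = (J, l)" by (cases "k x")
    ultimately show "snd (k x) (pull q g ((\<lambda>x\<in>dir p I. fst (k x)) x) y) = snd (k (dact p I g x)) y"
      using * assms by (simp add: act_app)
  qed
  then show ?thesis by simp
qed

lemma fst_Hom:
  assumes "I \<in> pos p" and k: "k \<in> Hom d (dirs p I) (app e q X)"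
  shows "(\<lambda>x\<in>dir p I. fst (k x)) \<in> Hom d (dirs p I) (poss q)"
proof -
  have "natural d (app e q X) (poss q) fst"
    by (rule naturalI; elim app_elE) (simp_all add: act_app)
  then show ?thesis
    using p.comp_Hom [OF assms] by blast
qed

lemma app_comp_inv_mem:
  assumes "z \<in> els (app d p (app e q X))"
  shows "app_comp_inv d p q z \<in> els (app e pq X)"
    and "app_comp d p q (app_comp_inv d p q z) = z"
proof -
  obtain I k where z: "z = (I, k)" "I \<in> pos p" and k: "k \<in> Hom d (dirs p I) (app e q X)"
    using assms by (rule app_elE)
  let ?f = "\<lambda>x\<in>dir p I. fst (k x)"
  let ?h = "\<lambda>K\<in>dir pq (I, ?f). on_class (\<lambda>(x, y). snd (k x) y) K"
  have f: "?f \<in> Hom d (dirs p I) (poss q)"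
    using z(2) k by (rule fst_Hom)
  have kx: "fst (k x) \<in> pos q" "snd (k x) \<in> Hom e (dirs q (fst (k x))) X" if "x \<in> dir p I" for x
    using Hom_dirsD(1) [OF k that] by (auto elim!: app_elE)
  have h_cls: "?h (cls d p q (I, ?f) (x, y)) = snd (k x) y" if "x \<in> dir p I" "y \<in> dir q (fst (k x))" for x y
    using that z(2) k by (simp add: on_class_inner)
  have "?h \<in> Hom e (dirs pq (I, ?f)) X"
  proof (rule dirs_restrict_Hom)
    show "copresheaf e (dirs pq (I, ?f))"
      using z f by (simp add: pq.copresheaf_dirs)
    show "natural e (dirs pq (I, ?f)) X (on_class (\<lambda>(x, y). snd (k x) y))"
    proof (rule naturalI; unfold dirs_simps; erule dir_bicompE)
      fix K x y assume x: "x \<in> dir p I" "y \<in> dir q (?f x)" and K: "K = cls d p q (I, ?f) (x, y)"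
      note kx' = Hom_dirsD [OF kx(2) [OF x(1)], of y]
      show "on_class (\<lambda>(x, y). snd (k x) y) K \<in> els X"
        "anch X (on_class (\<lambda>(x, y). snd (k x) y) K) = danc pq (I, ?f) K"
        unfolding K on_class_inner [OF z(2) k] danc_bicomp [OF z(2) f] using x kx' by simp_all
      fix g assume "g \<in> out e (danc pq (I, ?f) K)"
      then have g: "g \<in> out e (danc q (?f x) y)"
        unfolding K danc_bicomp [OF z(2) f] .
      show "on_class (\<lambda>(x, y). snd (k x) y) (dact pq (I, ?f) g K) =
          act X g (on_class (\<lambda>(x, y). snd (k x) y) K)"
        unfolding K dact_bicomp [OF z(2) f g] on_class_inner [OF z(2) k] using g x kx' by simp
    qed
  qed
  then show "app_comp_inv d p q z \<in> els (app e pq X)"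
    using z f by (simp add: app_comp_inv_Pair)
  have "(\<lambda>x\<in>dir p I. (?f x, \<lambda>y\<in>dir q (?f x). ?h (cls d p q (I, ?f) (x, y)))) =
      (\<lambda>x\<in>dir p I. (fst (k x), snd (k x)))"
    using kx by (intro restrict_ext) (simp add: on_class_inner [OF z(2) k] Hom_dirs_restrict_eq [OF kx(2)] cong: restrict_cong)
  then show "app_comp d p q (app_comp_inv d p q z) = z"
    unfolding z app_comp_inv_Pair app_comp_Pair using k by (simp add: Hom_dirs_restrict_eq)
qed

text \<open>Each direction of the composite is the class of some \<open>(x, y)\<close>, and currying
  records the value there. With the right inverse above, this makes \<open>app_comp\<close>
  bijective.\<close>

lemma app_comp_inj:
  assumes "z \<in> els (app e pq X)" "z' \<in> els (app e pq X)"
    and eq: "app_comp d p q z = app_comp d p q z'"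
  shows "z = z'"
proof -
  obtain I f h where z: "z = ((I, f), h)" "I \<in> pos p" "f \<in> Hom d (dirs p I) (poss q)"
    "h \<in> Hom e (dirs pq (I, f)) X"
    using assms(1) by (auto elim!: app_elE pos_bicompE)
  obtain I' f' h' where z': "z' = ((I', f'), h')" "f' \<in> Hom d (dirs p I') (poss q)"
    "h' \<in> Hom e (dirs pq (I', f')) X"
    using assms(2) by (auto elim!: app_elE pos_bicompE)
  have I: "I' = I" using eq z z' by (simp add: app_comp_Pair)
  have fh: "f x = f' x" "(\<lambda>y\<in>dir q (f x). h (cls d p q (I, f) (x, y))) =
      (\<lambda>y\<in>dir q (f x). h' (cls d p q (I, f') (x, y)))" if "x \<in> dir p I" for x
    using eq that by (simp_all add: z z' I app_comp_Pair fun_eq_iff restrict_def split: if_splits)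
  have f: "f' = f"
    using z z' fh(1) by (intro Hom_dirs_eqI [of f' d p I "poss q" f]) (simp_all add: I)
  have "h = h'"
  proof (rule Hom_dirs_eqI)
    show "h \<in> Hom e (dirs pq (I, f)) X" "h' \<in> Hom e (dirs pq (I, f)) X"
      using z z' by (simp_all add: I f)
    fix K assume "K \<in> dir pq (I, f)"
    then obtain x y where x: "x \<in> dir p I" "y \<in> dir q (f x)" "K = cls d p q (I, f) (x, y)"
      by (rule dir_bicompE)
    then show "h K = h' K"
      using fun_cong [OF fh(2) [OF x(1)], of y] by (simp add: f)
  qed
  then show ?thesis by (simp add: z z' I f)
qed

lemma app_comp_inv_app_comp:
  "z \<in> els (app e pq X) \<Longrightarrow> app_comp_inv d p q (app_comp d p q z) = z"
  using natural_app_comp [of X] app_comp_inv_mem [of "app_comp d p q z" X]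
  by (intro app_comp_inj [where X = X]) (simp_all add: natural_def)

lemma natural_app_comp_inv:
  "natural c (app d p (app e q X)) (app e pq X) (app_comp_inv d p q)"
proof (rule naturalI)
  fix z assume z: "z \<in> els (app d p (app e q X))"
  note w = app_comp_inv_mem [OF z]
  show "app_comp_inv d p q z \<in> els (app e pq X)" by (rule w)
  note n = naturalD [OF natural_app_comp w(1), unfolded w(2)]
  show anch: "anch (app e pq X) (app_comp_inv d p q z) = anch (app d p (app e q X)) z"
    using n(2) by simp
  fix g assume g: "g \<in> out c (anch (app d p (app e q X)) z)"
  then show "app_comp_inv d p q (act (app d p (app e q X)) g z) =
      act (app e pq X) g (app_comp_inv d p q z)"
    using n(3) [of g] app_comp_inv_app_comp [OF copresheafD(3) [OF pq.copresheaf_app w(1)], of g] anch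
    by simp
qed

lemma app_comp_inv_app_map:
  assumes z: "z \<in> els (app d p (app e q X))" and f: "natural e X Y f"
  shows "app_comp_inv d p q (app_map p (app_map q f) z) = app_map pq f (app_comp_inv d p q z)"
proof -
  note w = app_comp_inv_mem [OF z]
  show ?thesis
    using app_comp_app_map [OF w(1), of f] w(2)
      app_comp_inv_app_comp [OF naturalD(1) [OF pq.natural_app_map [OF f] w(1)]] by simp
qed

text \<open>The criterion behind the evaluation of maps into a composite: a candidate
  \<open>N\<close>, known to be natural, is compared with the lens on positions and on
  representatives \<open>(x, y)\<close>. Naturality of the component comes out as a conclusion, and
  is what \<open>bimap_componentI\<close> asks for.\<close>

lemma component_via_app_comp:
  assumes N: "natural c (app e s X) (app d p (app e q X)) N"
    and fwd: "\<And>I h P k. (I, h) \<in> els (app e s X) \<Longrightarrow> N (I, h) = (P, k) \<Longrightarrow>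
      fwd \<phi> I = (P, \<lambda>x\<in>dir p P. fst (k x))"
    and bwd: "\<And>I h P k x y. (I, h) \<in> els (app e s X) \<Longrightarrow> N (I, h) = (P, k) \<Longrightarrow>
      x \<in> dir p P \<Longrightarrow> y \<in> dir q (fst (k x)) \<Longrightarrow>
      h (bwd \<phi> I (cls d p q (fwd \<phi> I) (x, y))) = snd (k x) y"
    and s: "bicom c e s"
  shows "natural c (app e s X) (app e pq X) (component pq \<phi>)"
    and "z \<in> els (app e s X) \<Longrightarrow> app_comp d p q (component pq \<phi> z) = N z"
proof -
  interpret s: bicom c e s by fact
  have eq: "component pq \<phi> z = app_comp_inv d p q (N z)" if z: "z \<in> els (app e s X)" for z
  proof -
    obtain I h P k where zI: "z = (I, h)" and Nz: "N z = (P, k)" by (cases z, cases "N z")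
    have k: "P \<in> pos p" "k \<in> Hom d (dirs p P) (app e q X)"
      using naturalD(1) [OF N z] by (simp_all add: Nz)
    note Ih = z [unfolded zI] and NI = Nz [unfolded zI]
    have "h (bwd \<phi> I K) = on_class (\<lambda>(x, y). snd (k x) y) K" if "K \<in> dir pq (fwd \<phi> I)" for K
    proof -
      obtain x y where x: "x \<in> dir p P" and y: "y \<in> dir q ((\<lambda>x\<in>dir p P. fst (k x)) x)"
        and K: "K = cls d p q (P, \<lambda>x\<in>dir p P. fst (k x)) (x, y)"
        using \<open>K \<in> _\<close> unfolding fwd [OF Ih NI] by (rule dir_bicompE)
      show ?thesis
        using bwd [OF Ih NI x] x y unfolding K on_class_inner [OF k] fwd [OF Ih NI] by simp
    qed
    then show ?thesis
      unfolding zI NI app_comp_inv_Pair component_Pair by (simp add: fwd [OF Ih NI] cong: restrict_cong)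
  qed
  show "natural c (app e s X) (app e pq X) (component pq \<phi>)"
    by (rule iffD2 [OF natural_cong], rule s.copresheaf_app, erule eq,
        rule natural_comp [OF N natural_app_comp_inv])
  show "z \<in> els (app e s X) \<Longrightarrow> app_comp d p q (component pq \<phi> z) = N z"
    using eq app_comp_inv_mem(2) [OF naturalD(1) [OF N]] by simp
qed

end

section \<open>Horizontal composites and whiskering\<close>

lemma bicomp_map_fwd [simp]:
  "fwd (bicomp_map d p p' q \<chi> \<psi>) (I, f) =
     (fwd \<chi> I, \<lambda>x\<in>dir p' (fwd \<chi> I). fwd \<psi> (f (bwd \<chi> I x)))"
  by (simp add: bicomp_map_def)

locale bicom2_map =
  \<chi>: bimap c d p p' \<chi> + \<psi>: bimap d e q q' \<psi>
  for c :: "('co, 'ca) cat" and d :: "('do, 'da) cat" and e :: "('eo, 'ea) cat"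
    and p :: "('p, 'x, 'co, 'ca, 'do, 'da) bimod" and p' :: "('p1, 'x1, 'co, 'ca, 'do, 'da) bimod"
    and q :: "('q, 'y, 'do, 'da, 'eo, 'ea) bimod" and q' :: "('q1, 'y1, 'do, 'da, 'eo, 'ea) bimod"
    and \<chi> \<psi>
begin

sublocale pq: bicom2 c d e p q by unfold_locales
sublocale pq': bicom2 c d e p' q' by unfold_locales

abbreviation w where "w \<equiv> bicomp_map d p p' q \<chi> \<psi>"

text \<open>A generator along \<open>g\<close> for \<open>p'\<close> and \<open>q'\<close> is sent
  to the generator along the same \<open>g\<close> for \<open>p\<close> and \<open>q\<close>, since
  \<open>bwd \<chi> I\<close> commutes with the action and \<open>bwd \<psi>\<close> with
  \<open>pull\<close>.\<close>

lemma bwd_bicomp_map: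
  assumes I: "I \<in> pos p" "f \<in> Hom d (dirs p I) (poss q)"
    and J: "J = (fwd \<chi> I, \<lambda>x\<in>dir p' (fwd \<chi> I). fwd \<psi> (f (bwd \<chi> I x)))"
  shows "bwd w (I, f) (cls d p' q' J (x, y)) =
    cls d p q (I, f) (bwd \<chi> I x, bwd \<psi> (f (bwd \<chi> I x)) y)"
proof -
  note f = pq.pos_fun [OF I(2)]
  have "bwd w (I, f) (cls d p' q' J (x, y)) =
    on_class (\<lambda>(x, y). cls d p q (I, f) (bwd \<chi> I x, bwd \<psi> (f (bwd \<chi> I x)) y)) (cls d p' q' J (x, y))"
    by (simp add: bicomp_map_def)
  also have "\<dots> = (\<lambda>(x, y). cls d p q (I, f) (bwd \<chi> I x, bwd \<psi> (f (bwd \<chi> I x)) y)) (x, y)"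
    unfolding J
  proof (rule on_class_cls, unfold prod.case)
    fix x g y
    let ?f = "\<lambda>x\<in>dir p' (fwd \<chi> I). fwd \<psi> (f (bwd \<chi> I x))"
    assume *: "x \<in> dir p' (fwd \<chi> I)" "g \<in> out d (danc p' (fwd \<chi> I) x)"
      "y \<in> dir q' (?f (dact p' (fwd \<chi> I) g x))"
    then have y: "y \<in> dir q' (push q' g (fwd \<psi> (f (bwd \<chi> I x))))"
      using I by (simp add: f)
    have "bwd \<psi> (push q g (f (bwd \<chi> I x))) y \<in> dir q (push q g (f (bwd \<chi> I x)))"
      using I * y by (intro \<psi>.bwd_simps) (simp_all add: f)
    then have "cls d p q (I, f) (bwd \<chi> I x, pull q g (f (bwd \<chi> I x)) (bwd \<psi> (push q g (f (bwd \<chi> I x))) y)) =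
        cls d p q (I, f) (dact p I g (bwd \<chi> I x), bwd \<psi> (push q g (f (bwd \<chi> I x))) y)"
      using I * by (intro cls_glue) (simp_all add: f)
    then show "cls d p q (I, f) (bwd \<chi> I x, bwd \<psi> (f (bwd \<chi> I x)) (pull q' g (?f x) y)) =
        cls d p q (I, f) (bwd \<chi> I (dact p' (fwd \<chi> I) g x), bwd \<psi> (f (bwd \<chi> I (dact p' (fwd \<chi> I) g x))) y)"
      using I * y by (simp add: f)
  qed
  finally show ?thesis by simp
qed

text \<open>The right-hand side is a composite of natural maps, hence a candidate for
  \<open>component_via_app_comp\<close>; on a representative both sides unfold to the same value of
  \<open>h\<close>.\<close>

lemma bicomp_map_component:
  shows "natural c (app e pq.pq X) (app e pq'.pq X) (component pq'.pq w)"
    and "z \<in> els (app e pq.pq X) \<Longrightarrow>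
      app_comp d p' q' (component pq'.pq w z) =
      component p' \<chi> (app_map p (component q' \<psi>) (app_comp d p q z))"
proof -
  let ?N = "\<lambda>z. component p' \<chi> (app_map p (component q' \<psi>) (app_comp d p q z))"
  have N: "natural c (app e pq.pq X) (app d p' (app e q' X)) ?N"
    by (intro natural_comp [OF natural_comp [OF pq.natural_app_comp
        \<chi>.p.natural_app_map [OF \<psi>.natural_component]] \<chi>.natural_component])
  \<comment> \<open>Both comparison premises of \<open>component_via_app_comp\<close> in one
    formula, as the same unfolding of \<open>?N\<close> proves them.\<close>
  have eval: "fwd w J = (P, \<lambda>x\<in>dir p' P. fst (k x)) \<and>
      (\<forall>x\<in>dir p' P. \<forall>y\<in>dir q' (fst (k x)).
        h (bwd w J (cls d p' q' (fwd w J) (x, y))) = snd (k x) y)"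
    if J: "(J, h) \<in> els (app e pq.pq X)" and N: "?N (J, h) = (P, k)" for J h P k
  proof -
    obtain I f where I: "J = (I, f)" "I \<in> pos p" "f \<in> Hom d (dirs p I) (poss q)"
      using J by (auto elim: pos_bicompE)
    have "P = fwd \<chi> I" and k: "k = (\<lambda>x\<in>dir p' (fwd \<chi> I). (fwd \<psi> (f (bwd \<chi> I x)), \<lambda>y\<in>dir q' (fwd \<psi> (f (bwd \<chi> I x))).
        h (cls d p q (I, f) (bwd \<chi> I x, bwd \<psi> (f (bwd \<chi> I x)) y))))"
      using N I pq.pos_fun [OF I(3)] by (auto simp: pq.app_comp_Pair cong: restrict_cong)
    then show ?thesis
      using I by (simp add: bwd_bicomp_map cong: restrict_cong)
  qed
  show "natural c (app e pq.pq X) (app e pq'.pq X) (component pq'.pq w)"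
    by (rule pq'.component_via_app_comp(1) [OF N _ _ pq.pq.bicom_axioms]) (use eval in blast)+
  show "z \<in> els (app e pq.pq X) \<Longrightarrow> app_comp d p' q' (component pq'.pq w z) = ?N z"
    by (rule pq'.component_via_app_comp(2) [OF N _ _ pq.pq.bicom_axioms]) (use eval in blast)+
qed

lemma bimap_bicomp_map: "bimap c e pq.pq pq'.pq w"
proof (intro bimap_componentI pq.pq.bicom_axioms pq'.pq.bicom_axioms bicomp_map_component(1))
  fix J K assume J: "J \<in> pos pq.pq" and K: "K \<in> dir pq'.pq (fwd w J)"
  obtain I f where I: "J = (I, f)" "I \<in> pos p" "f \<in> Hom d (dirs p I) (poss q)"
    using J by (rule pos_bicompE)
  from K show "bwd w J K \<in> dir pq.pq J"
    unfolding I bicomp_map_fwd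
    by (elim dir_bicompE) (use I pq.pos_fun [OF I(3)] in \<open>simp add: bwd_bicomp_map\<close>)
qed

end

lemma bimap_whisk_l:
  assumes "bicom c d p" "bimap d e q q' \<psi>"
  shows "bimap c e (p \<triangleleft>\<^bsub>d\<^esub> q) (p \<triangleleft>\<^bsub>d\<^esub> q') (whisk_l d p q \<psi>)"
    and "z \<in> els (app e (p \<triangleleft>\<^bsub>d\<^esub> q) X) \<Longrightarrow>
      app_comp d p q' (component (p \<triangleleft>\<^bsub>d\<^esub> q') (whisk_l d p q \<psi>) z) =
      app_map p (component q' \<psi>) (app_comp d p q z)"
proof -
  interpret \<psi>: bimap d e q q' \<psi> by fact
  interpret bicom2_map c d e p p q q' idl \<psi>
    by (intro bicom2_map.intro bimap_idl assms)
  show "bimap c e (p \<triangleleft>\<^bsub>d\<^esub> q) (p \<triangleleft>\<^bsub>d\<^esub> q') (whisk_l d p q \<psi>)"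
    by (rule bimap_bicomp_map)
  assume z: "z \<in> els (app e (p \<triangleleft>\<^bsub>d\<^esub> q) X)"
  show "app_comp d p q' (component (p \<triangleleft>\<^bsub>d\<^esub> q') (whisk_l d p q \<psi>) z) =
      app_map p (component q' \<psi>) (app_comp d p q z)"
    unfolding bicomp_map_component(2) [OF z]
    by (rule component_idl [OF naturalD(1) [OF \<chi>.p.natural_app_map [OF \<psi>.natural_component]
          naturalD(1) [OF pq.natural_app_comp z]]])
qed

lemma bimap_whisk_r:
  assumes "bimap c d p p' \<chi>" "bicom d e q"
  shows "bimap c e (p \<triangleleft>\<^bsub>d\<^esub> q) (p' \<triangleleft>\<^bsub>d\<^esub> q) (whisk_r d p p' \<chi> q)"
    and "z \<in> els (app e (p \<triangleleft>\<^bsub>d\<^esub> q) X) \<Longrightarrow>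
      app_comp d p' q (component (p' \<triangleleft>\<^bsub>d\<^esub> q) (whisk_r d p p' \<chi> q) z) =
      component p' \<chi> (app_comp d p q z)"
proof -
  interpret \<chi>: bimap c d p p' \<chi> by fact
  interpret bicom2_map c d e p p' q q \<chi> idl
    by (intro bicom2_map.intro bimap_idl assms)
  show "bimap c e (p \<triangleleft>\<^bsub>d\<^esub> q) (p' \<triangleleft>\<^bsub>d\<^esub> q) (whisk_r d p p' \<chi> q)"
    by (rule bimap_bicomp_map)
  assume z: "z \<in> els (app e (p \<triangleleft>\<^bsub>d\<^esub> q) X)"
  note z' = naturalD(1) [OF pq.natural_app_comp z]
  have "app_map p (component q idl) (app_comp d p q z) = app_map p (\<lambda>x. x) (app_comp d p q z)"
    by (rule app_map_cong [OF z' component_idl])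
  then show "app_comp d p' q (component (p' \<triangleleft>\<^bsub>d\<^esub> q) (whisk_r d p p' \<chi> q) z) =
      component p' \<chi> (app_comp d p q z)"
    unfolding bicomp_map_component(2) [OF z] app_map_id [OF z'] by (rule arg_cong)
qed

section \<open>The associator\<close>

locale bicom3 = p: bicom c d p + q: bicom d e q + r: bicom e b r
  for c :: "('co, 'ca) cat" and d :: "('do, 'da) cat" and e :: "('eo, 'ea) cat"
    and b :: "('bo, 'ba) cat"
    and p :: "('p, 'x, 'co, 'ca, 'do, 'da) bimod"
    and q :: "('q, 'y, 'do, 'da, 'eo, 'ea) bimod"
    and r :: "('r, 'z, 'eo, 'ea, 'bo, 'ba) bimod"
begin

sublocale pq: bicom2 c d e p q by unfold_locales
sublocale qr: bicom2 d e b q r by unfold_locales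
sublocale pq_r: bicom2 c e b "p \<triangleleft>\<^bsub>d\<^esub> q" r by unfold_locales
sublocale p_qr: bicom2 c d b p "q \<triangleleft>\<^bsub>e\<^esub> r" by unfold_locales

abbreviation pq where "pq \<equiv> p \<triangleleft>\<^bsub>d\<^esub> q"
abbreviation qr where "qr \<equiv> q \<triangleleft>\<^bsub>e\<^esub> r"

lemma assoc_fwd: "fwd (bi_assoc d e p q r) J = app_comp d p q J"
  by (simp add: bi_assoc_def app_comp_def)

text \<open>The position of \<open>q \<triangleleft> r\<close> that the reassociated form of
  \<open>((I, f), g)\<close> has over the direction \<open>x\<close>.\<close>

abbreviation part where
  "part I f g x \<equiv> (f x, \<lambda>y\<in>dir q (f x). g (cls d p q (I, f) (x, y)))"

abbreviation inner where
  "inner I f g \<equiv> \<lambda>x\<in>dir p I. part I f g x"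

lemma assoc_fwd_Pair: "fwd (bi_assoc d e p q r) ((I, f), g) = (I, inner I f g)"
  by (simp add: assoc_fwd pq.app_comp_Pair)

context
  fixes I f g
  assumes I: "I \<in> pos p" and f: "f \<in> Hom d (dirs p I) (poss q)"
    and g: "g \<in> Hom e (dirs pq (I, f)) (poss r)"
begin

lemma inner_Hom: "inner I f g \<in> Hom d (dirs p I) (poss qr)"
  using pq.app_comp_outer_Hom [OF I f g] by (simp only: poss_bicomp)

lemma inner_Hom': "x \<in> dir p I \<Longrightarrow> (\<lambda>y\<in>dir q (f x). g (cls d p q (I, f) (x, y))) \<in> Hom e (dirs q (f x)) (poss r)"
  using pq.app_comp_inner_Hom [OF I f g] .

text \<open>The inner class, for fixed \<open>x\<close>: a generator along \<open>h\<close> in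
  \<open>q \<triangleleft> r\<close> becomes one along \<open>h\<close> in
  \<open>(p \<triangleleft> q) \<triangleleft> r\<close>, as \<open>dact\<close> on
  \<open>p \<triangleleft> q\<close> acts on the second direction.\<close>

lemma assoc_inner:
  assumes x: "x \<in> dir p I"
  shows "on_class (\<lambda>(y, z). cls e pq r ((I, f), g) (cls d p q (I, f) (x, y), z))
      (cls e q r (part I f g x) (y, z)) =
    cls e pq r ((I, f), g) (cls d p q (I, f) (x, y), z)"
    (is "on_class ?k _ = _")
proof -
  have "on_class ?k (cls e q r (part I f g x) (y, z)) = ?k (y, z)"
  proof (rule on_class_cls, unfold prod.case)
    fix y h z assume *: "y \<in> dir q (f x)" "h \<in> out e (danc q (f x) y)"
      "z \<in> dir r ((\<lambda>y\<in>dir q (f x). g (cls d p q (I, f) (x, y))) (dact q (f x) h y))"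
    have "f x \<in> pos q" using x by (simp add: pq.pos_fun [OF f])
    then have "cls e pq r ((I, f), g) (cls d p q (I, f) (x, y), pull r h (g (cls d p q (I, f) (x, y))) z) =
        cls e pq r ((I, f), g) (dact pq (I, f) h (cls d p q (I, f) (x, y)), z)"
      using * I f x by (intro cls_glue) simp_all
    then show "cls e pq r ((I, f), g) (cls d p q (I, f) (x, y),
          pull r h ((\<lambda>y\<in>dir q (f x). g (cls d p q (I, f) (x, y))) y) z) =
        cls e pq r ((I, f), g) (cls d p q (I, f) (x, dact q (f x) h y), z)"
      using * I f by simp
  qed
  then show ?thesis by simp
qed

text \<open>The outer class: moving \<open>x\<close> along \<open>h\<close> goes with pulling
  \<open>y\<close> back along \<open>h\<close>, a change that the class of \<open>(x, y)\<close> in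
  \<open>p \<triangleleft> q\<close> absorbs.\<close>

lemma assoc_bwd:
  assumes x: "x \<in> dir p I"
    and J: "J = (I, inner I f g)"
    and J': "J' = part I f g x"
  shows "bwd (bi_assoc d e p q r) ((I, f), g) (cls d p qr J (x, cls e q r J' (y, z))) =
    cls e pq r ((I, f), g) (cls d p q (I, f) (x, y), z)"
proof -
  let ?k = "\<lambda>(x, K). on_class (\<lambda>(y, z).
        cls e pq r ((I, f), g) (cls d p q (I, f) (x, y), z)) K"
  have "on_class ?k (cls d p qr (I, inner I f g) (x, cls e q r J' (y, z))) = ?k (x, cls e q r J' (y, z))"
  proof (rule on_class_cls)
    fix x h K assume *: "x \<in> dir p I" "h \<in> out d (danc p I x)"
      "K \<in> dir qr (inner I f g (dact p I h x))"
    have x': "dact p I h x \<in> dir p I" using * I by simp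
    have "inner I f g (dact p I h x) = push qr h (inner I f g x)"
      using Hom_dirsD [OF inner_Hom *(1)] *(2) by simp
    then have push: "part I f g (dact p I h x) =
        push qr h (part I f g x)"
      using *(1) x' by (simp only: restrict_apply')
    obtain y z where y: "y \<in> dir q (f (dact p I h x))"
      and K: "K = cls e q r (part I f g (dact p I h x)) (y, z)"
      using *(3) x' by (auto elim: dir_bicompE)
    have "pull qr h (inner I f g x) K =
        cls e q r (part I f g x) (pull q h (f x) y, z)"
      unfolding K push using * inner_Hom'
      by (simp only: restrict_apply' push_bicomp) (intro qr.pull_bicomp, simp_all add: pq.pos_fun [OF f])
    moreover have "cls d p q (I, f) (x, pull q h (f x) y) = cls d p q (I, f) (dact p I h x, y)"
      using * y by (intro cls_glue)
    ultimately show "?k (x, pull qr h (inner I f g x) K) = ?k (dact p I h x, K)"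
      by (simp add: assoc_inner [OF *(1)] K assoc_inner [OF x'])
  qed
  then show ?thesis
    unfolding J J' by (simp add: bi_assoc_def assoc_inner [OF x])
qed

end

text \<open>The candidate unfolds both brackets of the left composite, down to
  \<open>p(q(r(X)))\<close>, and refolds the inner two; reassociation changes nothing in
  between.\<close>

lemma assoc_component:
  shows "natural c (app b (pq \<triangleleft>\<^bsub>e\<^esub> r) X) (app b (p \<triangleleft>\<^bsub>d\<^esub> qr) X) (component (p \<triangleleft>\<^bsub>d\<^esub> qr) (bi_assoc d e p q r))"
    and "z \<in> els (app b (pq \<triangleleft>\<^bsub>e\<^esub> r) X) \<Longrightarrow>
      app_comp d p qr (component (p \<triangleleft>\<^bsub>d\<^esub> qr) (bi_assoc d e p q r) z) =
      app_map p (app_comp_inv e q r) (app_comp d p q (app_comp e pq r z))"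
proof -
  let ?a = "bi_assoc d e p q r"
  let ?N = "\<lambda>z. app_map p (app_comp_inv e q r) (app_comp d p q (app_comp e pq r z))"
  have N: "natural c (app b (pq \<triangleleft>\<^bsub>e\<^esub> r) X) (app d p (app b qr X)) ?N"
    by (intro natural_comp [OF natural_comp [OF pq_r.natural_app_comp pq.natural_app_comp]
        p.natural_app_map [OF qr.natural_app_comp_inv]])
  have eval: "fwd ?a J = (P, \<lambda>x\<in>dir p P. fst (k x)) \<and> (\<forall>x\<in>dir p P. \<forall>K\<in>dir qr (fst (k x)).
        h (bwd ?a J (cls d p qr (fwd ?a J) (x, K))) = snd (k x) K)"
    if J: "(J, h) \<in> els (app b (pq \<triangleleft>\<^bsub>e\<^esub> r) X)" and NJ: "?N (J, h) = (P, k)" for J h P k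
  proof -
    obtain I f g where Ifg: "J = ((I, f), g)" and I: "I \<in> pos p" and f: "f \<in> Hom d (dirs p I) (poss q)"
      and g: "g \<in> Hom e (dirs pq (I, f)) (poss r)"
      using J by (auto elim!: pos_bicompE)
    let ?w = "\<lambda>x. (f x, \<lambda>y\<in>dir q (f x). (g (cls d p q (I, f) (x, y)), \<lambda>z\<in>dir r (g (cls d p q (I, f) (x, y))).
        h (cls e pq r J (cls d p q (I, f) (x, y), z))))"
    have AB: "app_comp d p q (app_comp e pq r (J, h)) = (I, \<lambda>x\<in>dir p I. ?w x)"
      by (simp add: Ifg pq_r.app_comp_Pair pq.app_comp_Pair cong: restrict_cong)
    have "(I, \<lambda>x\<in>dir p I. ?w x) \<in> els (app d p (app e q (app b r X)))"
      using naturalD(1) [OF pq.natural_app_comp naturalD(1) [OF pq_r.natural_app_comp J]] by (simp only: AB)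
    then have "(\<lambda>x\<in>dir p I. ?w x) \<in> Hom d (dirs p I) (app e q (app b r X))"
      by simp
    note w = Hom_dirsD(1) [OF this]
    have P: "P = I" and k: "k = (\<lambda>x\<in>dir p I. app_comp_inv e q r (?w x))"
      using NJ unfolding AB by (auto cong: restrict_cong)
    have fst_k: "fst (k x) = part I f g x" if "x \<in> dir p I" for x
      using that by (simp add: k qr.app_comp_inv_Pair cong: restrict_cong)
    have "h (bwd ?a J (cls d p qr (fwd ?a J) (x, K))) = snd (k x) K"
      if x: "x \<in> dir p I" and K: "K \<in> dir qr (fst (k x))" for x K
    proof -
      obtain y z where y: "y \<in> dir q (f x)" and z: "z \<in> dir r (g (cls d p q (I, f) (x, y)))"
        and K': "K = cls e q r (part I f g x) (y, z)"
        using K unfolding fst_k [OF x] by (auto elim!: dir_bicompE)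
      have "bwd ?a J (cls d p qr (fwd ?a J) (x, K)) = cls e pq r J (cls d p q (I, f) (x, y), z)"
        unfolding Ifg assoc_fwd_Pair K' by (rule assoc_bwd [OF I f g x refl refl])
      moreover have "snd (app_comp_inv e q r (?w x)) K = h (cls e pq r J (cls d p q (I, f) (x, y), z))"
        using qr.on_class_inner [of "f x" "snd (?w x)" X y z] w [OF x] x y z K [unfolded fst_k [OF x]]
        by (simp add: qr.app_comp_inv_Pair K' cong: restrict_cong)
      ultimately show ?thesis using x by (simp add: k)
    qed
    then show ?thesis
      using fst_k by (simp add: P Ifg assoc_fwd_Pair cong: restrict_cong)
  qed
  note via = p_qr.component_via_app_comp [OF N _ _ pq_r.pq.bicom_axioms]
  show "natural c (app b (pq \<triangleleft>\<^bsub>e\<^esub> r) X) (app b (p \<triangleleft>\<^bsub>d\<^esub> qr) X) (component (p \<triangleleft>\<^bsub>d\<^esub> qr) ?a)"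
    by (rule via(1)) (use eval in blast)+
  show "z \<in> els (app b (pq \<triangleleft>\<^bsub>e\<^esub> r) X) \<Longrightarrow> app_comp d p qr (component (p \<triangleleft>\<^bsub>d\<^esub> qr) ?a z) = ?N z"
    by (rule via(2)) (use eval in blast)+
qed

lemma bimap_assoc: "bimap c b (pq \<triangleleft>\<^bsub>e\<^esub> r) (p \<triangleleft>\<^bsub>d\<^esub> qr) (bi_assoc d e p q r)"
proof (intro bimap_componentI pq_r.pq.bicom_axioms p_qr.pq.bicom_axioms assoc_component(1))
  fix J K assume J: "J \<in> pos (pq \<triangleleft>\<^bsub>e\<^esub> r)" and K: "K \<in> dir (p \<triangleleft>\<^bsub>d\<^esub> qr) (fwd (bi_assoc d e p q r) J)"
  obtain I f g where Ifg: "J = ((I, f), g)" and I: "I \<in> pos p" and f: "f \<in> Hom d (dirs p I) (poss q)"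
    and g: "g \<in> Hom e (dirs pq (I, f)) (poss r)"
    using J by (auto elim!: pos_bicompE)
  from K show "bwd (bi_assoc d e p q r) J K \<in> dir (pq \<triangleleft>\<^bsub>e\<^esub> r) J"
    unfolding Ifg assoc_fwd_Pair
    by (elim dir_bicompE) (auto elim!: dir_bicompE simp: assoc_bwd [OF I f g _ refl refl])
qed

text \<open>Unfolding the inner composite as well cancels the refolding, so that the associator
  disappears from evaluated equations.\<close>

lemma app_comp_assoc:
  assumes z: "z \<in> els (app b (pq \<triangleleft>\<^bsub>e\<^esub> r) X)"
  shows "app_map p (app_comp e q r) (app_comp d p qr (component (p \<triangleleft>\<^bsub>d\<^esub> qr) (bi_assoc d e p q r) z)) =
    app_comp d p q (app_comp e pq r z)"
proof -
  note z' = naturalD(1) [OF pq.natural_app_comp naturalD(1) [OF pq_r.natural_app_comp z]]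
  show ?thesis
    unfolding assoc_component(2) [OF z] app_map_comp
    using app_map_cong [OF z' qr.app_comp_inv_mem(2)] app_map_id [OF z'] by (rule trans)
qed

end

section \<open>The unit bicomodule\<close>

lemma unit_bimod_simps [simp]:
  "pos (unit_bimod c) = Ob c" "dir (unit_bimod c) C = out c C" "anc (unit_bimod c) C = C"
  "push (unit_bimod c) g C = tgt c g" "pull (unit_bimod c) g C h = cmp c h g"
  "danc (unit_bimod c) C h = tgt c h" "dact (unit_bimod c) C g h = cmp c g h"
  by (simp_all add: unit_bimod_def)

lemma bicom_unit:
  assumes "category c"
  shows "bicom c c (unit_bimod c)"
proof (intro bicom.intro assms)
  show "bicomodule c c (unit_bimod c)"
    unfolding bicomodule_def copresheaf_def natural_def
      poss_simps dirs_simps unit_bimod_simps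
    by (intro conjI ballI; (rule category_out [OF assms] refl; assumption)?;
        (simp add: category_out(1,2) [OF assms] category_out(3-8) [OF assms]; fail)?)
qed

text \<open>The morphism from the representable \<open>c[C]\<close> to \<open>X\<close> that
  corresponds to an element \<open>x\<close> over \<open>C\<close>; it is inverse to evaluation at
  the identity of \<open>C\<close>.\<close>

definition yoneda :: "('o, 'a) cat \<Rightarrow> ('x, 'o, 'a) copsh \<Rightarrow> 'x \<Rightarrow> 'o \<times> ('a \<Rightarrow> 'x)" where
  "yoneda c X x = (anch X x, \<lambda>g\<in>out c (anch X x). act X g x)"

lemma natural_yoneda:
  assumes c: "category c" and X: "copresheaf c X"
  shows "natural c X (app c (unit_bimod c) X) (yoneda c X)"
proof (rule naturalI)
  fix x assume x: "x \<in> els X"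
  note x' = copresheafD [OF X x]
  have "natural c (dirs (unit_bimod c) (anch X x)) X (\<lambda>g. act X g x)"
    by (rule naturalI) (simp_all add: x')
  then have "(\<lambda>g\<in>out c (anch X x). act X g x) \<in> Hom c (dirs (unit_bimod c) (anch X x)) X"
    using dirs_restrict_Hom [OF bicom.copresheaf_dirs [OF bicom_unit [OF c]], of "anch X x" X "\<lambda>g. act X g x"]
      x'(1) by simp
  then show "yoneda c X x \<in> els (app c (unit_bimod c) X)" "anch (app c (unit_bimod c) X) (yoneda c X x) = anch X x"
    using x'(1) by (simp_all add: yoneda_def)
  fix g assume g: "g \<in> out c (anch X x)"
  then show "yoneda c X (act X g x) = act (app c (unit_bimod c) X) g (yoneda c X x)"
    using x' category_out(4) [OF c] by (simp add: yoneda_def act_app cong: restrict_cong)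
qed

context bicom
begin

interpretation lunit: bicom2 c c d "unit_bimod c" p
  by (rule bicom2.intro [OF bicom_unit [OF category_left] bicom_axioms])
interpretation runit: bicom2 c d d p "unit_bimod d"
  by (rule bicom2.intro [OF bicom_axioms bicom_unit [OF category_right]])

lemma lunit_inv_bwd:
  assumes I: "I \<in> pos p"
    and J: "J = (anc p I, \<lambda>g\<in>out c (anc p I). push p g I)"
  shows "bwd (bi_lunit_inv c p) I (cls c (unit_bimod c) p J (g, x)) = pull p g I x"
proof -
  have "on_class (\<lambda>(g, x). pull p g I x) (cls c (unit_bimod c) p (anc p I, \<lambda>g\<in>out c (anc p I). push p g I) (g, x)) =
      (\<lambda>(g, x). pull p g I x) (g, x)"
    by (rule on_class_cls) (use I in \<open>simp add: out_left(4)\<close>)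
  then show ?thesis by (simp add: bi_lunit_inv_def J)
qed

lemma lunit_inv_component:
  shows "natural c (app d p X) (app d lunit.pq X) (component lunit.pq (bi_lunit_inv c p))"
    and "z \<in> els (app d p X) \<Longrightarrow>
      app_comp c (unit_bimod c) p (component lunit.pq (bi_lunit_inv c p) z) = yoneda c (app d p X) z"
proof -
  have eval: "fwd (bi_lunit_inv c p) I = (C, \<lambda>g\<in>dir (unit_bimod c) C. fst (k g)) \<and>
      (\<forall>g\<in>dir (unit_bimod c) C. \<forall>x\<in>dir p (fst (k g)).
        h (bwd (bi_lunit_inv c p) I (cls c (unit_bimod c) p (fwd (bi_lunit_inv c p) I) (g, x))) = snd (k g) x)"
    if I: "(I, h) \<in> els (app d p X)" and N: "yoneda c (app d p X) (I, h) = (C, k)" for I h C k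
  proof -
    have "C = anc p I" "k = (\<lambda>g\<in>out c (anc p I). act (app d p X) g (I, h))"
      using N by (auto simp: yoneda_def)
    moreover have "fwd (bi_lunit_inv c p) I = (anc p I, \<lambda>g\<in>out c (anc p I). push p g I)"
      by (simp add: bi_lunit_inv_def)
    ultimately show ?thesis
      using I by (simp add: act_app lunit_inv_bwd cong: restrict_cong)
  qed
  note via = lunit.component_via_app_comp [OF natural_yoneda [OF category_left copresheaf_app] _ _ bicom_axioms]
  show "natural c (app d p X) (app d lunit.pq X) (component lunit.pq (bi_lunit_inv c p))"
    by (rule via(1)) (use eval in blast)+
  show "z \<in> els (app d p X) \<Longrightarrow>
      app_comp c (unit_bimod c) p (component lunit.pq (bi_lunit_inv c p) z) = yoneda c (app d p X) z"
    by (rule via(2)) (use eval in blast)+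
qed

lemma bimap_lunit_inv: "bimap c d p (unit_bimod c \<triangleleft>\<^bsub>c\<^esub> p) (bi_lunit_inv c p)"
proof (intro bimap_componentI bicom_axioms lunit.pq.bicom_axioms lunit_inv_component(1))
  fix I K assume I: "I \<in> pos p" and "K \<in> dir lunit.pq (fwd (bi_lunit_inv c p) I)"
  then have "K \<in> dir lunit.pq (anc p I, \<lambda>g\<in>out c (anc p I). push p g I)"
    by (simp add: bi_lunit_inv_def)
  then show "bwd (bi_lunit_inv c p) I K \<in> dir p I"
    by (elim dir_bicompE) (use I in \<open>simp add: lunit_inv_bwd\<close>)
qed

text \<open>This map leaves a composite, so its component is computed directly: it evaluates a
  morphism out of \<open>c[C]\<close> at the identity.\<close>

lemma lunit_component:
  shows "natural c (app d lunit.pq X) (app d p X) (component p (bi_lunit c p))"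
    and "z \<in> els (app d lunit.pq X) \<Longrightarrow> component p (bi_lunit c p) z =
      (let (C, k) = app_comp c (unit_bimod c) p z in k (ide c C))"
proof -
  let ?N = "\<lambda>z. let (C, k) = app_comp c (unit_bimod c) p z in k (ide c C)"
  have eval: "component p (bi_lunit c p) z = ?N z" if "z \<in> els (app d lunit.pq X)" for z
    using that by (auto elim!: app_elE pos_bicompE simp: bi_lunit_def lunit.app_comp_Pair out_left)
  have "natural c (app c (unit_bimod c) (app d p X)) (app d p X) (\<lambda>(C, k). k (ide c C))"
  proof (rule naturalI; elim app_elE)
    fix z C k assume z: "z = (C, k)" "C \<in> pos (unit_bimod c)"
      and k: "k \<in> Hom c (dirs (unit_bimod c) C) (app d p X)"
    then have C: "ide c C \<in> dir (unit_bimod c) C" "tgt c (ide c C) = C" by (simp_all add: out_left)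
    note k' = Hom_dirsD [OF k]
    show "(case z of (C, k) \<Rightarrow> k (ide c C)) \<in> els (app d p X)"
      "anch (app d p X) (case z of (C, k) \<Rightarrow> k (ide c C)) = anch (app c (unit_bimod c) (app d p X)) z"
      using k'(1,2) [OF C(1)] C(2) by (simp_all add: z)
    fix g assume "g \<in> out c (anch (app c (unit_bimod c) (app d p X)) z)"
    then have g: "g \<in> out c C" by (simp add: z)
    then show "(case act (app c (unit_bimod c) (app d p X)) g z of (C, k) \<Rightarrow> k (ide c C)) =
        act (app d p X) g (case z of (C, k) \<Rightarrow> k (ide c C))"
      using k'(3) [OF C(1), of g] C(2) by (simp add: z act_app out_left(1,3) out_left(6,7) [OF g])
  qed
  from natural_comp [OF lunit.natural_app_comp this]
  show "natural c (app d lunit.pq X) (app d p X) (component p (bi_lunit c p))"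
    by (subst natural_cong [OF lunit.pq.copresheaf_app eval]) (simp_all add: case_prod_beta Let_def)
  show "z \<in> els (app d lunit.pq X) \<Longrightarrow> component p (bi_lunit c p) z = ?N z" by (rule eval)
qed

lemma bimap_lunit: "bimap c d (unit_bimod c \<triangleleft>\<^bsub>c\<^esub> p) p (bi_lunit c p)"
proof (intro bimap_componentI bicom_axioms lunit.pq.bicom_axioms lunit_component(1))
  fix J x assume "J \<in> pos lunit.pq" "x \<in> dir p (fwd (bi_lunit c p) J)"
  then show "bwd (bi_lunit c p) J x \<in> dir lunit.pq J"
    by (elim pos_bicompE) (simp add: bi_lunit_def out_left)
qed

lemma runit_inv_bwd:
  assumes I: "I \<in> pos p"
    and J: "J = (I, \<lambda>x\<in>dir p I. danc p I x)"
    and g: "x \<in> dir p I" "g \<in> out d (danc p I x)"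
  shows "bwd (bi_runit_inv p) I (cls d p (unit_bimod d) J (x, g)) = dact p I g x"
proof -
  have "on_class (\<lambda>(x, g). dact p I g x) (cls d p (unit_bimod d) (I, \<lambda>x\<in>dir p I. danc p I x) (x, g)) =
      (\<lambda>(x, g). dact p I g x) (x, g)"
    by (rule on_class_cls) (use I in simp)
  then show ?thesis by (simp add: bi_runit_inv_def J)
qed

text \<open>Here \<open>yoneda\<close> is applied inside \<open>p\<close>, to the elements of
  \<open>X\<close>, so \<open>X\<close> itself is taken to be a copresheaf; for the left unit it is
  applied to \<open>p(X)\<close>, which is one by \<open>copresheaf_app\<close>.\<close>

lemma runit_inv_component:
  assumes X: "copresheaf d X"
  shows "natural c (app d p X) (app d runit.pq X) (component runit.pq (bi_runit_inv p))"
    and "z \<in> els (app d p X) \<Longrightarrow>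
      app_comp d p (unit_bimod d) (component runit.pq (bi_runit_inv p) z) = app_map p (yoneda d X) z"
proof -
  have eval: "fwd (bi_runit_inv p) I = (P, \<lambda>x\<in>dir p P. fst (k x)) \<and>
      (\<forall>x\<in>dir p P. \<forall>g\<in>dir (unit_bimod d) (fst (k x)).
        h (bwd (bi_runit_inv p) I (cls d p (unit_bimod d) (fwd (bi_runit_inv p) I) (x, g))) = snd (k x) g)"
    if I: "(I, h) \<in> els (app d p X)" and N: "app_map p (yoneda d X) (I, h) = (P, k)" for I h P k
  proof -
    have h: "h \<in> Hom d (dirs p I) X" using I by simp
    have "P = I" "k = (\<lambda>x\<in>dir p I. yoneda d X (h x))" using N by auto
    moreover have "fwd (bi_runit_inv p) I = (I, \<lambda>x\<in>dir p I. danc p I x)"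
      by (simp add: bi_runit_inv_def)
    ultimately show ?thesis
      using I by (simp add: yoneda_def runit_inv_bwd Hom_dirsD [OF h] cong: restrict_cong)
  qed
  note via = runit.component_via_app_comp [OF natural_app_map [OF natural_yoneda [OF category_right X]] _ _ bicom_axioms]
  show "natural c (app d p X) (app d runit.pq X) (component runit.pq (bi_runit_inv p))"
    by (rule via(1)) (use eval in blast)+
  show "z \<in> els (app d p X) \<Longrightarrow>
      app_comp d p (unit_bimod d) (component runit.pq (bi_runit_inv p) z) = app_map p (yoneda d X) z"
    by (rule via(2)) (use eval in blast)+
qed

lemma bimap_runit_inv: "bimap c d p (p \<triangleleft>\<^bsub>d\<^esub> unit_bimod d) (bi_runit_inv p)"
proof (intro bimap_componentI bicom_axioms runit.pq.bicom_axioms runit_inv_component(1) copresheaf_dirs)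
  fix I K assume I: "I \<in> pos p" and "K \<in> dir runit.pq (fwd (bi_runit_inv p) I)"
  then have "K \<in> dir runit.pq (I, \<lambda>x\<in>dir p I. danc p I x)"
    by (simp add: bi_runit_inv_def)
  then show "bwd (bi_runit_inv p) I K \<in> dir p I"
    by (elim dir_bicompE) (use I in \<open>simp add: runit_inv_bwd\<close>)
qed

end

section \<open>The right coclosure\<close>

lemma coclosure_simps [simp]:
  "pos (coclosure e q p) = pos p" "anc (coclosure e q p) = anc p" "push (coclosure e q p) = push p"
  "dir (coclosure e q p) I = els (app e q (dirs p I))"
  "pull (coclosure e q p) g I = app_map q (pull p g I)"
  "danc (coclosure e q p) I = anch (app e q (dirs p I))"
  "dact (coclosure e q p) I = act (app e q (dirs p I))"
  by (simp_all add: coclosure_def)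

lemma dirs_coclosure: "dirs (coclosure e q p) I = app e q (dirs p I)"
  by (simp add: dirs_def)

lemma poss_coclosure: "poss (coclosure e q p) = poss p"
  by (simp add: poss_def)

locale coclos = p: bicom c e p + q: bicom d e q
  for c :: "('co, 'ca) cat" and d :: "('do, 'da) cat" and e :: "('eo, 'ea) cat"
    and p :: "('p, 'x, 'co, 'ca, 'eo, 'ea) bimod"
    and q :: "('q, 'y, 'do, 'da, 'eo, 'ea) bimod"
begin

abbreviation L where "L \<equiv> coclosure e q p"
abbreviation u where "u \<equiv> coclosure_unit e q p"

text \<open>The laws for directions are functoriality of \<open>q(-)\<close>, applied to the
  \<open>pull\<close> maps of \<open>p\<close>.\<close>

lemma bicomodule_coclosure: "bicomodule c d L"
  unfolding bicomodule_def poss_coclosure dirs_coclosure coclosure_simps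
proof (intro conjI ballI)
  show "copresheaf c (poss p)" by (rule p.copresheaf_poss)
  fix I assume I: "I \<in> pos p"
  show "copresheaf d (app e q (dirs p I))" by (rule q.copresheaf_app)
  {
    fix z assume z: "z \<in> els (app e q (dirs p I))"
    have "app_map q (pull p (ide c (anc p I)) I) z = app_map q (\<lambda>x. x) z"
      using I by (intro app_map_cong [OF z]) simp
    then show "app_map q (pull p (ide c (anc p I)) I) z = z"
      using app_map_id [OF z] by simp
  }
  fix g assume g: "g \<in> out c (anc p I)"
  show "natural d (app e q (dirs p (push p g I))) (app e q (dirs p I)) (app_map q (pull p g I))"
    by (intro q.natural_app_map p.natural_pull I g)
  fix h z assume h: "h \<in> out c (tgt c g)" and z: "z \<in> els (app e q (dirs p (push p h (push p g I))))"
  show "app_map q (pull p (cmp c h g) I) z = app_map q (pull p g I) (app_map q (pull p h (push p g I)) z)"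
    unfolding app_map_comp using I g h by (intro app_map_cong [OF z]) simp
qed

sublocale L: bicom c d L
  by (intro bicom.intro p.category_left q.category_left bicomodule_coclosure)

sublocale Lq: bicom2 c d e L q
  by unfold_locales

lemma fwd_unit: "fwd u I = (I, \<lambda>z\<in>els (app e q (dirs p I)). fst z)"
  by (simp add: coclosure_unit_def)

text \<open>Evaluation of \<open>z\<close> at \<open>y\<close> is constant on classes, because the
  action on \<open>q(p[I])\<close> precomposes with \<open>pull q\<close>.\<close>

lemma bwd_unit:
  assumes "J = (I, \<lambda>z\<in>els (app e q (dirs p I)). fst z)" "I \<in> pos p"
  shows "bwd u I (cls d L q J (z, y)) = snd z y"
proof -
  have eq: "(\<lambda>((J, h), y). h y) = (\<lambda>(z :: 'q \<times> ('y \<Rightarrow> 'x), y). snd z y)"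
    by (auto simp: fun_eq_iff)
  have "on_class (\<lambda>(z, y). snd z y) (cls d L q (I, \<lambda>z\<in>els (app e q (dirs p I)). fst z) (z, y)) =
      (\<lambda>(z, y). snd z y) (z, y)"
  proof (rule on_class_cls, unfold prod.case)
    fix z g y assume *: "z \<in> dir L I" "g \<in> out d (danc L I z)"
      "y \<in> dir q ((\<lambda>z\<in>els (app e q (dirs p I)). fst z) (dact L I g z))"
    then obtain J h where z: "z = (J, h)" "J \<in> pos q" "h \<in> Hom e (dirs q J) (dirs p I)"
      by (auto elim: app_elE)
    then show "snd z (pull q g ((\<lambda>z\<in>els (app e q (dirs p I)). fst z) z) y) = snd (dact L I g z) y"
      using * by (simp add: act_app q.pull_Hom)
  qed
  then show ?thesis
    by (simp add: coclosure_unit_def assms eq)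
qed

text \<open>Applying \<open>q\<close> to \<open>h: p[I] \<rightarrow> X\<close> gives a morphism
  from \<open>q(p[I])\<close>, the directions of \<open>L\<close> at \<open>I\<close>, to
  \<open>q(X)\<close>, and hence an element of \<open>L(q(X))\<close>.\<close>

lemma unit_component:
  shows "natural c (app e p X) (app e Lq.pq X) (component Lq.pq u)"
    and "(I, h) \<in> els (app e p X) \<Longrightarrow>
      app_comp d L q (component Lq.pq u (I, h)) = (I, \<lambda>z\<in>els (app e q (dirs p I)). app_map q h z)"
proof -
  let ?N = "\<lambda>(I, h). (I, \<lambda>z\<in>els (app e q (dirs p I)). app_map q h z)"
  have N: "natural c (app e p X) (app d L (app e q X)) ?N"
  proof (rule naturalI; elim app_elE)
    fix z I h assume z: "z = (I, h)" and I: "I \<in> pos p" and h: "h \<in> Hom e (dirs p I) X"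
    show "?N z \<in> els (app d L (app e q X))"
      using dirs_restrict_Hom [of d L I, unfolded dirs_coclosure, OF q.copresheaf_app
          q.natural_app_map [OF Hom_natural [OF h]]] I by (simp add: z dirs_coclosure)
    show "anch (app d L (app e q X)) (?N z) = anch (app e p X) z" by (simp add: z)
    fix g assume "g \<in> out c (anch (app e p X) z)"
    then have g: "g \<in> out c (anc p I)" by (simp add: z)
    have "app_map q (pull p g I) w \<in> els (app e q (dirs p I))" if "w \<in> els (app e q (dirs p (push p g I)))" for w
      by (rule naturalD(1) [OF q.natural_app_map [OF p.natural_pull [OF I g]] that])
    moreover have "app_map q (\<lambda>x\<in>dir p (push p g I). h (pull p g I x)) w = app_map q h (app_map q (pull p g I) w)"
      if "w \<in> els (app e q (dirs p (push p g I)))" for w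
      unfolding app_map_comp by (rule app_map_cong [OF that]) simp
    ultimately show "?N (act (app e p X) g z) = act (app d L (app e q X)) g (?N z)"
      by (simp add: z act_app cong: restrict_cong)
  qed
  have eval: "fwd u I = (P, \<lambda>z\<in>dir L P. fst (k z)) \<and> (\<forall>z\<in>dir L P. \<forall>y\<in>dir q (fst (k z)).
        h (bwd u I (cls d L q (fwd u I) (z, y))) = snd (k z) y)"
    if I: "(I, h) \<in> els (app e p X)" and NI: "?N (I, h) = (P, k)" for I h P k
  proof -
    have "P = I" "k = (\<lambda>z\<in>els (app e q (dirs p I)). app_map q h z)" using NI by auto
    moreover have "app_map q h z = (fst z, \<lambda>y\<in>dir q (fst z). h (snd z y))" for z
      by (cases z) simp
    ultimately show ?thesis
      using I by (simp add: fwd_unit bwd_unit cong: restrict_cong)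
  qed
  note via = Lq.component_via_app_comp [OF N _ _ p.bicom_axioms]
  show "natural c (app e p X) (app e Lq.pq X) (component Lq.pq u)"
    by (rule via(1)) (use eval in blast)+
  assume "(I, h) \<in> els (app e p X)"
  then have "app_comp d L q (component Lq.pq u (I, h)) = ?N (I, h)"
    by (rule via(2) [rotated 2]) (use eval in blast)+
  then show "app_comp d L q (component Lq.pq u (I, h)) = (I, \<lambda>z\<in>els (app e q (dirs p I)). app_map q h z)"
    by (simp only: prod.case)
qed

lemma bimap_unit: "bimap c e p (L \<triangleleft>\<^bsub>d\<^esub> q) u"
proof (intro bimap_componentI p.bicom_axioms Lq.pq.bicom_axioms unit_component(1))
  fix I K assume I: "I \<in> pos p" and "K \<in> dir Lq.pq (fwd u I)"
  then obtain z y where z: "z \<in> els (app e q (dirs p I))" and y: "y \<in> dir q (fst z)"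
    and K: "K = cls d L q (I, \<lambda>z\<in>els (app e q (dirs p I)). fst z) (z, y)"
    unfolding fwd_unit by (auto elim!: dir_bicompE)
  have "snd z \<in> Hom e (dirs q (fst z)) (dirs p I)" using z by (auto elim: app_elE)
  from Hom_dirsD(1) [OF this y] show "bwd u I K \<in> dir p I"
    unfolding K bwd_unit [OF refl I] by simp
qed

end

section \<open>The adjunction of the coclosure\<close>

locale adj = coclos c d e p q + r: bicom c d r
  for c :: "('co, 'ca) cat" and d :: "('do, 'da) cat" and e :: "('eo, 'ea) cat"
    and p :: "('p, 'x, 'co, 'ca, 'eo, 'ea) bimod"
    and q :: "('q, 'y, 'do, 'da, 'eo, 'ea) bimod"
    and r :: "('r, 'z, 'co, 'ca, 'do, 'da) bimod"
begin

sublocale rq: bicom2 c d e r q by unfold_locales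

abbreviation rq where "rq \<equiv> r \<triangleleft>\<^bsub>d\<^esub> q"

definition transpose where
  "transpose \<psi> = whisk_r d L r \<psi> q \<odot> u"

text \<open>The inverse of \<open>transpose\<close>, read off at the identity of
  \<open>p[I]\<close>: evaluating \<phi> there gives an element of \<open>r(q(p[I]))\<close>, that
  is, a position of \<open>r\<close> with a morphism from its directions to \<open>q(p[I])\<close>,
  the directions of \<open>L\<close> at \<open>I\<close>.\<close>

definition mate where
  "mate \<phi> = \<lparr>fwd = (\<lambda>I. fst (fwd \<phi> I)),
     bwd = (\<lambda>I. snd (app_comp d r q (component rq \<phi> (gen p I))))\<rparr>"

lemma bimap_transpose: "bimap c d L r \<psi> \<Longrightarrow> bimap c e p rq (transpose \<psi>)"
  unfolding transpose_def by (intro bimap_lcomp [OF bimap_unit] bimap_whisk_r(1) q.bicom_axioms)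

lemma app_comp_transpose:
  assumes \<psi>: "bimap c d L r \<psi>" and z: "(I, h) \<in> els (app e p X)"
  shows "app_comp d r q (component rq (transpose \<psi>) (I, h)) =
    (fwd \<psi> I, \<lambda>x\<in>dir r (fwd \<psi> I). app_map q h (bwd \<psi> I x))"
proof -
  interpret \<psi>: bimap c d L r \<psi> by fact
  note w = bimap_whisk_r [OF \<psi> q.bicom_axioms]
  show ?thesis
    unfolding transpose_def component_bimap_lcomp [OF bimap_unit w(1) z]
      w(2) [OF bimap_component_mem [OF bimap_unit z]] unit_component(2) [OF z]
    using z \<psi>.bwd_simps(1) [of I] by (simp cong: restrict_cong)
qed

lemma app_map_id_dir: "z \<in> els (app e q (dirs p I)) \<Longrightarrow> app_map q (\<lambda>x\<in>dir p I. x) z = z"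
  using app_map_cong [where f = "\<lambda>x\<in>dir p I. x" and f' = "\<lambda>x. x"] app_map_id by fastforce

lemma app_comp_transpose_id:
  assumes \<psi>: "bimap c d L r \<psi>" and I: "I \<in> pos p"
  shows "app_comp d r q (component rq (transpose \<psi>) (gen p I)) =
    (fwd \<psi> I, \<lambda>x\<in>dir r (fwd \<psi> I). bwd \<psi> I x)"
proof -
  interpret \<psi>: bimap c d L r \<psi> by fact
  show ?thesis
    using I p.id_Hom \<psi>.bwd_simps(1) [of I]
    by (simp add: app_comp_transpose [OF \<psi>, of _ _ "dirs p I"] app_map_id_dir del: component_Pair cong: restrict_cong)
qed

text \<open>At the identities the transpose returns \<psi> itself, by
  \<open>app_comp_transpose_id\<close>, and \<open>app_comp\<close> is injective.\<close>

lemma transpose_lens_eq_iff: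
  assumes \<psi>: "bimap c d L r \<psi>" "bimap c d L r \<psi>'"
  shows "lens_eq p rq (transpose \<psi>) (transpose \<psi>') \<longleftrightarrow> lens_eq L r \<psi> \<psi>'"
proof -
  note t = bimap_transpose [OF \<psi>(1)] bimap_transpose [OF \<psi>(2)]
  have "component rq (transpose \<psi>) (gen p I) = component rq (transpose \<psi>') (gen p I) \<longleftrightarrow>
      fwd \<psi> I = fwd \<psi>' I \<and> (\<forall>x\<in>dir r (fwd \<psi> I). bwd \<psi> I x = bwd \<psi>' I x)" if I: "I \<in> pos p" for I
  proof -
    have i: "gen p I \<in> els (app e p (dirs p I))" using I by (rule p.gen_mem)
    note inj = rq.app_comp_inj [OF bimap_component_mem [OF t(1) i] bimap_component_mem [OF t(2) i]]
    have "component rq (transpose \<psi>) (gen p I) = component rq (transpose \<psi>') (gen p I) \<longleftrightarrow>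
        (fwd \<psi> I, \<lambda>x\<in>dir r (fwd \<psi> I). bwd \<psi> I x) = (fwd \<psi>' I, \<lambda>x\<in>dir r (fwd \<psi>' I). bwd \<psi>' I x)"
      unfolding app_comp_transpose_id [OF \<psi>(1) I, symmetric] app_comp_transpose_id [OF \<psi>(2) I, symmetric]
      by (rule iffI, simp only:, erule inj)
    then show ?thesis
      by (cases "fwd \<psi> I = fwd \<psi>' I") (simp_all add: restrict_eq_iff del: component_Pair)
  qed
  then show ?thesis
    unfolding lens_eq_bimap_iff [OF t] unfolding lens_eq_def by (simp del: component_Pair)
qed

context
  fixes \<phi>
  assumes \<phi>: "bimap c e p rq \<phi>"
begin

interpretation \<phi>: bimap c e p rq \<phi>
  by (rule \<phi>)

abbreviation mate_at where "mate_at I \<equiv> (fwd (mate \<phi>) I, bwd (mate \<phi>) I)"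

lemma app_comp_gen: "app_comp d r q (component rq \<phi> (gen p I)) = mate_at I"
  by (cases "fwd \<phi> I") (simp add: mate_def rq.app_comp_Pair)

lemma mate_at_mem: "I \<in> pos p \<Longrightarrow> mate_at I \<in> els (app d r (app e q (dirs p I)))"
  using naturalD(1) [OF rq.natural_app_comp bimap_component_mem [OF \<phi> p.gen_mem]]
  by (simp only: app_comp_gen)

text \<open>Naturality of \<phi> in the copresheaf, as \<open>(I, h)\<close> is the image of the
  identity under \<open>h\<close>.\<close>

lemma app_comp_mate:
  assumes z: "(I, h) \<in> els (app e p X)"
  shows "app_comp d r q (component rq \<phi> (I, h)) = app_map r (app_map q h) (mate_at I)"
proof -
  have i: "gen p I \<in> els (app e p (dirs p I))" and h: "h \<in> Hom e (dirs p I) X"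
    using z p.gen_mem by simp_all
  have "(I, h) = app_map p h (gen p I)"
    by (simp add: Hom_dirs_restrict_eq [OF h] cong: restrict_cong)
  then show ?thesis
    using rq.app_comp_app_map [OF bimap_component_mem [OF \<phi> i], of h] \<phi>.component_app_map [OF i, of h]
    by (simp only: app_comp_gen)
qed

text \<open>Naturality of \<phi> over \<open>c\<close>: acting by \<open>g\<close> on the identity
  of \<open>p[I]\<close> gives \<open>pull p g I\<close>, which is also the image of the identity of
  \<open>p[push p g I]\<close>.\<close>

lemma act_mate_at:
  assumes I: "I \<in> pos p" and g: "g \<in> out c (anc p I)"
  shows "act (app d r (app e q (dirs p I))) g (mate_at I) =
    app_map r (app_map q (pull p g I)) (mate_at (push p g I))"
proof -
  note i = p.gen_mem [OF I] and n = naturalD [OF natural_comp [OF \<phi>.natural_component rq.natural_app_comp]]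
  have act: "act (app e p (dirs p I)) g (gen p I) = (push p g I, \<lambda>x\<in>dir p (push p g I). pull p g I x)"
    using I g by (simp add: act_app cong: restrict_cong)
  have mem: "(push p g I, \<lambda>x\<in>dir p (push p g I). pull p g I x) \<in> els (app e p (dirs p I))"
    using act copresheafD(3) [OF p.copresheaf_app i, of g] g by simp
  have "act (app d r (app e q (dirs p I))) g (mate_at I) =
      app_map r (app_map q (\<lambda>x\<in>dir p (push p g I). pull p g I x)) (mate_at (push p g I))"
    using n(3) [OF i, of g] g unfolding act app_comp_mate [OF mem] app_comp_gen by simp
  also have "\<dots> = app_map r (app_map q (pull p g I)) (mate_at (push p g I))"
    by (rule app_map_cong [OF mate_at_mem], use I g in simp, erule app_map_cong) simp
  finally show ?thesis .
qed

text \<open>The component of the mate at \<open>(K, k)\<close> is \<open>app_map r k\<close> of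
  \<open>mate_at K\<close>, so naturality reduces to \<open>act_mate_at\<close>.\<close>

lemma bimap_mate: "bimap c d L r (mate \<phi>)"
proof (intro bimap_componentI L.bicom_axioms r.bicom_axioms; unfold coclosure_simps)
  fix I assume "I \<in> pos p"
  then show "bwd (mate \<phi>) I y \<in> els (app e q (dirs p I))" if "y \<in> dir r (fwd (mate \<phi>) I)" for y
    using mate_at_mem [of I] that Hom_dirsD(1) by fastforce
  show "natural c (app d L (dirs L I)) (app d r (dirs L I)) (component r (mate \<phi>))"
  proof (rule naturalI; elim app_elE)
    fix z J h assume z: "z = (J, h)" "J \<in> pos L" and h: "h \<in> Hom d (dirs L J) (dirs L I)"
    then have J: "J \<in> pos p" by simp
    note nat = r.natural_app_map [OF Hom_natural [OF h [unfolded dirs_coclosure]]]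
    have comp: "component r (mate \<phi>) (K, k) = app_map r k (mate_at K)" for K and k :: "'q \<times> ('y \<Rightarrow> 'x) \<Rightarrow> 'q \<times> ('y \<Rightarrow> 'x)"
      by simp
    show "component r (mate \<phi>) z \<in> els (app d r (dirs L I))"
      unfolding z(1) comp dirs_coclosure by (rule naturalD(1) [OF nat mate_at_mem [OF J]])
    show anc: "anch (app d r (dirs L I)) (component r (mate \<phi>) z) = anch (app d L (dirs L I)) z"
      using \<phi>.fwd_simps(2) [OF J] by (cases "fwd \<phi> J") (simp add: mate_def z)
    fix g assume "g \<in> out c (anch (app d L (dirs L I)) z)"
    then have g: "g \<in> out c (anc p J)" by (simp add: z)
    then have g': "g \<in> out c (anch (app d r (app e q (dirs p J))) (mate_at J))" using anc by (simp add: z)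
    have m: "mate_at (push p g J) \<in> els (app d r (app e q (dirs p (push p g J))))"
      using J g by (intro mate_at_mem) simp
    have "component r (mate \<phi>) (act (app d L (dirs L I)) g z) =
        app_map r (\<lambda>x. h (app_map q (pull p g J) x)) (mate_at (push p g J))"
      unfolding z act_app comp coclosure_simps by (rule app_map_cong [OF m]) simp
    also have "\<dots> = app_map r h (act (app d r (app e q (dirs p J))) g (mate_at J))"
      unfolding act_mate_at [OF J g] by (simp only: app_map_comp)
    also have "\<dots> = act (app d r (dirs L I)) g (component r (mate \<phi>) z)"
      unfolding z(1) comp dirs_coclosure by (rule naturalD(3) [OF nat mate_at_mem [OF J] g'])
    finally show "component r (mate \<phi>) (act (app d L (dirs L I)) g z) =
        act (app d r (dirs L I)) g (component r (mate \<phi>) z)" .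
  qed
qed

lemma transpose_mate: "lens_eq p rq (transpose (mate \<phi>)) \<phi>"
  unfolding lens_eq_bimap_iff [OF bimap_transpose [OF bimap_mate] \<phi>]
proof
  fix I assume "I \<in> pos p"
  then have i: "gen p I \<in> els (app e p (dirs p I))" by (rule p.gen_mem)
  show "component rq (transpose (mate \<phi>)) (gen p I) = component rq \<phi> (gen p I)"
    by (rule rq.app_comp_inj [OF bimap_component_mem [OF bimap_transpose [OF bimap_mate] i]
          bimap_component_mem [OF \<phi> i]])
      (simp only: app_comp_transpose [OF bimap_mate i] app_comp_mate [OF i] app_map_Pair)
qed

end

end

text \<open>Makes \<open>L\<close> with its unit the instance of the adjunction in which \<psi> is
  the identity; the structure of \<open>L\<close> is found by evaluating the conditions in this
  instance.\<close>

lemma (in coclos) transpose_idl: "lens_eq p (L \<triangleleft>\<^bsub>d\<^esub> q) (whisk_r d L L idl q \<odot> u) u"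
proof -
  interpret adj c d e p q L by unfold_locales
  note t = bimap_transpose [OF bimap_idl [OF L.bicom_axioms]]
  show ?thesis
    unfolding transpose_def [symmetric] lens_eq_bimap_iff [OF t bimap_unit]
  proof
    fix I assume "I \<in> pos p"
    then have i: "gen p I \<in> els (app e p (dirs p I))" by (rule p.gen_mem)
    show "component Lq.pq (transpose idl) (gen p I) = component Lq.pq u (gen p I)"
      by (rule Lq.app_comp_inj [OF bimap_component_mem [OF t i] bimap_component_mem [OF bimap_unit i]])
        (simp only: app_comp_transpose [OF bimap_idl [OF L.bicom_axioms] i] unit_component(2) [OF i],
          simp add: idl_def)
  qed
qed

section \<open>Familial monads\<close>

locale fam_monad =
  fixes c :: "('o, 'a) cat"
    and m :: "('i, 'd, 'o, 'a, 'o, 'a) bimod"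
    and \<eta> :: "('o, 'a, 'i, 'd) lens"
    and \<mu> :: "('i \<times> ('d \<Rightarrow> 'i), ('d \<times> 'd) set, 'i, 'd) lens"
  assumes category: "category c"
    and monad: "familial_monad c m \<eta> \<mu>"
begin

sublocale m: bicom c c m
  by (intro bicom.intro category) (use monad in \<open>simp add: familial_monad_def\<close>)

sublocale m3: bicom3 c c c c m m m by unfold_locales

abbreviation mm where "mm \<equiv> m \<triangleleft>\<^bsub>c\<^esub> m"
abbreviation T where "T X \<equiv> app c m X"
abbreviation mult where "mult \<equiv> mult_at c m \<mu>"
abbreviation unit where "unit X \<equiv> unit_at c m \<eta> X"

sublocale \<eta>: bimap c c "unit_bimod c" m \<eta>
  by (rule bimap_hom [OF bicom_unit [OF category] m.bicom_axioms])
    (use monad in \<open>simp add: familial_monad_def\<close>)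

sublocale \<mu>: bimap c c mm m \<mu>
  by (rule bimap_hom [OF m3.pq.pq.bicom_axioms m.bicom_axioms])
    (use monad in \<open>simp add: familial_monad_def\<close>)

lemma unit_yoneda: "unit X x = component m \<eta> (yoneda c X x)"
  by (simp only: unit_at_def yoneda_def)

lemma natural_unit:
  assumes "copresheaf c X"
  shows "natural c X (T X) (unit X)"
  unfolding unit_yoneda [abs_def]
  by (rule natural_comp [OF natural_yoneda [OF category assms] \<eta>.natural_component])

lemma app_map_unit:
  assumes "copresheaf c X" "natural c X Y f" "x \<in> els X"
  shows "app_map m f (unit X x) = unit Y (f x)"
proof -
  have "app_map (unit_bimod c) f (yoneda c X x) = yoneda c Y (f x)"
    using naturalD [OF assms(2,3)] by (simp add: yoneda_def cong: restrict_cong)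
  then show ?thesis
    unfolding unit_yoneda
    using \<eta>.component_app_map [OF naturalD(1) [OF natural_yoneda [OF category assms(1)] assms(3)], of f]
    by (simp only:)
qed

lemma natural_mult: "natural c (T (T X)) (T X) mult"
  unfolding mult_at_def [abs_def]
  by (rule natural_comp [OF m3.pq.natural_app_comp_inv \<mu>.natural_component])

lemma mult_app_map:
  assumes "z \<in> els (T (T X))" "natural c X Y f"
  shows "mult (app_map m (app_map m f) z) = app_map m f (mult z)"
  unfolding mult_at_def m3.pq.app_comp_inv_app_map [OF assms]
  by (rule \<mu>.component_app_map [OF m3.pq.app_comp_inv_mem(1) [OF assms(1)]])

abbreviation A where "A \<equiv> app_comp c m m"

lemma A_mem: "z \<in> els (app c mm X) \<Longrightarrow> A z \<in> els (T (T X))"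
  by (rule naturalD(1) [OF m3.pq.natural_app_comp])

lemma component_mult: "z \<in> els (app c mm X) \<Longrightarrow> component m \<mu> z = mult (A z)"
  by (simp add: mult_at_def m3.pq.app_comp_inv_app_comp)

text \<open>The unit law of the lenses at \<open>z\<close>: \<open>bi_lunit_inv\<close> turns into
  \<open>yoneda\<close> at \<open>T X\<close> and the whiskered \<eta> into its component there;
  together they are the unit at \<open>T X\<close>.\<close>

lemma mult_unit:
  assumes z: "z \<in> els (T X)"
  shows "mult (unit (T X) z) = z"
proof -
  note w = bimap_whisk_r [OF \<eta>.bimap_axioms m.bicom_axioms] and l = m.bimap_lunit_inv
  note lz = bimap_component_mem [OF l z]
  have "lens_eq m m (\<mu> \<odot> whisk_r c (unit_bimod c) m \<eta> m \<odot> bi_lunit_inv c m) idl"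
    using monad by (simp add: familial_monad_def)
  from component_cong [OF this z] show ?thesis
    unfolding component_idl [OF z]
      component_bimap_lcomp [OF bimap_lcomp [OF l w(1)] \<mu>.bimap_axioms z]
      component_bimap_lcomp [OF l w(1) z] component_mult [OF bimap_component_mem [OF w(1) lz]]
      w(2) [OF lz] m.lunit_inv_component(2) [OF z] unit_yoneda .
qed

text \<open>Evaluates \<open>m \<triangleleft> \<eta>\<close>, for the second unit law and for the
  right-hand side of the counit condition.\<close>

lemma A_unit:
  assumes z: "z \<in> els (T X)" and X: "copresheaf c X"
  shows "A (component mm (whisk_l c m (unit_bimod c) \<eta> \<odot> bi_runit_inv m) z) = app_map m (unit X) z"
proof -
  note w = bimap_whisk_l [OF m.bicom_axioms \<eta>.bimap_axioms] and r = m.bimap_runit_inv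
  show ?thesis
    unfolding component_bimap_lcomp [OF r w(1) z] w(2) [OF bimap_component_mem [OF r z]]
      m.runit_inv_component(2) [OF X z] app_map_comp unit_yoneda [abs_def] ..
qed

lemma bimap_unit_runit: "bimap c c m mm (whisk_l c m (unit_bimod c) \<eta> \<odot> bi_runit_inv m)"
  by (intro bimap_lcomp [OF m.bimap_runit_inv] bimap_whisk_l(1) m.bicom_axioms \<eta>.bimap_axioms)

lemma mult_app_map_unit:
  assumes z: "z \<in> els (T X)" and X: "copresheaf c X"
  shows "mult (app_map m (unit X) z) = z"
proof -
  have "lens_eq m m (\<mu> \<odot> whisk_l c m (unit_bimod c) \<eta> \<odot> bi_runit_inv m) idl"
    using monad by (simp add: familial_monad_def)
  from component_cong [OF this z] show ?thesis
    unfolding component_idl [OF z] component_bimap_lcomp [OF bimap_unit_runit \<mu>.bimap_axioms z]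
      component_mult [OF bimap_component_mem [OF bimap_unit_runit z]] A_unit [OF z X] .
qed

text \<open>The associator followed by whiskering with \<mu> occurs both in the associative law of
  the monad and in the comultiplication condition.\<close>

lemma A_mult_assoc:
  assumes v: "v \<in> els (app c (mm \<triangleleft>\<^bsub>c\<^esub> m) X)"
  shows "A (component mm (whisk_l c m mm \<mu>) (component (m \<triangleleft>\<^bsub>c\<^esub> mm) (bi_assoc c c m m m) v)) =
    app_map m mult (A (app_comp c mm m v))"
proof -
  note av = bimap_component_mem [OF m3.bimap_assoc v]
  show ?thesis
    unfolding bimap_whisk_l(2) [OF m.bicom_axioms \<mu>.bimap_axioms av] m3.app_comp_assoc [OF v, symmetric] app_map_comp
    by (rule app_map_cong [OF naturalD(1) [OF m3.p_qr.natural_app_comp av] component_mult])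
qed

lemma mult_mult:
  assumes W: "W \<in> els (T (T (T X)))"
  shows "mult (mult W) = mult (app_map m mult W)"
proof -
  \<comment> \<open>The associative law concerns
    \<open>(m \<triangleleft> m) \<triangleleft> m\<close>, so \<open>W\<close> is folded up in two
    steps to an element of that composite.\<close>
  let ?Z1 = "app_comp_inv c m m W"
  let ?Z = "app_comp_inv c mm m ?Z1"
  note Z1 = m3.pq.app_comp_inv_mem [OF W]
  note Z = m3.pq_r.app_comp_inv_mem [OF Z1(1)]
  note l = bimap_whisk_r [OF \<mu>.bimap_axioms m.bicom_axioms]
    and r = bimap_whisk_l [OF m.bicom_axioms \<mu>.bimap_axioms] and a = m3.bimap_assoc
  have N: "component m \<mu> ?Z1 = mult W" by (simp only: mult_at_def)
  have "lens_eq (mm \<triangleleft>\<^bsub>c\<^esub> m) m (\<mu> \<odot> whisk_r c mm m \<mu> m) (\<mu> \<odot> whisk_l c m mm \<mu> \<odot> bi_assoc c c m m m)"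
    using monad by (simp add: familial_monad_def)
  from component_cong [OF this Z(1)] show ?thesis
    unfolding component_bimap_lcomp [OF l(1) \<mu>.bimap_axioms Z(1)]
      component_bimap_lcomp [OF bimap_lcomp [OF a r(1)] \<mu>.bimap_axioms Z(1)] component_bimap_lcomp [OF a r(1) Z(1)]
      component_mult [OF bimap_component_mem [OF l(1) Z(1)]] l(2) [OF Z(1)]
      component_mult [OF bimap_component_mem [OF r(1) bimap_component_mem [OF a Z(1)]]]
      A_mult_assoc [OF Z(1)] Z(2) N Z1(2) .
qed

section \<open>The theory category\<close>

text \<open>The Kleisli extension of \<open>k: X \<rightarrow> T Y\<close>.\<close>

definition ext where "ext k z = mult (app_map m k z)"

lemma natural_ext: "natural c X (T Y) k \<Longrightarrow> natural c (T X) (T Y) (ext k)"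
  unfolding ext_def [abs_def] by (intro natural_comp [OF m.natural_app_map natural_mult])

lemma ext_cong: "z \<in> els (T X) \<Longrightarrow> (\<And>x. x \<in> els X \<Longrightarrow> k x = k' x) \<Longrightarrow> ext k z = ext k' z"
  unfolding ext_def by (metis app_map_cong)

lemma ext_unit:
  assumes "copresheaf c X" "natural c X (T Y) k" "x \<in> els X"
  shows "ext k (unit X x) = k x"
  unfolding ext_def app_map_unit [OF assms] by (rule mult_unit [OF naturalD(1) [OF assms(2,3)]])

lemma ext_of_unit: "copresheaf c X \<Longrightarrow> z \<in> els (T X) \<Longrightarrow> ext (unit X) z = z"
  by (simp add: ext_def mult_app_map_unit)

lemma ext_ext:
  assumes l: "natural c X (T Y) l" and k: "natural c Y (T Z) k" and z: "z \<in> els (T X)"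
  shows "ext k (ext l z) = ext (\<lambda>x. ext k (l x)) z"
proof -
  have lz: "app_map m l z \<in> els (T (T Y))"
    using naturalD(1) [OF m.natural_app_map [OF l] z] .
  have klz: "app_map m (app_map m k) (app_map m l z) \<in> els (T (T (T Z)))"
    using naturalD(1) [OF m.natural_app_map [OF m.natural_app_map [OF k]] lz] .
  have "ext k (ext l z) = mult (mult (app_map m (app_map m k) (app_map m l z)))"
    by (simp add: ext_def mult_app_map [OF lz k])
  also have "\<dots> = ext (\<lambda>x. ext k (l x)) z"
    unfolding mult_mult [OF klz] by (simp add: app_map_comp ext_def [abs_def])
  finally show ?thesis .
qed

lemma app_map_ext:
  assumes "natural c X (T Y) k" "natural c Y Z f" "z \<in> els (T X)"
  shows "app_map m f (ext k z) = ext (\<lambda>x. app_map m f (k x)) z"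
  unfolding ext_def mult_app_map [OF naturalD(1) [OF m.natural_app_map [OF assms(1)] assms(3)] assms(2), symmetric]
  by (simp add: app_map_comp)

abbreviation \<Theta> where "\<Theta> \<equiv> Theta c m \<eta> \<mu>"

lemma Theta_simps [simp]:
  "Ob \<Theta> = pos m"
  "(M', M, k) \<in> Ar \<Theta> \<longleftrightarrow> M' \<in> pos m \<and> M \<in> pos m \<and> k \<in> Hom c (dirs m M') (T (dirs m M))"
  "src \<Theta> (M', M, k) = M'" "tgt \<Theta> (M', M, k) = M"
  "ide \<Theta> M = (M, M, \<lambda>x\<in>dir m M. unit (dirs m M) x)"
  "cmp \<Theta> (M1', M1, k) (M2', M2, l) = (M2', M1, \<lambda>x\<in>dir m M2'. ext k (l x))"
  by (simp_all add: Theta_def ext_def)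

lemma ArE:
  assumes "f \<in> Ar \<Theta>"
  obtains M' M k where "f = (M', M, k)" "M' \<in> pos m" "M \<in> pos m" "k \<in> Hom c (dirs m M') (T (dirs m M))"
  using assms by (cases f) auto

lemma unit_Hom: "M \<in> pos m \<Longrightarrow> (\<lambda>x\<in>dir m M. unit (dirs m M) x) \<in> Hom c (dirs m M) (T (dirs m M))"
  by (intro dirs_restrict_Hom m.copresheaf_dirs natural_unit)

lemma ext_Hom:
  assumes "M2 \<in> pos m" "l \<in> Hom c (dirs m M2) (T X)" "natural c X (T Y) k"
  shows "(\<lambda>x\<in>dir m M2. ext k (l x)) \<in> Hom c (dirs m M2) (T Y)"
  by (intro m.comp_Hom [OF assms(1,2)] natural_ext assms(3))

text \<open>The Kleisli laws are \<open>ext_unit\<close>, \<open>ext_of_unit\<close> and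
  \<open>ext_ext\<close>; as identities and composites are extensional, \<open>ext_cong\<close>
  passes between a function and its restriction.\<close>

lemma category_Theta: "category \<Theta>"
  unfolding category_def
proof (intro conjI ballI impI)
  fix f assume "f \<in> Ar \<Theta>"
  then obtain M' M k where f: "f = (M', M, k)" "M' \<in> pos m" "M \<in> pos m"
    and k: "k \<in> Hom c (dirs m M') (T (dirs m M))" by (rule ArE)
  note kx = Hom_dirsD(1) [OF k]
  show "src \<Theta> f \<in> Ob \<Theta>" "tgt \<Theta> f \<in> Ob \<Theta>" using f by simp_all
  have "ext k (unit (dirs m M') x) = k x" if "x \<in> dir m M'" for x
    using that f by (intro ext_unit [OF m.copresheaf_dirs Hom_natural [OF k]]) simp_all
  then show "cmp \<Theta> f (ide \<Theta> (src \<Theta> f)) = f"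
    using f k by (simp add: Hom_dirs_restrict_eq cong: restrict_cong)
  have "ext (restrict (unit (dirs m M)) (dir m M)) (k x) = k x" if "x \<in> dir m M'" for x
    using ext_cong [OF kx [OF that], of "restrict (unit (dirs m M)) (dir m M)" "unit (dirs m M)"]
      ext_of_unit [OF m.copresheaf_dirs kx [OF that]] f(3) by simp
  then show "cmp \<Theta> (ide \<Theta> (tgt \<Theta> f)) f = f"
    using f k by (simp add: Hom_dirs_restrict_eq cong: restrict_cong)
  fix g assume "g \<in> Ar \<Theta>"
  then obtain N' N l where g: "g = (N', N, l)" "N' \<in> pos m" "N \<in> pos m"
    and l: "l \<in> Hom c (dirs m N') (T (dirs m N))" by (rule ArE)
  {
    assume eq: "src \<Theta> g = tgt \<Theta> f"
    have "(\<lambda>x\<in>dir m M'. ext l (k x)) \<in> Hom c (dirs m M') (T (dirs m N))"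
      using f eq g l by (intro ext_Hom [OF f(2) k] Hom_natural) simp
    then show "cmp \<Theta> g f \<in> Ar \<Theta>" "src \<Theta> (cmp \<Theta> g f) = src \<Theta> f" "tgt \<Theta> (cmp \<Theta> g f) = tgt \<Theta> g"
      using f g by simp_all
  }
  fix h assume "h \<in> Ar \<Theta>" and eq: "src \<Theta> g = tgt \<Theta> f \<and> src \<Theta> h = tgt \<Theta> g"
  then obtain O' Q j where h: "h = (O', Q, j)" "O' \<in> pos m" "Q \<in> pos m"
    and j: "j \<in> Hom c (dirs m O') (T (dirs m Q))" by (auto elim: ArE)
  have nat: "natural c (dirs m M) (T (dirs m N)) l" "natural c (dirs m N) (T (dirs m Q)) j"
    using eq f g h Hom_natural [OF l] Hom_natural [OF j] by simp_all
  have "ext j (ext l (k x)) = ext (\<lambda>x\<in>dir m M. ext j (l x)) (k x)" if "x \<in> dir m M'" for x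
    unfolding ext_ext [OF nat kx [OF that]] by (rule ext_cong [OF kx [OF that]]) simp
  then show "cmp \<Theta> h (cmp \<Theta> g f) = cmp \<Theta> (cmp \<Theta> h g) f"
    using f g h eq by (simp cong: restrict_cong)
next
  fix M assume "M \<in> Ob \<Theta>"
  then show "ide \<Theta> M \<in> Ar \<Theta>" "src \<Theta> (ide \<Theta> M) = M" "tgt \<Theta> (ide \<Theta> M) = M"
    using unit_Hom by simp_all
qed

end

lemma op_cat_simps [simp]:
  "Ob (op_cat c) = Ob c" "Ar (op_cat c) = Ar c" "src (op_cat c) = tgt c" "tgt (op_cat c) = src c"
  "ide (op_cat c) = ide c" "cmp (op_cat c) g f = cmp c f g"
  by (simp_all add: op_cat_def)

lemma category_op: "category c \<Longrightarrow> category (op_cat c)"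
  unfolding category_def by auto

section \<open>Cofunctors as comonads\<close>

lemma cat_poly_simps [simp]: "pos (cat_poly c) = Ob c" "dir (cat_poly c) = out c"
  by (simp_all add: cat_poly_def)

lemma cof_bimod_simps [simp]:
  "pos (cof_bimod a \<alpha>) = Ob a" "dir (cof_bimod a \<alpha>) = out a" "anc (cof_bimod a \<alpha>) = fwd \<alpha>"
  "push (cof_bimod a \<alpha>) g A = tgt a (bwd \<alpha> A g)"
  "pull (cof_bimod a \<alpha>) g A h = cmp a h (bwd \<alpha> A g)"
  "danc (cof_bimod a \<alpha>) A h = fwd \<alpha> (tgt a h)"
  "dact (cof_bimod a \<alpha>) A g h = cmp a (bwd \<alpha> (tgt a h) g) h"
  by (simp_all add: cof_bimod_def)

locale cofun =
  fixes a :: "('b, 'e) cat" and c :: "('o, 'a) cat" and \<alpha> :: "('b, 'e, 'o, 'a) lens"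
  assumes cat_dom: "category a" and cat_cod: "category c" and cofunctor: "cofunctor a c \<alpha>"
begin

abbreviation Ca where "Ca \<equiv> cof_bimod a \<alpha>"

lemma cof_simps [simp]:
  assumes "A \<in> Ob a"
  shows "fwd \<alpha> A \<in> Ob c" "bwd \<alpha> A (ide c (fwd \<alpha> A)) = ide a A"
    and "g \<in> out c (fwd \<alpha> A) \<Longrightarrow> bwd \<alpha> A g \<in> out a A"
    and "g \<in> out c (fwd \<alpha> A) \<Longrightarrow> fwd \<alpha> (tgt a (bwd \<alpha> A g)) = tgt c g"
    and "g \<in> out c (fwd \<alpha> A) \<Longrightarrow> h \<in> out c (tgt c g) \<Longrightarrow>
      bwd \<alpha> A (cmp c h g) = cmp a (bwd \<alpha> (tgt a (bwd \<alpha> A g)) h) (bwd \<alpha> A g)"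
proof -
  have l: "is_lens (cat_poly a) (cat_poly c) \<alpha>"
    using cofunctor by (simp add: cofunctor_def)
  then show "fwd \<alpha> A \<in> Ob c" using assms by (auto simp: is_lens_def)
  from l have "bwd \<alpha> \<in> (\<Pi>\<^sub>E A\<in>Ob a. out c (fwd \<alpha> A) \<rightarrow>\<^sub>E out a A)"
    by (simp add: is_lens_def)
  from PiE_mem [OF this assms] show "g \<in> out c (fwd \<alpha> A) \<Longrightarrow> bwd \<alpha> A g \<in> out a A" by auto
qed (use cofunctor assms in \<open>simp_all add: cofunctor_def\<close>)

lemmas out_dom = category_out [OF cat_dom]
lemmas out_cod = category_out [OF cat_cod]

lemma tgt_bwd [simp]: "A \<in> Ob a \<Longrightarrow> g \<in> out c (fwd \<alpha> A) \<Longrightarrow> tgt a (bwd \<alpha> A g) \<in> Ob a"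
  using out_dom(3) cof_simps(3) .

lemma tgt_cmp [simp]:
  "A \<in> Ob a \<Longrightarrow> h \<in> out a A \<Longrightarrow> k \<in> out a (tgt a h) \<Longrightarrow> tgt a (cmp a k h) = tgt a k"
  by (rule out_dom(5))

text \<open>An arrow of \<open>c\<close> acts through its lift, at \<open>A\<close> on positions and
  at the codomain of a direction on directions. The laws then are those of the cofunctor together
  with the category laws of \<open>a\<close>.\<close>

lemma bicom_cof: "bicom c c Ca"
proof (intro bicom.intro cat_cod)
  show "bicomodule c c Ca"
    unfolding bicomodule_def
  proof (intro conjI ballI)
    show "copresheaf c (poss Ca)"
      unfolding copresheaf_def poss_simps cof_bimod_simps
    proof (intro conjI ballI)
      fix A g h assume *: "A \<in> Ob a" "g \<in> out c (fwd \<alpha> A)" "h \<in> out c (tgt c g)"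
      show "tgt a (bwd \<alpha> A (cmp c h g)) = tgt a (bwd \<alpha> (tgt a (bwd \<alpha> A g)) h)"
        using * by (simp add: tgt_cmp [OF *(1)])
    qed (simp_all add: out_dom(2))
    fix A assume "A \<in> pos Ca"
    then have A: "A \<in> Ob a" by simp
    show "copresheaf c (dirs Ca A)"
      unfolding copresheaf_def dirs_simps cof_bimod_simps
    proof (intro conjI ballI)
      fix x assume x: "x \<in> out a A"
      have t: "tgt a x \<in> Ob a" using x by (rule out_dom)
      show "fwd \<alpha> (tgt a x) \<in> Ob c" using t by simp
      show "cmp a (bwd \<alpha> (tgt a x) (ide c (fwd \<alpha> (tgt a x)))) x = x"
        using t x by (simp add: out_dom(7))
      fix g assume g: "g \<in> out c (fwd \<alpha> (tgt a x))"
      have gx: "tgt a (cmp a (bwd \<alpha> (tgt a x) g) x) = tgt a (bwd \<alpha> (tgt a x) g)"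
        using A x g t by (simp add: tgt_cmp)
      show "cmp a (bwd \<alpha> (tgt a x) g) x \<in> out a A"
        using x g t by (simp add: out_dom(4))
      show "fwd \<alpha> (tgt a (cmp a (bwd \<alpha> (tgt a x) g) x)) = tgt c g"
        using gx g t by simp
      fix h assume h: "h \<in> out c (tgt c g)"
      show "cmp a (bwd \<alpha> (tgt a x) (cmp c h g)) x =
          cmp a (bwd \<alpha> (tgt a (cmp a (bwd \<alpha> (tgt a x) g) x)) h) (cmp a (bwd \<alpha> (tgt a x) g) x)"
        unfolding gx using t g h x by (simp add: out_dom(8) [of x A])
    qed
    {
      fix x assume "x \<in> dir Ca A"
      then show "pull Ca (ide c (anc Ca A)) A x = x"
        using A by (simp add: out_dom(6))
    }
    fix g assume "g \<in> out c (anc Ca A)"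
    then have g: "g \<in> out c (fwd \<alpha> A)" by simp
    have l: "bwd \<alpha> A g \<in> out a A" using A g by simp
    show "natural c (dirs Ca (push Ca g A)) (dirs Ca A) (pull Ca g A)"
    proof (rule naturalI; unfold dirs_simps cof_bimod_simps)
      fix x assume x: "x \<in> out a (tgt a (bwd \<alpha> A g))"
      show "cmp a x (bwd \<alpha> A g) \<in> out a A" "fwd \<alpha> (tgt a (cmp a x (bwd \<alpha> A g))) = fwd \<alpha> (tgt a x)"
        using A l x by (simp_all add: out_dom(4) tgt_cmp [OF A])
      fix h assume "h \<in> out c (fwd \<alpha> (tgt a x))"
      then show "cmp a (cmp a (bwd \<alpha> (tgt a x) h) x) (bwd \<alpha> A g) =
          cmp a (bwd \<alpha> (tgt a (cmp a x (bwd \<alpha> A g))) h) (cmp a x (bwd \<alpha> A g))"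
        using A l x by (simp add: tgt_cmp [OF A] out_dom(8) [OF l x] out_dom(3) [OF x])
    qed
    fix h x assume h: "h \<in> out c (tgt c g)"
      and "x \<in> dir Ca (push Ca h (push Ca g A))"
    then have x: "x \<in> out a (tgt a (bwd \<alpha> (tgt a (bwd \<alpha> A g)) h))" by simp
    show "pull Ca (cmp c h g) A x = pull Ca g A
        (pull Ca h (push Ca g A) x)"
      using A g h x by (simp add: out_dom(8) [OF l])
  qed
qed

sublocale cof: bicom c c Ca by (rule bicom_cof)
sublocale cof2: bicom2 c c c Ca Ca by unfold_locales

lemma bimap_counit: "bimap c c Ca (unit_bimod c) \<alpha>"
  by (intro bimapI bicom_cof bicom_unit cat_cod bimod_mapI) simp_all

lemma cof_comult_fwd: "fwd (cof_comult a) A = (A, \<lambda>h\<in>out a A. tgt a h)"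
  by (simp add: cof_comult_def)

text \<open>A generator identifies the two bracketings of a threefold composite with a lift in the
  middle, so composition in \<open>a\<close> is constant on classes by associativity.\<close>

lemma cof_comult_bwd:
  assumes J: "J = (A, \<lambda>h\<in>out a A. tgt a h)" and A: "A \<in> Ob a"
    and hk: "h \<in> out a A" "k \<in> out a (tgt a h)"
  shows "bwd (cof_comult a) A (cls c Ca Ca J (h, k)) = cmp a k h"
proof -
  have "on_class (\<lambda>(h, k). cmp a k h) (cls c Ca Ca (A, \<lambda>h\<in>out a A. tgt a h) (h, k)) =
      (\<lambda>(h, k). cmp a k h) (h, k)"
  proof (rule on_class_cls, unfold prod.case)
    fix x g y assume *: "x \<in> dir Ca A" "g \<in> out c (danc Ca A x)"
      "y \<in> dir Ca ((\<lambda>h\<in>out a A. tgt a h) (dact Ca A g x))"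
    have x: "x \<in> out a A" and t: "tgt a x \<in> Ob a" using * A out_dom(3) by auto
    have g: "bwd \<alpha> (tgt a x) g \<in> out a (tgt a x)" using * t by simp
    have "dact Ca A g x \<in> dir Ca A"
      using A * by (intro cof.dact_simps(3)) simp_all
    then have "y \<in> out a (tgt a (bwd \<alpha> (tgt a x) g))"
      using * x g A by (simp add: tgt_cmp [OF A])
    then show "cmp a (pull Ca g ((\<lambda>h\<in>out a A. tgt a h) x) y) x =
        cmp a y (dact Ca A g x)"
      using x g by (simp add: out_dom(8))
  qed
  then show ?thesis by (simp add: cof_comult_def J)
qed

lemma tgt_Hom: "A \<in> Ob a \<Longrightarrow> (\<lambda>h\<in>out a A. tgt a h) \<in> Hom c (dirs Ca A) (poss Ca)"
proof -
  assume A: "A \<in> Ob a"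
  have "natural c (dirs Ca A) (poss Ca) (tgt a)"
    using A out_dom(3) by (intro naturalI) (auto simp: tgt_cmp [OF A])
  then show ?thesis
    using dirs_restrict_Hom [OF cof.copresheaf_dirs, of A] A by simp
qed

lemma bimap_comult:
  "bimap c c Ca (Ca \<triangleleft>\<^bsub>c\<^esub> Ca) (cof_comult a)"
proof (intro bimapI bicom_cof cof2.pq.bicom_axioms)
  let Ca = Ca
  show "bimod_map c c Ca (Ca \<triangleleft>\<^bsub>c\<^esub> Ca) (cof_comult a)"
  proof (rule bimod_mapI; unfold cof_comult_fwd anc_bicomp)
    fix A assume "A \<in> pos Ca"
    then have A: "A \<in> Ob a" by simp
    let ?f = "\<lambda>h\<in>out a A. tgt a h"
    note f = tgt_Hom [OF A]
    show "(A, ?f) \<in> pos (Ca \<triangleleft>\<^bsub>c\<^esub> Ca)" "anc Ca A = anc Ca A"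
      using A f by simp_all
    {
      fix K assume "K \<in> dir (Ca \<triangleleft>\<^bsub>c\<^esub> Ca) (A, ?f)"
      then obtain h k where K: "K = cls c Ca Ca (A, ?f) (h, k)"
        and h: "h \<in> out a A" and k: "k \<in> out a (tgt a h)"
        by (auto elim: dir_bicompE)
      note bwd = cof_comult_bwd [OF refl A]
      have kh: "cmp a k h \<in> out a A" using h k by (rule out_dom)
      show "bwd (cof_comult a) A K \<in> dir Ca A"
        unfolding K bwd [OF h k] using kh by simp
      show "danc Ca A (bwd (cof_comult a) A K) = danc (Ca \<triangleleft>\<^bsub>c\<^esub> Ca) (A, ?f) K"
        unfolding K bwd [OF h k] using A h k f by (simp add: tgt_cmp [OF A])
      fix g assume "g \<in> out c (danc (Ca \<triangleleft>\<^bsub>c\<^esub> Ca) (A, ?f) K)"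
      then have g: "g \<in> out c (fwd \<alpha> (tgt a k))"
        unfolding K using A h k f by simp
      have t: "tgt a h \<in> Ob a" "tgt a k \<in> Ob a" using h k out_dom(3) by auto
      have g': "cmp a (bwd \<alpha> (tgt a k) g) k \<in> out a (tgt a h)"
        using k g t by (intro out_dom(4)) simp_all
      have "dact (Ca \<triangleleft>\<^bsub>c\<^esub> Ca) (A, ?f) g K = cls c Ca Ca (A, ?f) (h, cmp a (bwd \<alpha> (tgt a k) g) k)"
        unfolding K using A h g f by simp
      then show "bwd (cof_comult a) A (dact (Ca \<triangleleft>\<^bsub>c\<^esub> Ca) (A, ?f) g K) = dact Ca A g (bwd (cof_comult a) A K)"
        unfolding K using t g by (simp add: bwd [OF h g'] bwd [OF h k] tgt_cmp [OF A h k] out_dom(8) [OF h k])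
    }
    fix g assume "g \<in> out c (anc Ca A)"
    then have g: "g \<in> out c (fwd \<alpha> A)" by simp
    let ?A = "tgt a (bwd \<alpha> A g)"
    have gA: "bwd \<alpha> A g \<in> out a A" "?A \<in> Ob a" using A g by simp_all
    show push: "(push Ca g A, \<lambda>h\<in>out a (push Ca g A). tgt a h) = push (Ca \<triangleleft>\<^bsub>c\<^esub> Ca) g (A, ?f)"
      using A gA by (simp add: out_dom(4) tgt_cmp [OF A] cong: restrict_cong)
    fix K assume "K \<in> dir (Ca \<triangleleft>\<^bsub>c\<^esub> Ca) (push (Ca \<triangleleft>\<^bsub>c\<^esub> Ca) g (A, ?f))"
    then obtain h k where K: "K = cls c Ca Ca (?A, \<lambda>h\<in>out a ?A. tgt a h) (h, k)"
      and h: "h \<in> out a ?A" and k: "k \<in> out a (tgt a h)"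
      unfolding push [symmetric] by (auto elim: dir_bicompE)
    have "pull (Ca \<triangleleft>\<^bsub>c\<^esub> Ca) g (A, ?f) K = cls c Ca Ca (A, ?f) (pull Ca g A h, k)"
      unfolding K using A g f push by (intro cof2.pull_bicomp) simp_all
    then show "bwd (cof_comult a) A (pull (Ca \<triangleleft>\<^bsub>c\<^esub> Ca) g (A, ?f) K) =
        pull Ca g A (bwd (cof_comult a) (push Ca g A) K)"
      using h k gA A
      by (simp add: cof_comult_bwd [OF refl A] out_dom(4) [OF gA(1) h] tgt_cmp [OF A gA(1) h] K
          cof_comult_bwd [OF refl gA(2) h k] out_dom(8) [OF gA(1) h k])
  qed
qed

end

text \<open>By \<open>over\<close>, a lift along \<beta> is the lift along \<open>F\<close> of a
  lift along \<alpha>; so \<open>F\<close> respects both actions because it respects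
  composites.\<close>

lemma bimap_cofunctor:
  assumes "category a" "category b" "category c" "cofunctor a c \<alpha>" "cofunctor b c \<beta>"
    and F: "cofunctor b a F" and over: "lens_eq (cat_poly b) (cat_poly c) (\<alpha> \<odot> F) \<beta>"
  shows "bimap c c (cof_bimod b \<beta>) (cof_bimod a \<alpha>) F"
proof -
  interpret \<alpha>: cofun a c \<alpha> by (intro cofun.intro assms)
  interpret \<beta>: cofun b c \<beta> by (intro cofun.intro assms)
  interpret F: cofun b a F by (intro cofun.intro assms)
  have *: "fwd \<beta> B = fwd \<alpha> (fwd F B)"
    "g \<in> out c (fwd \<alpha> (fwd F B)) \<Longrightarrow> bwd \<beta> B g = bwd F B (bwd \<alpha> (fwd F B) g)" if "B \<in> Ob b" for B g
    using over that by (simp_all add: lens_eq_def lcomp_def)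
  show ?thesis
  proof (intro bimapI \<alpha>.bicom_cof \<beta>.bicom_cof bimod_mapI; unfold cof_bimod_simps)
    fix B assume B: "B \<in> Ob b"
    show "fwd F B \<in> Ob a" "fwd \<alpha> (fwd F B) = fwd \<beta> B" using B * by simp_all
    {
      fix g assume g: "g \<in> out c (fwd \<beta> B)"
      then show "fwd F (tgt b (bwd \<beta> B g)) = tgt a (bwd \<alpha> (fwd F B) g)"
        using B by (simp add: *)
      fix y assume "y \<in> out a (tgt a (bwd \<alpha> (fwd F B) g))"
      then show "bwd F B (cmp a y (bwd \<alpha> (fwd F B) g)) = cmp b (bwd F (tgt b (bwd \<beta> B g)) y) (bwd \<beta> B g)"
        using B g by (simp add: *)
    }
    fix y assume y: "y \<in> out a (fwd F B)"
    then have t: "tgt b (bwd F B y) \<in> Ob b" "fwd F (tgt b (bwd F B y)) = tgt a y" using B by simp_all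
    show "bwd F B y \<in> out b B" "fwd \<beta> (tgt b (bwd F B y)) = fwd \<alpha> (tgt a y)"
      using B y t by (simp_all add: *)
    fix g assume "g \<in> out c (fwd \<alpha> (tgt a y))"
    then show "bwd F B (cmp a (bwd \<alpha> (tgt a y) g) y) = cmp b (bwd \<beta> (tgt b (bwd F B y)) g) (bwd F B y)"
      using B y t F.out_cod(3) [OF y] by (simp add: *)
  qed
qed

text \<open>Commutation with the projections to \<open>c\<close> follows from the bicomodule
  structure and preservation of identities. Identities, codomains and composites are assumed in the
  shape in which the evaluated conditions supply them.\<close>

lemma cofunctor_bimap:
  assumes "category a" "category b" "category c" "cofunctor a c \<alpha>" "cofunctor b c \<beta>"
    and "is_lens (cat_poly b) (cat_poly a) F"
    and F: "bimap c c (cof_bimod b \<beta>) (cof_bimod a \<alpha>) F"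
    and ide: "\<And>B. B \<in> Ob b \<Longrightarrow> bwd F B (ide a (fwd F B)) = ide b B"
    and tgt: "\<And>B x. B \<in> Ob b \<Longrightarrow> x \<in> out a (fwd F B) \<Longrightarrow> tgt a x = fwd F (tgt b (bwd F B x))"
    and cmp: "\<And>B x w. B \<in> Ob b \<Longrightarrow> x \<in> out a (fwd F B) \<Longrightarrow> w \<in> out a (tgt a x) \<Longrightarrow>
      bwd F B (cmp a w x) = cmp b (bwd F (tgt b (bwd F B x)) w) (bwd F B x)"
  shows "cofunctor b a F" "lens_eq (cat_poly b) (cat_poly c) (\<alpha> \<odot> F) \<beta>"
proof -
  interpret \<alpha>: cofun a c \<alpha> by (intro cofun.intro assms)
  interpret \<beta>: cofun b c \<beta> by (intro cofun.intro assms)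
  interpret F: bimap c c "cof_bimod b \<beta>" "cof_bimod a \<alpha>" F
    by (rule F)
  show "cofunctor b a F"
    unfolding cofunctor_def using assms by auto
  show "lens_eq (cat_poly b) (cat_poly c) (\<alpha> \<odot> F) \<beta>"
    unfolding lens_eq_def lcomp_def cat_poly_simps lens.simps
  proof (intro ballI conjI)
    fix B assume B: "B \<in> Ob b"
    have FB: "fwd F B \<in> Ob a" using F.fwd_simps(1) [of B] B by simp
    show fwd: "fwd \<alpha> (fwd F B) = fwd \<beta> B" using F.fwd_simps(2) [of B] B by simp
    fix g assume g: "g \<in> out c (fwd \<alpha> (fwd F B))"
    have "ide a (fwd F B) \<in> out a (fwd F B)" "tgt a (ide a (fwd F B)) = fwd F B"
      using FB by (simp_all add: \<alpha>.out_dom)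
    \<comment> \<open>The lift of \<open>g\<close> is the action of \<open>g\<close> on the
      identity, so \<open>F\<close> carries lifts to lifts because it respects the action and
      preserves identities.\<close>
    then have "bwd F B (dact (cof_bimod a \<alpha>) (fwd F B) g (ide a (fwd F B))) =
        dact (cof_bimod b \<beta>) B g (bwd F B (ide a (fwd F B)))"
      using B g by (intro F.bwd_simps(3)) simp_all
    then show "bwd F B (bwd \<alpha> (fwd F B) g) = bwd \<beta> B g"
      using B FB g fwd by (simp add: ide \<alpha>.out_dom(2) \<beta>.out_dom(2) \<alpha>.out_dom(6) [of _ "fwd F B"] \<beta>.out_dom(6) [of _ B])
  qed
qed

text \<open>Serves to strip nested composites layer by layer from an equation.\<close>

lemma app_map_inj:
  assumes "z \<in> els (app d p X)" "z' \<in> els (app d p X)"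
    and f: "\<And>x y. x \<in> els X \<Longrightarrow> y \<in> els X \<Longrightarrow> f x = f y \<Longrightarrow> x = y"
    and eq: "app_map p f z = app_map p f z'"
  shows "z = z'"
proof -
  obtain I h where z: "z = (I, h)" "h \<in> Hom d (dirs p I) X" using assms(1) by (rule app_elE)
  obtain I' h' where z': "z' = (I', h')" "h' \<in> Hom d (dirs p I') X" using assms(2) by (rule app_elE)
  have I: "I' = I" using eq z z' by simp
  have "h = h'"
  proof (rule Hom_dirs_eqI [OF z(2)])
    show "h' \<in> Hom d (dirs p I) X" using z' I by simp
    fix x assume x: "x \<in> dir p I"
    have "(\<lambda>x\<in>dir p I. f (h x)) = (\<lambda>x\<in>dir p I. f (h' x))"
      using eq by (simp add: z z' I)
    from fun_cong [OF this, of x] have "f (h x) = f (h' x)"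
      using x by simp
    then show "h x = h' x"
      using Hom_dirsD(1) [OF z(2) x] Hom_dirsD(1) [OF z'(2), of x] x I f by simp
  qed
  then show ?thesis by (simp add: z z' I)
qed

section \<open>The two conditions, evaluated\<close>

context fam_monad
begin

sublocale lan: coclos c c c m mm by unfold_locales

lemma Lan_eq: "Lan c m = lan.L" "Lan_unit c m = lan.u"
  by (simp_all add: Lan_def Lan_unit_def)

text \<open>\<open>Theta_arr\<close> with the position as a separate argument, which makes
  \<open>\<tau> M\<close> a function from the directions of \<open>L\<close> at \<open>M\<close> to
  the arrows of \<Theta> into \<open>M\<close>.\<close>

definition \<tau> :: "'i \<Rightarrow> ('i \<times> ('d \<Rightarrow> 'i)) \<times> (('d \<times> 'd) set \<Rightarrow> 'd) \<Rightarrow> 'i \<times> 'i \<times> ('d \<Rightarrow> 'i \<times> ('d \<Rightarrow> 'd))"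
  where "\<tau> M z = Theta_arr c m (M, z)"

lemma tau_eq: "\<tau> M z = (fst (A z), M, snd (A z))"
  by (simp add: \<tau>_def Theta_arr_def case_prod_beta Let_def)

lemma tau_eq_iff: "\<tau> M z = (M', M, k) \<longleftrightarrow> A z = (M', k)"
  by (auto simp: tau_eq prod_eq_iff)

end

text \<open>There are two kinds of instances: \<open>a\<close> is \<open>L\<close>, with \<psi> the
  identity and \<phi> the unit, or \<open>a\<close> is the comonad of a cofunctor. The adjointness
  of \<phi> and \<psi> is stated up to \<open>lens_eq\<close>, since \<phi> may be a normalised
  transpose.\<close>

locale fam_monad_over = fam_monad c m \<eta> \<mu> + a: bicom c c a
  for c :: "('o, 'a) cat" and m :: "('i, 'd, 'o, 'a, 'o, 'a) bimod"
    and \<eta> :: "('o, 'a, 'i, 'd) lens"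
    and \<mu> :: "('i \<times> ('d \<Rightarrow> 'i), ('d \<times> 'd) set, 'i, 'd) lens"
    and a :: "('r, 'z, 'o, 'a, 'o, 'a) bimod" +
  fixes \<psi> :: "('i, ('i \<times> ('d \<Rightarrow> 'i)) \<times> (('d \<times> 'd) set \<Rightarrow> 'd), 'r, 'z) lens"
    and \<phi> :: "('i, 'd, 'r \<times> ('z \<Rightarrow> 'i \<times> ('d \<Rightarrow> 'i)), ('z \<times> ('d \<times> 'd) set) set) lens"
  assumes psi: "bimap c c (Lan c m) a \<psi>"
    and phi: "lens_eq m (a \<triangleleft>\<^bsub>c\<^esub> m \<triangleleft>\<^bsub>c\<^esub> m) (whisk_r c (Lan c m) a \<psi> (m \<triangleleft>\<^bsub>c\<^esub> m) \<odot> Lan_unit c m) \<phi>"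
begin

sublocale adj: adj c c c m mm a by unfold_locales

abbreviation amm where "amm \<equiv> a \<triangleleft>\<^bsub>c\<^esub> mm"

sublocale psi: bimap c c lan.L a \<psi> using psi by (simp only: Lan_eq)

lemma phi': "lens_eq m amm (adj.transpose \<psi>) \<phi>"
  using phi by (simp only: adj.transpose_def Lan_eq)

lemma bimap_phi: "bimap c c m amm \<phi>"
  by (rule bimap_cong [OF adj.bimap_transpose [OF psi.bimap_axioms] phi'])

lemma phi_eval:
  assumes z: "(M, h) \<in> els (T X)"
  shows "app_comp c a mm (component amm \<phi> (M, h)) =
    (fwd \<psi> M, \<lambda>x\<in>dir a (fwd \<psi> M). app_map mm h (bwd \<psi> M x))"
  using adj.app_comp_transpose [OF psi.bimap_axioms z] component_cong [OF phi' z] by (simp only:)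

lemma bwd_psi: "M \<in> pos m \<Longrightarrow> x \<in> dir a (fwd \<psi> M) \<Longrightarrow> bwd \<psi> M x \<in> els (app c mm (dirs m M))"
  using psi.bwd_simps(1) [of M x] by simp

lemma fwd_psi: "M \<in> pos m \<Longrightarrow> fwd \<psi> M \<in> pos a" "M \<in> pos m \<Longrightarrow> anc a (fwd \<psi> M) = anc m M"
  using psi.fwd_simps [of M] by simp_all

abbreviation val where "val M \<equiv> (fwd \<psi> M, \<lambda>x\<in>dir a (fwd \<psi> M). bwd \<psi> M x)"
abbreviation nxt where "nxt M x \<equiv> fst (\<tau> M (bwd \<psi> M x))"

lemma phi_gen:
  assumes M: "M \<in> pos m"
  shows "app_comp c a mm (component amm \<phi> (gen m M)) = val M"
  using adj.app_comp_transpose_id [OF psi.bimap_axioms M] component_cong [OF phi' m.gen_mem [OF M]]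
  by (simp only:)

text \<open>At the identity of \<open>m[M]\<close> the left side is \<psi> at the direction that
  \<epsilon> assigns to an identity of \<open>c\<close>. The right side is the monad unit applied
  inside that element, which is the Kleisli identity of \<open>M\<close>. Injectivity of
  \<open>A\<close> turns the condition into an equation of arrows.\<close>

lemma counit_condition_iff:
  assumes \<epsilon>: "bimap c c a (unit_bimod c) \<epsilon>"
  shows "counit_condition c m \<eta> a \<epsilon> \<phi> \<longleftrightarrow>
    (\<forall>M\<in>pos m. \<tau> M (bwd \<psi> M (bwd \<epsilon> (fwd \<psi> M) (ide c (anc m M)))) = ide \<Theta> M)"
proof -
  interpret \<epsilon>: bimap c c a "unit_bimod c" \<epsilon> by (rule \<epsilon>)
  note w = bimap_whisk_r [OF \<epsilon> m3.pq.pq.bicom_axioms] and lun = m3.pq.pq.bimap_lunit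
    and r = bimap_unit_runit
  note w\<phi> = bimap_lcomp [OF bimap_phi w(1)]
  show ?thesis
    unfolding counit_condition_def lens_eq_bimap_iff [OF bimap_lcomp [OF w\<phi> lun] r]
  proof (rule ball_cong [OF refl])
    fix M assume M: "M \<in> pos m"
    let ?z = "bwd \<psi> M (bwd \<epsilon> (fwd \<psi> M) (ide c (anc m M)))"
    let ?r = "component mm (whisk_l c m (unit_bimod c) \<eta> \<odot> bi_runit_inv m) (gen m M)"
    note e = m.gen_mem [OF M]
    note \<phi>e = bimap_component_mem [OF bimap_phi e]
    have i: "bwd \<epsilon> (fwd \<psi> M) (ide c (anc m M)) \<in> dir a (fwd \<psi> M)"
      using M fwd_psi [OF M] \<epsilon>.fwd_simps [of "fwd \<psi> M"]
        \<epsilon>.bwd_simps(1) [of "fwd \<psi> M" "ide c (anc m M)"] by simp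
    have l: "component mm (bi_lunit c mm \<odot> whisk_r c a (unit_bimod c) \<epsilon> mm \<odot> \<phi>) (gen m M) = ?z"
      unfolding component_bimap_lcomp [OF w\<phi> lun e] component_bimap_lcomp [OF bimap_phi w(1) e]
        m3.pq.pq.lunit_component(2) [OF bimap_component_mem [OF w(1) \<phi>e]] w(2) [OF \<phi>e] phi_gen [OF M]
      using M i fwd_psi [OF M] \<epsilon>.fwd_simps [of "fwd \<psi> M"] by simp
    note inj = m3.pq.app_comp_inj [OF bwd_psi [OF M i] bimap_component_mem [OF r e]]
    have "?z = ?r \<longleftrightarrow> A ?z = A ?r"
      by (rule iffI, simp only:, erule inj)
    also have "\<dots> \<longleftrightarrow> A ?z = (M, \<lambda>x\<in>dir m M. unit (dirs m M) x)"
      unfolding A_unit [OF e m.copresheaf_dirs [OF M]] by (simp cong: restrict_cong)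
    finally show "component mm (bi_lunit c mm \<odot> whisk_r c a (unit_bimod c) \<epsilon> mm \<odot> \<phi>) (gen m M) = ?r \<longleftrightarrow>
        \<tau> M ?z = ide \<Theta> M"
      unfolding l by (simp add: tau_eq_iff)
  qed
qed

abbreviation lhs where "lhs \<delta> \<equiv> bi_assoc c c a a mm \<odot> whisk_r c a (a \<triangleleft>\<^bsub>c\<^esub> a) \<delta> mm \<odot> \<phi>"

text \<open>Once all composites are unfolded, the associator vanishes and \<delta> acts on the value
  \<open>val M\<close> that \<phi> has at the identity.\<close>

lemma comult_left:
  assumes \<delta>: "bimap c c a (a \<triangleleft>\<^bsub>c\<^esub> a) \<delta>"
  shows "bimap c c m (a \<triangleleft>\<^bsub>c\<^esub> amm) (lhs \<delta>)"
    and "M \<in> pos m \<Longrightarrow> app_map a (app_comp c a mm) (app_comp c a amm (component (a \<triangleleft>\<^bsub>c\<^esub> amm) (lhs \<delta>) (gen m M))) =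
      app_comp c a a (component (a \<triangleleft>\<^bsub>c\<^esub> a) \<delta> (val M))"
proof -
  interpret aamm: bicom3 c c c c a a mm by unfold_locales
  note w = bimap_whisk_r [OF \<delta> m3.pq.pq.bicom_axioms] and as = aamm.bimap_assoc
  note w\<phi> = bimap_lcomp [OF bimap_phi w(1)]
  show "bimap c c m (a \<triangleleft>\<^bsub>c\<^esub> amm) (lhs \<delta>)" by (rule bimap_lcomp [OF w\<phi> as])
  assume M: "M \<in> pos m"
  note e = m.gen_mem [OF M]
  note \<phi>e = bimap_component_mem [OF bimap_phi e]
  show "app_map a (app_comp c a mm) (app_comp c a amm (component (a \<triangleleft>\<^bsub>c\<^esub> amm) (lhs \<delta>) (gen m M))) =
      app_comp c a a (component (a \<triangleleft>\<^bsub>c\<^esub> a) \<delta> (val M))"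
    unfolding component_bimap_lcomp [OF w\<phi> as e] component_bimap_lcomp [OF bimap_phi w(1) e]
      aamm.app_comp_assoc [OF bimap_component_mem [OF w(1) \<phi>e]] w(2) [OF \<phi>e] phi_gen [OF M] ..
qed

abbreviation rhs1 where "rhs1 \<equiv> whisk_r c m amm \<phi> m"
abbreviation rhs2 where "rhs2 \<equiv> bi_assoc c c a mm m"
abbreviation rhs3 where "rhs3 \<equiv> whisk_l c a (mm \<triangleleft>\<^bsub>c\<^esub> m) (bi_assoc c c m m m)"
abbreviation rhs4 where "rhs4 \<equiv> whisk_l c a (m \<triangleleft>\<^bsub>c\<^esub> mm) (whisk_l c m mm \<mu>)"
abbreviation rhs where
  "rhs \<equiv> whisk_l c a (a \<triangleleft>\<^bsub>c\<^esub> m \<triangleleft>\<^bsub>c\<^esub> mm) rhs4 \<odot> whisk_l c a (a \<triangleleft>\<^bsub>c\<^esub> mm \<triangleleft>\<^bsub>c\<^esub> m) rhs3 \<odot>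
    whisk_l c a (amm \<triangleleft>\<^bsub>c\<^esub> m) rhs2 \<odot> whisk_l c a mm rhs1 \<odot> \<phi>"
abbreviation "step1 \<equiv> component (amm \<triangleleft>\<^bsub>c\<^esub> m) rhs1"
abbreviation "step2 \<equiv> component (a \<triangleleft>\<^bsub>c\<^esub> mm \<triangleleft>\<^bsub>c\<^esub> m) rhs2"
abbreviation "step3 \<equiv> component (a \<triangleleft>\<^bsub>c\<^esub> m \<triangleleft>\<^bsub>c\<^esub> mm) rhs3"
abbreviation "step4 \<equiv> component amm rhs4"

text \<open>The Kleisli composites of the morphism \<open>k\<close> that \<open>bwd \<psi> M x\<close> stands for with those
  that \<open>\<psi>\<close> gives at its domain.\<close>

definition composites where
  "composites z = (let (M', k) = A z in
    (fwd \<psi> M', \<lambda>w\<in>dir a (fwd \<psi> M'). app_map m (ext k) (A (bwd \<psi> M' w))))"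

lemma app_map_restrict: "app_map p f (I, \<lambda>x\<in>dir p I. k x) = (I, \<lambda>x\<in>dir p I. f (k x))"
  by (simp cong: restrict_cong)

text \<open>The second use of \<phi> is inside \<open>a\<close>, on the element
  \<open>(M', k)\<close> into which \<open>A\<close> unfolds \<open>bwd \<psi> M x\<close>. There
  \<phi> applies \<open>k\<close> to the arrows that \<psi> gives at \<open>M'\<close>, and the
  final multiplication turns this into Kleisli extension along \<open>k\<close>.\<close>

lemma comult_right:
  shows "bimap c c m (a \<triangleleft>\<^bsub>c\<^esub> amm) rhs"
    and "M \<in> pos m \<Longrightarrow> app_map a (\<lambda>w. app_map a A (app_comp c a mm w))
        (app_comp c a amm (component (a \<triangleleft>\<^bsub>c\<^esub> amm) rhs (gen m M))) =
      (fwd \<psi> M, \<lambda>x\<in>dir a (fwd \<psi> M). composites (bwd \<psi> M x))"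
proof -
  interpret amm_m: bicom3 c c c c a mm m by unfold_locales
  note f1 = bimap_whisk_r [OF bimap_phi m.bicom_axioms] and f2 = amm_m.bimap_assoc
    and f3 = bimap_whisk_l [OF a.bicom_axioms m3.bimap_assoc]
    and f4 = bimap_whisk_l [OF a.bicom_axioms bimap_whisk_l(1) [OF m.bicom_axioms \<mu>.bimap_axioms]]
  note w1 = bimap_whisk_l [OF a.bicom_axioms f1(1)] and w2 = bimap_whisk_l [OF a.bicom_axioms f2]
    and w3 = bimap_whisk_l [OF a.bicom_axioms f3(1)] and w4 = bimap_whisk_l [OF a.bicom_axioms f4(1)]
  note c1 = bimap_lcomp [OF bimap_phi w1(1)]
  note c2 = bimap_lcomp [OF c1 w2(1)]
  note c3 = bimap_lcomp [OF c2 w3(1)]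
  show "bimap c c m (a \<triangleleft>\<^bsub>c\<^esub> amm) rhs"
    by (rule bimap_lcomp [OF c3 w4(1)])
  assume M: "M \<in> pos m"
  note e = m.gen_mem [OF M]
  note e0 = bimap_component_mem [OF bimap_phi e]
  note e1 = bimap_component_mem [OF w1(1) e0]
  note e2 = bimap_component_mem [OF w2(1) e1]
  note e3 = bimap_component_mem [OF w3(1) e2]
  \<comment> \<open>All four whiskered maps act inside the outer \<open>a\<close>, so what remains
    is their effect on a single direction.\<close>
  have outer: "app_comp c a amm (component (a \<triangleleft>\<^bsub>c\<^esub> amm) rhs (gen m M)) =
      app_map a (\<lambda>z. step4 (step3 (step2 (step1 z)))) (val M)"
    unfolding component_bimap_lcomp [OF c3 w4(1) e] component_bimap_lcomp [OF c2 w3(1) e]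
      component_bimap_lcomp [OF c1 w2(1) e] component_bimap_lcomp [OF bimap_phi w1(1) e]
      w4(2) [OF e3] w3(2) [OF e2] w2(2) [OF e1] w1(2) [OF e0] phi_gen [OF M] app_map_comp ..
  have inner: "app_map a A (app_comp c a mm (step4 (step3 (step2 (step1 z))))) = composites z"
    if z: "z \<in> els (app c mm (dirs m M))" for z
  proof -
    obtain M' k where Az: "A z = (M', k)" by fastforce
    have k: "(M', k) \<in> els (T (T (dirs m M)))" using A_mem [OF z] Az by simp
    note z1 = bimap_component_mem [OF f1(1) z]
    note z2 = bimap_component_mem [OF f2 z1]
    note z3 = bimap_component_mem [OF f3(1) z2]
    have "app_map a A (app_comp c a mm (step4 (step3 (step2 (step1 z))))) =
        app_map a (\<lambda>v. A (component mm (whisk_l c m mm \<mu>) (component (m \<triangleleft>\<^bsub>c\<^esub> mm) (bi_assoc c c m m m) v)))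
          (app_comp c a (mm \<triangleleft>\<^bsub>c\<^esub> m) (step2 (step1 z)))"
      unfolding f4(2) [OF z3] f3(2) [OF z2] app_map_comp ..
    also have "\<dots> = app_map a (\<lambda>v. app_map m mult (A (app_comp c mm m v)))
        (app_comp c a (mm \<triangleleft>\<^bsub>c\<^esub> m) (step2 (step1 z)))"
      by (rule app_map_cong [OF naturalD(1) [OF amm_m.p_qr.natural_app_comp z2] A_mult_assoc])
    also have "\<dots> = app_map a (\<lambda>v. app_map m mult (A v))
        (app_map a (app_comp c mm m) (app_comp c a (mm \<triangleleft>\<^bsub>c\<^esub> m) (step2 (step1 z))))"
      by (simp only: app_map_comp)
    also have "app_map a (app_comp c mm m) (app_comp c a (mm \<triangleleft>\<^bsub>c\<^esub> m) (step2 (step1 z))) =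
        (fwd \<psi> M', \<lambda>w\<in>dir a (fwd \<psi> M'). app_map mm k (bwd \<psi> M' w))"
      unfolding amm_m.app_comp_assoc [OF z1] f1(2) [OF z] Az phi_eval [OF k] ..
    finally show ?thesis
      using k m3.pq.app_comp_app_map [OF bwd_psi, of M' _ k]
      by (simp add: app_map_restrict app_map_comp ext_def [abs_def] composites_def Az del: app_map_Pair
          cong: restrict_cong)
  qed
  show "app_map a (\<lambda>w. app_map a A (app_comp c a mm w)) (app_comp c a amm (component (a \<triangleleft>\<^bsub>c\<^esub> amm) rhs (gen m M))) =
      (fwd \<psi> M, \<lambda>x\<in>dir a (fwd \<psi> M). composites (bwd \<psi> M x))"
    unfolding outer app_map_comp app_map_restrict
    by (simp add: inner bwd_psi [OF M] del: app_map_Pair component_Pair cong: restrict_cong)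
qed

text \<open>With every composite unfolded, both sides lie in \<open>a(a(m(m(m[M]))))\<close>.
  Comparing the outer position, the position over each \<open>x\<close>, and the elements over
  \<open>x\<close> and \<open>w\<close> gives the three clauses: the object is kept, codomains
  agree, and composites go to Kleisli composites.\<close>

lemma comult_condition_iff:
  assumes \<delta>: "bimap c c a (a \<triangleleft>\<^bsub>c\<^esub> a) \<delta>"
  shows "comult_condition c m \<mu> a \<delta> \<phi> \<longleftrightarrow> (\<forall>M\<in>pos m.
    fst (fwd \<delta> (fwd \<psi> M)) = fwd \<psi> M \<and> (\<forall>x\<in>dir a (fwd \<psi> M).
      snd (fwd \<delta> (fwd \<psi> M)) x = fwd \<psi> (nxt M x) \<and>
      (\<forall>w\<in>dir a (fwd \<psi> (nxt M x)).
        \<tau> M (bwd \<psi> M (bwd \<delta> (fwd \<psi> M) (cls c a a (fwd \<delta> (fwd \<psi> M)) (x, w)))) =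
        cmp \<Theta> (\<tau> M (bwd \<psi> M x)) (\<tau> (nxt M x) (bwd \<psi> (nxt M x) w)))))"
  (is "_ \<longleftrightarrow> (\<forall>M\<in>pos m. ?P M)")
proof -
  interpret \<delta>: bimap c c a "a \<triangleleft>\<^bsub>c\<^esub> a" \<delta> by fact
  interpret aa: bicom2 c c c a a by unfold_locales
  interpret aamm: bicom2 c c c a amm by unfold_locales
  let ?amm = "a \<triangleleft>\<^bsub>c\<^esub> amm"
  let ?G = "\<lambda>z. app_map a (\<lambda>w. app_map a A (app_comp c a mm w)) (app_comp c a amm z)"
  have "component ?amm (lhs \<delta>) (gen m M) = component ?amm rhs (gen m M) \<longleftrightarrow> ?P M" if M: "M \<in> pos m" for M
  proof -
    note e = m.gen_mem [OF M]
    note le = bimap_component_mem [OF comult_left(1) [OF \<delta>] e]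
    note re = bimap_component_mem [OF comult_right(1) e]
    \<comment> \<open>\<open>?G\<close> is injective one layer at a time: \<open>app_comp\<close> at
      each level, and \<open>app_map a\<close> of an injective function in between.\<close>
    have inj: "z = z'" if "z \<in> els (app c ?amm (dirs m M))" "z' \<in> els (app c ?amm (dirs m M))" "?G z = ?G z'" for z z'
    proof (rule aamm.app_comp_inj [OF that(1,2)], rule app_map_inj [OF _ _ _ that(3)])
      show "app_comp c a amm z \<in> els (app c a (app c amm (dirs m M)))"
        "app_comp c a amm z' \<in> els (app c a (app c amm (dirs m M)))"
        by (rule naturalD(1) [OF aamm.natural_app_comp that(1)], rule naturalD(1) [OF aamm.natural_app_comp that(2)])
      fix v v' assume v: "v \<in> els (app c amm (dirs m M))" "v' \<in> els (app c amm (dirs m M))"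
        and eq: "app_map a A (app_comp c a mm v) = app_map a A (app_comp c a mm v')"
      show "v = v'"
        by (rule adj.rq.app_comp_inj [OF v], rule app_map_inj [OF _ _ _ eq])
          (use v naturalD(1) [OF adj.rq.natural_app_comp] m3.pq.app_comp_inj in blast)+
    qed
    obtain B f where Bf: "fwd \<delta> (fwd \<psi> M) = (B, f)" by (cases "fwd \<delta> (fwd \<psi> M)")
    have B: "B \<in> pos a" "f \<in> Hom c (dirs a B) (poss a)"
      using \<delta>.fwd_simps(1) [OF fwd_psi(1) [OF M]] by (simp_all add: Bf)
    let ?d = "\<lambda>x w. bwd \<delta> (fwd \<psi> M) (cls c a a (B, f) (x, w))"
    have "?d x w \<in> dir a (fwd \<psi> M)" if "x \<in> dir a B" "w \<in> dir a (f x)" for x w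
      using that B Bf fwd_psi(1) [OF M] by (intro \<delta>.bwd_simps(1)) simp_all
    then have "app_map a (app_map a A) (app_comp c a a (component (a \<triangleleft>\<^bsub>c\<^esub> a) \<delta> (val M))) =
        (B, \<lambda>x\<in>dir a B. (f x, \<lambda>w\<in>dir a (f x). A (bwd \<psi> M (?d x w))))"
      by (simp add: Bf aa.app_comp_Pair cong: restrict_cong)
    then have left: "?G (component ?amm (lhs \<delta>) (gen m M)) =
        (B, \<lambda>x\<in>dir a B. (f x, \<lambda>w\<in>dir a (f x). A (bwd \<psi> M (?d x w))))"
      unfolding comult_left(2) [OF \<delta> M, symmetric] by (simp only: app_map_comp)
    \<comment> \<open>For fixed \<open>x\<close>, equality of the first coordinates is the clause on
      codomains; it also makes the two ranges of \<open>w\<close> equal, so that the second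
      coordinates can be compared pointwise.\<close>
    have pt: "(f x, \<lambda>w\<in>dir a (f x). A (bwd \<psi> M (?d x w))) = composites (bwd \<psi> M x) \<longleftrightarrow>
        f x = fwd \<psi> (nxt M x) \<and> (\<forall>w\<in>dir a (fwd \<psi> (nxt M x)). \<tau> M (bwd \<psi> M (?d x w)) =
          cmp \<Theta> (\<tau> M (bwd \<psi> M x)) (\<tau> (nxt M x) (bwd \<psi> (nxt M x) w)))" for x
    proof -
      obtain M' k where Mk: "A (bwd \<psi> M x) = (M', k)" by fastforce
      have eq: "A (bwd \<psi> M (?d x w)) = app_map m (ext k) (A (bwd \<psi> M' w)) \<longleftrightarrow>
          \<tau> M (bwd \<psi> M (?d x w)) = cmp \<Theta> (M', M, k) (\<tau> M' (bwd \<psi> M' w))" for w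
      proof -
        obtain N l where Nl: "A (bwd \<psi> M' w) = (N, l)" by fastforce
        show ?thesis by (simp add: Nl tau_eq prod_eq_iff [of "A (bwd \<psi> M (?d x w))"])
      qed
      have \<tau>: "\<tau> M (bwd \<psi> M x) = (M', M, k)" by (simp add: tau_eq Mk)
      show ?thesis
        unfolding composites_def Mk Let_def prod.case \<tau> fst_conv prod.inject
        by (cases "f x = fwd \<psi> M'") (simp_all only: restrict_eq_iff eq simp_thms)
    qed
    have "component ?amm (lhs \<delta>) (gen m M) = component ?amm rhs (gen m M) \<longleftrightarrow>
        ?G (component ?amm (lhs \<delta>) (gen m M)) = ?G (component ?amm rhs (gen m M))"
      by (rule iffI, simp only:, erule inj [OF le re])
    also have "\<dots> \<longleftrightarrow> ?P M"
    proof (cases "B = fwd \<psi> M")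
      case True
      show ?thesis
        unfolding left comult_right(2) [OF M] Bf prod.inject fst_conv snd_conv
        by (simp only: True restrict_eq_iff pt [unfolded True] simp_thms)
    qed (simp only: left comult_right(2) [OF M] Bf prod.inject fst_conv simp_thms)
    finally show ?thesis .
  qed
  then show ?thesis
    unfolding comult_condition_def lens_eq_bimap_iff [OF comult_left(1) [OF \<delta>] comult_right(1)]
    by (rule ball_cong [OF refl])
qed

end

text \<open>Every arrow \<open>g\<close> is the action of \<open>g\<close> on an identity, and maps
  of bicomodules respect this action.\<close>

lemma lens_eq_unit_bimod:
  assumes \<epsilon>: "bimap c c p (unit_bimod c) \<epsilon>" and \<epsilon>': "bimap c c p (unit_bimod c) \<epsilon>'"
    and eq: "\<And>I. I \<in> pos p \<Longrightarrow> bwd \<epsilon> I (ide c (anc p I)) = bwd \<epsilon>' I (ide c (anc p I))"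
  shows "lens_eq p (unit_bimod c) \<epsilon> \<epsilon>'"
proof -
  interpret \<epsilon>: bimap c c p "unit_bimod c" \<epsilon> by fact
  interpret \<epsilon>': bimap c c p "unit_bimod c" \<epsilon>' by fact
  show ?thesis
    unfolding lens_eq_def
  proof (intro ballI conjI)
    fix I assume I: "I \<in> pos p"
    have fwd: "fwd \<epsilon> I = anc p I" "fwd \<epsilon>' I = anc p I"
      using \<epsilon>.fwd_simps(2) [OF I] \<epsilon>'.fwd_simps(2) [OF I] by simp_all
    then show "fwd \<epsilon> I = fwd \<epsilon>' I" by simp
    fix g assume g: "g \<in> dir (unit_bimod c) (fwd \<epsilon> I)"
    have i: "ide c (anc p I) \<in> out c (anc p I)" "tgt c (ide c (anc p I)) = anc p I"
        "cmp c g (ide c (anc p I)) = g"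
      using I g fwd category_out [OF \<epsilon>.p.category_left] by simp_all
    have "bwd \<epsilon> I g = dact p I g (bwd \<epsilon> I (ide c (anc p I)))"
      "bwd \<epsilon>' I g = dact p I g (bwd \<epsilon>' I (ide c (anc p I)))"
      using \<epsilon>.bwd_simps(3) [of I "ide c (anc p I)" g] \<epsilon>'.bwd_simps(3) [of I "ide c (anc p I)" g]
        I fwd i g by simp_all
    then show "bwd \<epsilon> I g = bwd \<epsilon>' I g" by (simp add: eq [OF I])
  qed
qed

section \<open>Comonoids from categories\<close>

text \<open>The axioms of \<open>cat_of_comonoid e\<close>, read at tagged arrows, are the comonoid
  laws once the comultiplication keeps positions, which is the assumption
  \<open>fst\<close>.\<close>

lemma comonoidI:
  assumes counit: "is_lens e ypoly (counit e)" and comult: "is_lens e (pcomp e e) (comult e)"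
    and fst: "\<And>C. C \<in> pos e \<Longrightarrow> fst (fwd (comult e) C) = C"
    and cat: "category (cat_of_comonoid e)"
  shows "comonoid e"
proof -
  let ?c = "cat_of_comonoid e"
  define t where "t C = snd (fwd (comult e) C)" for C
  let ?i = "\<lambda>C. bwd (counit e) C ()"
    and ?m = "\<lambda>C. bwd (comult e) C"
  have fwd: "fwd (comult e) C = (C, t C)" if "C \<in> pos e" for C
    using fst [OF that] by (simp add: prod_eq_iff t_def)
  have t_pos: "t C f \<in> pos e" if "C \<in> pos e" "f \<in> dir e C" for C f
  proof -
    have "\<forall>F\<in>Ar ?c. tgt ?c F \<in> Ob ?c"
      using cat unfolding category_def by blast
    from this [rule_format, of "(C, f)"] show ?thesis
      using that by (simp add: cat_of_comonoid_def t_def)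
  qed
  \<comment> \<open>Positions of \<open>pcomp e e\<close> contain functions; coassociativity on
    positions is an equation between such functions, so extensionality enters.\<close>
  have tgt_ext: "t C \<in> extensional (dir e C)" if "C \<in> pos e" for C
  proof -
    have "fwd (comult e) C \<in> pos (pcomp e e)"
      using comult that by (auto simp: is_lens_def)
    then show ?thesis by (simp add: fwd [OF that] pcomp_def PiE_def)
  qed
  have i: "?i C \<in> dir e C" "t C (?i C) = C" if "C \<in> pos e" for C
  proof -
    have "\<forall>C\<in>Ob ?c. ide ?c C \<in> Ar ?c \<and> tgt ?c (ide ?c C) = C"
      using cat unfolding category_def by blast
    from this [rule_format, of C] show "?i C \<in> dir e C" "t C (?i C) = C"
      using that by (simp_all add: cat_of_comonoid_def t_def)
  qed
  have m: "?m C (f, g) \<in> dir e C" "t C (?m C (f, g)) = t (t C f) g"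
    if "C \<in> pos e" "f \<in> dir e C" "g \<in> dir e (t C f)" for C f g
  proof -
    have "\<forall>F\<in>Ar ?c. \<forall>G\<in>Ar ?c. src ?c G = tgt ?c F \<longrightarrow>
        cmp ?c G F \<in> Ar ?c \<and> src ?c (cmp ?c G F) = src ?c F \<and> tgt ?c (cmp ?c G F) = tgt ?c G"
      using cat unfolding category_def by blast
    from this [rule_format, of "(C, f)" "(t C f, g)"]
    show "?m C (f, g) \<in> dir e C" "t C (?m C (f, g)) = t (t C f) g"
      using that t_pos by (simp_all add: cat_of_comonoid_def t_def)
  qed
  have unit: "?m C (f, ?i (t C f)) = f" "?m C (?i C, f) = f" if "C \<in> pos e" "f \<in> dir e C" for C f
  proof -
    have "\<forall>F\<in>Ar ?c. cmp ?c F (ide ?c (src ?c F)) = F \<and> cmp ?c (ide ?c (tgt ?c F)) F = F"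
      using cat unfolding category_def by blast
    from this [rule_format, of "(C, f)"]
    show "?m C (f, ?i (t C f)) = f" "?m C (?i C, f) = f"
      using that by (simp_all add: cat_of_comonoid_def t_def)
  qed
  have assoc: "?m C (?m C (f, g), h) = ?m C (f, ?m (t C f) (g, h))"
    if "C \<in> pos e" "f \<in> dir e C" "g \<in> dir e (t C f)" "h \<in> dir e (t (t C f) g)" for C f g h
  proof -
    have "\<forall>F\<in>Ar ?c. \<forall>G\<in>Ar ?c. \<forall>H\<in>Ar ?c. src ?c G = tgt ?c F \<and> src ?c H = tgt ?c G \<longrightarrow>
        cmp ?c H (cmp ?c G F) = cmp ?c (cmp ?c H G) F"
      using cat unfolding category_def by blast
    from this [rule_format, of "(C, f)" "(t C f, g)" "(t (t C f) g, h)"]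
    show ?thesis
      using that t_pos by (simp add: cat_of_comonoid_def t_def)
  qed
  have "lens_eq e e (pcomp_lunit \<odot> pcomp_map ypoly (counit e) idl \<odot> comult e) idl"
    by (auto simp: lens_eq_def lcomp_def pcomp_lunit_def pcomp_map_def idl_def ypoly_def fwd i unit)
  moreover have "lens_eq e e (pcomp_runit \<odot> pcomp_map e idl (counit e) \<odot> comult e) idl"
    by (auto simp: lens_eq_def lcomp_def pcomp_runit_def pcomp_map_def idl_def fwd unit)
  moreover have "lens_eq e (pcomp e (pcomp e e))
       (pcomp_assoc e e \<odot> pcomp_map (pcomp e e) (comult e) idl \<odot> comult e)
       (pcomp_map e idl (comult e) \<odot> comult e)"
    unfolding lens_eq_def
  proof (intro ballI conjI)
    fix C assume C: "C \<in> pos e"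
    have "(\<lambda>y\<in>dir e (t C f). t (t C f) y) = t (t C f)" if "f \<in> dir e C" for f
      using tgt_ext [OF t_pos [OF C that]] by (simp add: extensional_restrict)
    then have "(\<lambda>y\<in>dir e (t C f). t C (?m C (f, y))) = t (t C f)" if "f \<in> dir e C" for f
      using that C m by (simp cong: restrict_cong)
    then show f: "fwd (pcomp_assoc e e \<odot> pcomp_map (pcomp e e) (comult e) idl \<odot> comult e) C =
        fwd (pcomp_map e idl (comult e) \<odot> comult e) C"
      using C t_pos by (simp add: lcomp_def pcomp_assoc_def pcomp_map_def idl_def fwd pcomp_def cong: restrict_cong)
    fix K assume "K \<in> dir (pcomp e (pcomp e e))
      (fwd (pcomp_assoc e e \<odot> pcomp_map (pcomp e e) (comult e) idl \<odot> comult e) C)"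
    then obtain f g h where K: "K = (f, g, h)" and fg: "f \<in> dir e C" "g \<in> dir e (t C f)"
      "h \<in> dir e (t (t C f) g)"
      unfolding f using C t_pos by (auto simp: lcomp_def pcomp_map_def idl_def fwd pcomp_def)
    show "bwd (pcomp_assoc e e \<odot> pcomp_map (pcomp e e) (comult e) idl \<odot> comult e) C K =
        bwd (pcomp_map e idl (comult e) \<odot> comult e) C K"
      using C fg assoc [OF C fg]
      by (simp add: K lcomp_def pcomp_assoc_def pcomp_map_def idl_def fwd)
  qed
  ultimately show ?thesis
    using counit comult by (simp add: comonoid_def)
qed

text \<open>Injective maps reflect equations. This also yields the sources and targets of identities
  and composites, which are compared through their images under \<open>Ko\<close>.\<close>

lemma category_transport:
  assumes d: "category d"
    and inj: "inj_on Ko (Ob c)" "inj_on Ka (Ar c)"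
    and ob: "\<And>f. f \<in> Ar c \<Longrightarrow> src c f \<in> Ob c" "\<And>f. f \<in> Ar c \<Longrightarrow> tgt c f \<in> Ob c"
      "\<And>C. C \<in> Ob c \<Longrightarrow> ide c C \<in> Ar c" "\<And>C. C \<in> Ob c \<Longrightarrow> Ko C \<in> Ob d"
    and ar: "\<And>f. f \<in> Ar c \<Longrightarrow> Ka f \<in> Ar d"
      "\<And>f g. f \<in> Ar c \<Longrightarrow> g \<in> Ar c \<Longrightarrow> src c g = tgt c f \<Longrightarrow> cmp c g f \<in> Ar c"
    and pres: "\<And>f. f \<in> Ar c \<Longrightarrow> src d (Ka f) = Ko (src c f)"
      "\<And>f. f \<in> Ar c \<Longrightarrow> tgt d (Ka f) = Ko (tgt c f)"
      "\<And>C. C \<in> Ob c \<Longrightarrow> Ka (ide c C) = ide d (Ko C)"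
      "\<And>f g. f \<in> Ar c \<Longrightarrow> g \<in> Ar c \<Longrightarrow> src c g = tgt c f \<Longrightarrow> Ka (cmp c g f) = cmp d (Ka g) (Ka f)"
  shows "category c"
proof -
  have dide: "\<And>C. C \<in> Ob d \<Longrightarrow> src d (ide d C) = C \<and> tgt d (ide d C) = C"
    and dcmp: "\<And>f g. f \<in> Ar d \<Longrightarrow> g \<in> Ar d \<Longrightarrow> src d g = tgt d f \<Longrightarrow>
      src d (cmp d g f) = src d f \<and> tgt d (cmp d g f) = tgt d g"
    and dunit: "\<And>f. f \<in> Ar d \<Longrightarrow> cmp d f (ide d (src d f)) = f \<and> cmp d (ide d (tgt d f)) f = f"
    and dassoc: "\<And>f g h. f \<in> Ar d \<Longrightarrow> g \<in> Ar d \<Longrightarrow> h \<in> Ar d \<Longrightarrow> src d g = tgt d f \<Longrightarrow> src d h = tgt d g \<Longrightarrow>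
      cmp d h (cmp d g f) = cmp d (cmp d h g) f"
    using d unfolding category_def by blast+
  have st: "src c (ide c C) = C" "tgt c (ide c C) = C" if "C \<in> Ob c" for C
    using that ob pres(1,2) [OF ob(3) [OF that]] dide [OF ob(4) [OF that]]
    by (auto simp: pres(3) intro!: inj_onD [OF inj(1)])
  have st2: "src c (cmp c g f) = src c f" "tgt c (cmp c g f) = tgt c g"
    if "f \<in> Ar c" "g \<in> Ar c" "src c g = tgt c f" for f g
    using that ob ar pres(1,2) [OF ar(2) [OF that]] dcmp [of "Ka f" "Ka g"]
    by (auto simp: pres intro!: inj_onD [OF inj(1)])
  show ?thesis
    unfolding category_def
  proof (intro conjI ballI impI)
    fix f assume f: "f \<in> Ar c"
    show "cmp c f (ide c (src c f)) = f" "cmp c (ide c (tgt c f)) f = f"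
      using f ob ar st dunit [of "Ka f"] by (auto simp: pres intro!: inj_onD [OF inj(2)])
    fix g h assume g: "g \<in> Ar c" and h: "h \<in> Ar c" and eq: "src c g = tgt c f \<and> src c h = tgt c g"
    show "cmp c h (cmp c g f) = cmp c (cmp c h g) f"
      using f g h eq ar st2 dassoc [of "Ka f" "Ka g" "Ka h"]
      by (intro inj_onD [OF inj(2)]) (simp_all add: pres)
  qed (use ob ar st st2 in auto)
qed

section \<open>The comonad \<open>L\<close> and the theory category\<close>

context fam_monad
begin

abbreviation \<Theta>op where "\<Theta>op \<equiv> op_cat \<Theta>"

lemma category_Thetaop: "category \<Theta>op"
  by (rule category_op [OF category_Theta])

lemma mem_out_Thetaop [simp]:
  "(M', N, k) \<in> out \<Theta>op M \<longleftrightarrow> N = M \<and> M' \<in> pos m \<and> M \<in> pos m \<and> k \<in> Hom c (dirs m M') (T (dirs m M))"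
  by (auto simp: out_def)

text \<open>The image in the Kleisli category of the map \<open>pull m g M\<close> from
  \<open>m[push m g M]\<close> to \<open>m[M]\<close>, that is, the unit after it; in the opposite
  of \<Theta> it starts at \<open>M\<close>.\<close>

definition lift where
  "lift M g = (push m g M, M, \<lambda>x\<in>dir m (push m g M). unit (dirs m M) (pull m g M x))"

definition proj where
  "proj = restrict_lens (cat_poly \<Theta>op) (cat_poly c) \<lparr>fwd = anc m, bwd = lift\<rparr>"

lemma fwd_proj [simp]: "M \<in> pos m \<Longrightarrow> fwd proj M = anc m M"
  and bwd_proj [simp]: "M \<in> pos m \<Longrightarrow> g \<in> out c (anc m M) \<Longrightarrow> bwd proj M g = lift M g"
  by (simp_all add: proj_def restrict_lens_def)

lemma lift_out: "M \<in> pos m \<Longrightarrow> g \<in> out c (anc m M) \<Longrightarrow> lift M g \<in> out \<Theta>op M"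
  unfolding lift_def
  by (simp add: dirs_restrict_Hom m.copresheaf_dirs
      natural_comp [OF m.natural_pull natural_unit [OF m.copresheaf_dirs]])

text \<open>By naturality of the unit, the arrow is the unit followed by \<open>app_map m\<close> of
  the pull map, and the extension of the unit is the identity.\<close>

lemma ext_lift:
  assumes "M \<in> pos m" "g \<in> out c (anc m M)" "z \<in> els (T (dirs m (push m g M)))"
  shows "ext (\<lambda>x\<in>dir m (push m g M). unit (dirs m M) (pull m g M x)) z = app_map m (pull m g M) z"
proof -
  have M': "push m g M \<in> pos m" using assms by simp
  note cop = m.copresheaf_dirs [OF M']
  have "ext (\<lambda>x\<in>dir m (push m g M). unit (dirs m M) (pull m g M x)) z =
      ext (\<lambda>x. app_map m (pull m g M) (unit (dirs m (push m g M)) x)) z"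
    by (rule ext_cong [OF assms(3)]) (simp add: app_map_unit [OF cop m.natural_pull [OF assms(1,2)]])
  also have "\<dots> = app_map m (pull m g M) (ext (unit (dirs m (push m g M))) z)"
    by (rule app_map_ext [OF natural_unit [OF cop] m.natural_pull [OF assms(1,2)] assms(3), symmetric])
  finally show ?thesis by (simp only: ext_of_unit [OF cop assms(3)])
qed

lemma cofunctor_proj: "cofunctor \<Theta>op c proj"
  unfolding cofunctor_def
proof (intro conjI ballI)
  show "is_lens (cat_poly \<Theta>op) (cat_poly c) proj"
    unfolding proj_def by (rule is_lens_restrict_lens) (simp_all add: lift_out)
next
  fix M assume "M \<in> Ob \<Theta>op"
  then have M: "M \<in> pos m" by simp
  show "bwd proj M (ide c (fwd proj M)) = ide \<Theta>op M"
    using M by (simp add: lift_def cong: restrict_cong)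
  fix g assume "g \<in> out c (fwd proj M)"
  then have g: "g \<in> out c (anc m M)" using M by simp
  show "fwd proj (tgt \<Theta>op (bwd proj M g)) = tgt c g"
    using M g by (simp add: lift_def)
  fix h assume h: "h \<in> out c (tgt c g)"
  have hg: "cmp c h g \<in> out c (anc m M)" using g h category_out(4) [OF category] by blast
  have "ext (\<lambda>x\<in>dir m (push m g M). unit (dirs m M) (pull m g M x)) (unit (dirs m (push m g M)) (pull m h (push m g M) x)) =
      unit (dirs m M) (pull m g M (pull m h (push m g M) x))"
    if "x \<in> dir m (push m h (push m g M))" for x
  proof -
    have M': "push m g M \<in> pos m" and x: "pull m h (push m g M) x \<in> dir m (push m g M)"
      using M g h that by simp_all
    note cop = m.copresheaf_dirs [OF M']
    have "unit (dirs m (push m g M)) (pull m h (push m g M) x) \<in> els (T (dirs m (push m g M)))"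
      using naturalD(1) [OF natural_unit [OF cop], of "pull m h (push m g M) x"] x by simp
    from ext_lift [OF M g this] show ?thesis
      using app_map_unit [OF cop m.natural_pull [OF M g], of "pull m h (push m g M) x"] x by simp
  qed
  then show "bwd proj M (cmp c h g) = cmp \<Theta>op (bwd proj (tgt \<Theta>op (bwd proj M g)) h) (bwd proj M g)"
    using M g h hg by (simp add: lift_def cong: restrict_cong)
qed

lemma cofun_proj: "cofun \<Theta>op c proj"
  by (intro cofun.intro category_Thetaop category cofunctor_proj)

section \<open>The isomorphism between \<open>L\<close> and the comonad of the opposite theory
  category\<close>

abbreviation B where "B \<equiv> cof_bimod \<Theta>op proj"

text \<open>The inverse of \<open>\<tau> M\<close>: it folds the domain and the Kleisli morphism of
  an arrow back into a direction of \<open>L\<close> at \<open>M\<close>.\<close>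

definition \<sigma> :: "'i \<Rightarrow> 'i \<times> 'i \<times> ('d \<Rightarrow> 'i \<times> ('d \<Rightarrow> 'd)) \<Rightarrow> ('i \<times> ('d \<Rightarrow> 'i)) \<times> (('d \<times> 'd) set \<Rightarrow> 'd)"
  where "\<sigma> M f = app_comp_inv c m m (fst f, snd (snd f))"

lemma tau_out: "M \<in> pos m \<Longrightarrow> z \<in> els (app c mm (dirs m M)) \<Longrightarrow> \<tau> M z \<in> out \<Theta>op M"
  using A_mem [of z "dirs m M"] by (cases "A z") (simp add: tau_eq)

lemma sigma_mem:
  assumes "f \<in> out \<Theta>op M"
  shows "\<sigma> M f \<in> els (app c mm (dirs m M))" "\<tau> M (\<sigma> M f) = f"
proof -
  obtain M' k where f: "f = (M', M, k)" "M' \<in> pos m" "k \<in> Hom c (dirs m M') (T (dirs m M))"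
    using assms by (cases f) auto
  then have k: "(M', k) \<in> els (T (T (dirs m M)))" by simp
  show "\<sigma> M f \<in> els (app c mm (dirs m M))" "\<tau> M (\<sigma> M f) = f"
    using m3.pq.app_comp_inv_mem [OF k] by (simp_all add: \<sigma>_def f tau_eq)
qed

lemma sigma_tau: "z \<in> els (app c mm (dirs m M)) \<Longrightarrow> \<sigma> M (\<tau> M z) = z"
  by (simp add: \<sigma>_def tau_eq m3.pq.app_comp_inv_app_comp)

lemma tau_inj:
  "z \<in> els (app c mm (dirs m M)) \<Longrightarrow> z' \<in> els (app c mm (dirs m M)) \<Longrightarrow> \<tau> M z = \<tau> M z' \<Longrightarrow> z = z'"
  by (metis sigma_tau)

text \<open>With \<open>of_L\<close> below, an isomorphism between \<open>B\<close> and
  \<open>L\<close>. Lenses run backwards on directions, so the map into \<open>L\<close> carries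
  \<tau> and the map out of it \<sigma>.\<close>

definition to_L where "to_L = \<lparr>fwd = (\<lambda>M. M), bwd = \<tau>\<rparr>"
definition of_L where "of_L = \<lparr>fwd = (\<lambda>M. M), bwd = \<sigma>\<rparr>"

text \<open>The action precomposes \<open>k\<close> with \<open>pull m g M'\<close>; so does Kleisli
  composition with a lift, since \<open>ext k\<close> of a unit is \<open>k\<close>.\<close>

lemma tau_dact:
  assumes M: "M \<in> pos m" and z: "z \<in> els (app c mm (dirs m M))"
    and g: "g \<in> out c (anch (app c mm (dirs m M)) z)"
  shows "\<tau> M (act (app c mm (dirs m M)) g z) = cmp \<Theta>op (bwd proj (tgt \<Theta>op (\<tau> M z)) g) (\<tau> M z)"
proof -
  obtain M' k where Mk: "A z = (M', k)" by fastforce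
  then have M': "M' \<in> pos m" and k: "k \<in> Hom c (dirs m M') (T (dirs m M))"
    using A_mem [OF z] by simp_all
  note nat = naturalD [OF m3.pq.natural_app_comp z]
  have g': "g \<in> out c (anc m M')" using nat(2) g by (simp add: Mk)
  have A: "A (act (app c mm (dirs m M)) g z) = (push m g M', \<lambda>x\<in>dir m (push m g M'). k (pull m g M' x))"
    using nat(3) [OF g] by (simp add: Mk act_app)
  have "ext k (unit (dirs m M') (pull m g M' x)) = k (pull m g M' x)" if "x \<in> dir m (push m g M')" for x
    using M' g' that by (intro ext_unit [OF m.copresheaf_dirs Hom_natural [OF k]]) simp_all
  then show ?thesis
    using M M' g' by (simp add: tau_eq A Mk lift_def cong: restrict_cong)
qed

text \<open>The pull map acts at the innermost level, on the values of \<open>k\<close>; by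
  \<open>ext_lift\<close> this is Kleisli composition with the lift of \<open>g\<close> on the
  codomain side.\<close>

lemma tau_pull:
  assumes M: "M \<in> pos m" and g: "g \<in> out c (anc m M)"
    and z: "z \<in> els (app c mm (dirs m (push m g M)))"
  shows "\<tau> M (app_map mm (pull m g M) z) = cmp \<Theta>op (\<tau> (push m g M) z) (bwd proj M g)"
proof -
  obtain M' k where Mk: "A z = (M', k)" by fastforce
  then have M': "M' \<in> pos m" and k: "k \<in> Hom c (dirs m M') (T (dirs m (push m g M)))"
    using A_mem [OF z] by simp_all
  have A: "A (app_map mm (pull m g M) z) = (M', \<lambda>x\<in>dir m M'. app_map m (pull m g M) (k x))"
    using m3.pq.app_comp_app_map [OF z, of "pull m g M"] by (simp add: Mk)
  show ?thesis
    using M M' g ext_lift [OF M g Hom_dirsD(1) [OF k]]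
    by (simp add: tau_eq A Mk lift_def cong: restrict_cong)
qed

lemma bimap_to_L: "bimap c c B lan.L to_L"
proof (intro bimapI cofun.bicom_cof cofun_proj lan.L.bicom_axioms bimod_mapI)
  interpret pr: cofun \<Theta>op c proj by (rule cofun_proj)
  fix M assume "M \<in> pos B"
  then have M: "M \<in> pos m" by simp
  show "fwd to_L M \<in> pos lan.L" "anc lan.L (fwd to_L M) = anc B M"
    using M by (simp_all add: to_L_def)
  {
    fix z assume "z \<in> dir lan.L (fwd to_L M)"
    then have z: "z \<in> els (app c mm (dirs m M))" by (simp add: to_L_def)
    show "bwd to_L M z \<in> dir B M" using tau_out [OF M z] by (simp add: to_L_def)
    have "fst (A z) \<in> pos m" using A_mem [OF z] by (cases "A z") simp
    moreover have "anch (app c mm (dirs m M)) z = anc m (fst (A z))"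
      using naturalD(2) [OF m3.pq.natural_app_comp z] by (cases "A z") simp
    ultimately show "danc B M (bwd to_L M z) = danc lan.L (fwd to_L M) z"
      by (simp add: to_L_def tau_eq)
    fix g assume "g \<in> out c (danc lan.L (fwd to_L M) z)"
    then have "g \<in> out c (anch (app c mm (dirs m M)) z)" by (simp add: to_L_def)
    then show "bwd to_L M (dact lan.L (fwd to_L M) g z) = dact B M g (bwd to_L M z)"
      using tau_dact [OF M z] by (simp add: to_L_def)
  }
  fix g assume "g \<in> out c (anc B M)"
  then have g: "g \<in> out c (anc m M)" using M by simp
  show "fwd to_L (push B g M) = push lan.L g (fwd to_L M)"
    using M g by (simp add: to_L_def lift_def)
  fix z assume "z \<in> dir lan.L (push lan.L g (fwd to_L M))"
  then have z: "z \<in> els (app c mm (dirs m (push m g M)))" by (simp add: to_L_def)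
  show "bwd to_L M (pull lan.L g (fwd to_L M) z) = pull B g M (bwd to_L (push B g M) z)"
    using tau_pull [OF M g z] M g by (simp add: to_L_def lift_def)
qed

text \<open>The equations on directions come from applying \<sigma> to those that \<tau>
  satisfies.\<close>

lemma bimap_of_L: "bimap c c lan.L B of_L"
proof (intro bimapI cofun.bicom_cof cofun_proj lan.L.bicom_axioms bimod_mapI)
  interpret pr: cofun \<Theta>op c proj by (rule cofun_proj)
  interpret t: bimap c c B lan.L to_L by (rule bimap_to_L)
  fix M assume "M \<in> pos lan.L"
  then have M: "M \<in> pos m" by simp
  note t = t.fwd_simps [of M, unfolded to_L_def lens.simps]
    and t' = t.bwd_simps [of M, unfolded to_L_def lens.simps]
  show "fwd of_L M \<in> pos B" "anc B (fwd of_L M) = anc lan.L M"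
    using M by (simp_all add: of_L_def)
  {
    fix f assume "f \<in> dir B (fwd of_L M)"
    then have f: "f \<in> out \<Theta>op M" by (simp add: of_L_def)
    note s = sigma_mem [OF f]
    show "bwd of_L M f \<in> dir lan.L M" using s by (simp add: of_L_def)
    show danc: "danc lan.L M (bwd of_L M f) = danc B (fwd of_L M) f"
      using t'(2) [of "\<sigma> M f"] s M by (simp add: of_L_def)
    fix g assume g: "g \<in> out c (danc B (fwd of_L M) f)"
    have "\<sigma> M (\<tau> M (dact lan.L M g (\<sigma> M f))) = dact lan.L M g (\<sigma> M f)"
      using lan.L.dact_simps(3) [of M "\<sigma> M f" g] s M g danc by (intro sigma_tau) (simp_all add: of_L_def)
    moreover have "\<tau> M (dact lan.L M g (\<sigma> M f)) = dact B M g f"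
      using t'(3) [of "\<sigma> M f" g] s M g danc by (simp add: of_L_def)
    ultimately show "bwd of_L M (dact B (fwd of_L M) g f) = dact lan.L M g (bwd of_L M f)"
      by (simp add: of_L_def)
  }
  fix g assume "g \<in> out c (anc lan.L M)"
  then have g: "g \<in> out c (anc m M)" by simp
  show push: "fwd of_L (push lan.L g M) = push B g (fwd of_L M)"
    using M g by (simp add: of_L_def lift_def)
  fix f assume "f \<in> dir B (push B g (fwd of_L M))"
  then have f: "f \<in> out \<Theta>op (push m g M)" using M g by (simp add: of_L_def lift_def)
  note s = sigma_mem [OF f]
  have "\<sigma> M (\<tau> M (app_map mm (pull m g M) (\<sigma> (push m g M) f))) = app_map mm (pull m g M) (\<sigma> (push m g M) f)"
    using s by (intro sigma_tau naturalD(1) [OF m3.pq.pq.natural_app_map [OF m.natural_pull [OF M g]]])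
  then show "bwd of_L M (pull B g (fwd of_L M) f) = pull lan.L g M (bwd of_L (push lan.L g M) f)"
    using tau_pull [OF M g s(1)] s(2) by (simp add: of_L_def)
qed

end

section \<open>Counit and comultiplication of \<open>L\<close>\<close>

context fam_monad
begin

abbreviation L_dir where "L_dir M \<equiv> els (app c mm (dirs m M))"
abbreviation LL where "LL \<equiv> lan.L \<triangleleft>\<^bsub>c\<^esub> lan.L"

lemma over_L: "fam_monad_over c m \<eta> \<mu> lan.L idl lan.u"
  by (intro fam_monad_over.intro fam_monad_axioms lan.L.bicom_axioms fam_monad_over_axioms.intro)
    (simp_all only: Lan_eq bimap_idl [OF lan.L.bicom_axioms] lan.transpose_idl)

lemma bicom_LL: "bicom c c LL"
  by (intro bicom.intro category bicom2.bicomodule_bicomp bicom2.intro lan.L.bicom_axioms)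

text \<open>The property that characterises \<open>Lan_counit\<close>, in evaluated form;
  \<open>is_comult\<close> below is its counterpart for \<open>Lan_comult\<close>. In \<Theta> they
  prescribe identities and composites.\<close>

definition is_counit where
  "is_counit \<epsilon> \<longleftrightarrow> bimod_hom c c lan.L (unit_bimod c) \<epsilon> \<and>
     (\<forall>M\<in>pos m. \<tau> M (bwd \<epsilon> M (ide c (anc m M))) = ide \<Theta> M)"

definition is_comult where
  "is_comult \<delta> \<longleftrightarrow> bimod_hom c c lan.L LL \<delta> \<and>
     (\<forall>M\<in>pos m. fwd \<delta> M = (M, \<lambda>z\<in>L_dir M. fst (\<tau> M z)) \<and>
       (\<forall>z\<in>L_dir M. \<forall>w\<in>L_dir (fst (\<tau> M z)).
         \<tau> M (bwd \<delta> M (cls c lan.L lan.L (fwd \<delta> M) (z, w))) =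
         cmp \<Theta> (\<tau> M z) (\<tau> (fst (\<tau> M z)) w)))"

lemma is_counit_bimap: "is_counit \<epsilon> \<Longrightarrow> bimap c c lan.L (unit_bimod c) \<epsilon>"
  by (simp add: is_counit_def bimap_hom lan.L.bicom_axioms bicom_unit category)

lemma is_comult_bimap: "is_comult \<delta> \<Longrightarrow> bimap c c lan.L LL \<delta>"
  by (simp add: is_comult_def bimap_hom lan.L.bicom_axioms bicom_LL)

lemma counit_iff:
  "bimod_hom c c lan.L (unit_bimod c) \<epsilon> \<and> counit_condition c m \<eta> lan.L \<epsilon> lan.u \<longleftrightarrow> is_counit \<epsilon>"
proof -
  interpret o: fam_monad_over c m \<eta> \<mu> lan.L idl lan.u by (rule over_L)
  show ?thesis
    using o.counit_condition_iff [of \<epsilon>] bimap_hom [OF lan.L.bicom_axioms bicom_unit [OF category], of \<epsilon>]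
    by (auto simp: is_counit_def idl_def)
qed

lemma comult_iff:
  "bimod_hom c c lan.L LL \<delta> \<and> comult_condition c m \<mu> lan.L \<delta> lan.u \<longleftrightarrow> is_comult \<delta>"
proof (cases "bimod_hom c c lan.L LL \<delta>")
  case True
  interpret o: fam_monad_over c m \<eta> \<mu> lan.L idl lan.u by (rule over_L)
  interpret \<delta>: bimap c c lan.L LL \<delta>
    by (rule bimap_hom [OF lan.L.bicom_axioms bicom_LL True])
  \<comment> \<open>The evaluated condition fixes the second component on \<open>L_dir M\<close>
    only; as a morphism of copresheaves it is extensional, and so it is determined.\<close>
  have fwd: "fst (fwd \<delta> M) = M \<and> (\<forall>z\<in>L_dir M. snd (fwd \<delta> M) z = fst (\<tau> M z)) \<longleftrightarrow>
      fwd \<delta> M = (M, \<lambda>z\<in>L_dir M. fst (\<tau> M z))" if "M \<in> pos m" for M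
  proof -
    obtain N f where Nf: "fwd \<delta> M = (N, f)" by fastforce
    then have "f \<in> extensional (L_dir N)"
      using \<delta>.fwd_simps(1) [of M] that by (simp add: Hom_def)
    then show ?thesis
      by (auto simp: Nf intro!: extensionalityI [of f "L_dir M"])
  qed
  have "comult_condition c m \<mu> lan.L \<delta> lan.u \<longleftrightarrow> (\<forall>M\<in>pos m.
    (fst (fwd \<delta> M) = M \<and> (\<forall>z\<in>L_dir M. snd (fwd \<delta> M) z = fst (\<tau> M z))) \<and>
    (\<forall>z\<in>L_dir M. \<forall>w\<in>L_dir (fst (\<tau> M z)).
        \<tau> M (bwd \<delta> M (cls c lan.L lan.L (fwd \<delta> M) (z, w))) = cmp \<Theta> (\<tau> M z) (\<tau> (fst (\<tau> M z)) w)))"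
    unfolding o.comult_condition_iff [OF \<delta>.bimap_axioms]
    by (simp only: idl_def lens.simps coclosure_simps ball_conj_distrib conj_assoc)
  also have "\<dots> \<longleftrightarrow> (\<forall>M\<in>pos m. fwd \<delta> M = (M, \<lambda>z\<in>L_dir M. fst (\<tau> M z)) \<and>
    (\<forall>z\<in>L_dir M. \<forall>w\<in>L_dir (fst (\<tau> M z)).
        \<tau> M (bwd \<delta> M (cls c lan.L lan.L (fwd \<delta> M) (z, w))) = cmp \<Theta> (\<tau> M z) (\<tau> (fst (\<tau> M z)) w)))"
    by (rule ball_cong [OF refl]) (simp only: fwd)
  finally show ?thesis using True by (simp only: is_comult_def simp_thms)
next
  case False
  then show ?thesis by (simp only: is_comult_def simp_thms)
qed

text \<open>The witness is the counit of the comonad of \<open>proj\<close>, carried over to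
  \<open>L\<close> along \<open>of_L\<close>.\<close>

lemma is_counit_ex: "is_counit (restrict_lens lan.L (unit_bimod c) (proj \<odot> of_L))"
proof -
  interpret pr: cofun \<Theta>op c proj by (rule cofun_proj)
  interpret e: bimap c c lan.L "unit_bimod c" "proj \<odot> of_L"
    by (rule bimap_lcomp [OF bimap_of_L pr.bimap_counit])
  have "\<tau> M (bwd (restrict_lens lan.L (unit_bimod c) (proj \<odot> of_L)) M (ide c (anc m M))) = ide \<Theta> M"
    if M: "M \<in> pos m" for M
  proof -
    have "bwd (restrict_lens lan.L (unit_bimod c) (proj \<odot> of_L)) M (ide c (anc m M)) =
        \<sigma> M (bwd proj M (ide c (fwd proj M)))"
      using M by (simp add: restrict_lens_def lcomp_def of_L_def)
    also have "bwd proj M (ide c (fwd proj M)) = ide \<Theta> M"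
      using pr.cof_simps(2) [of M] M by simp
    also have "\<tau> M (\<sigma> M \<dots>) = \<dots>"
      using M unit_Hom [OF M] by (intro sigma_mem(2)) simp
    finally show ?thesis .
  qed
  then show ?thesis
    unfolding is_counit_def
    using bimod_hom_restrict_lens [OF e.bimap_axioms] by blast
qed

text \<open>A map to the unit bicomodule is fixed by its values at identities, and \<tau> is
  injective on these.\<close>

lemma is_counit_unique:
  assumes "is_counit \<epsilon>" "is_counit \<epsilon>'"
  shows "\<epsilon> = \<epsilon>'"
proof (rule is_lens_eqI)
  show "is_lens lan.L (unit_bimod c) \<epsilon>" "is_lens lan.L (unit_bimod c) \<epsilon>'"
    using assms by (simp_all add: is_counit_def bimod_hom_iff)
  note e = is_counit_bimap [OF assms(1)] is_counit_bimap [OF assms(2)]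
  interpret \<epsilon>: bimap c c lan.L "unit_bimod c" \<epsilon> by (rule e)
  interpret \<epsilon>': bimap c c lan.L "unit_bimod c" \<epsilon>' by (rule e)
  show "lens_eq lan.L (unit_bimod c) \<epsilon> \<epsilon>'"
  proof (rule lens_eq_unit_bimod [OF e])
    fix M assume "M \<in> pos lan.L"
    then have M: "M \<in> pos m" by simp
    have i: "ide c (anc m M) \<in> out c (anc m M)" using M by simp
    have "bwd \<epsilon> M (ide c (anc m M)) \<in> L_dir M"
      "bwd \<epsilon>' M (ide c (anc m M)) \<in> L_dir M"
      using \<epsilon>.bwd_simps(1) [of M] \<epsilon>'.bwd_simps(1) [of M] \<epsilon>.fwd_simps(2) [of M] \<epsilon>'.fwd_simps(2) [of M] M i
      by simp_all
    then show "bwd \<epsilon> M (ide c (anc lan.L M)) = bwd \<epsilon>' M (ide c (anc lan.L M))"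
      using assms M by (intro tau_inj [of _ M]) (simp_all add: is_counit_def)
  qed
qed

lemma is_comult_ex: "\<exists>\<delta>. is_comult \<delta>"
proof -
  interpret pr: cofun \<Theta>op c proj by (rule cofun_proj)
  interpret t: bimap c c B lan.L to_L by (rule bimap_to_L)
  interpret tt: bicom2_map c c c B lan.L B lan.L to_L to_L by unfold_locales
  let ?w = "bicomp_map c B lan.L B to_L to_L"
  have tt: "bimap c c (B \<triangleleft>\<^bsub>c\<^esub> B) LL ?w"
    by (rule tt.bimap_bicomp_map)
  \<comment> \<open>The comultiplication of the comonad of \<open>proj\<close>, conjugated by the
    isomorphism between \<open>L\<close> and \<open>B\<close>.\<close>
  let ?\<delta> = "?w \<odot> cof_comult \<Theta>op \<odot> of_L"
  interpret d: bimap c c lan.L LL ?\<delta>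
    by (rule bimap_lcomp [OF bimap_lcomp [OF bimap_of_L pr.bimap_comult] tt])
  let ?r = "restrict_lens lan.L LL ?\<delta>"
  have hom: "bimod_hom c c lan.L LL ?r"
    by (rule bimod_hom_restrict_lens [OF d.bimap_axioms])
  have fwd: "fwd ?\<delta> M = (M, \<lambda>z\<in>L_dir M. fst (\<tau> M z))" if M: "M \<in> pos m" for M
  proof -
    have "\<tau> M z \<in> out \<Theta>op M \<and> tgt \<Theta>op (\<tau> M z) = fst (\<tau> M z)" if "z \<in> L_dir M" for z
      using tau_out [OF M that] by (simp add: tau_eq)
    then show ?thesis
      by (simp add: lcomp_def of_L_def to_L_def pr.cof_comult_fwd cong: restrict_cong)
  qed
  have "is_comult ?r"
    unfolding is_comult_def
  proof (intro conjI hom ballI)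
    fix M assume M: "M \<in> pos m"
    show fwdr: "fwd ?r M = (M, \<lambda>z\<in>L_dir M. fst (\<tau> M z))"
      using M fwd [OF M] by (simp add: restrict_lens_def)
    fix z w assume z: "z \<in> L_dir M" and w: "w \<in> L_dir (fst (\<tau> M z))"
    let ?M = "fst (\<tau> M z)"
    let ?J = "(M, \<lambda>z\<in>L_dir M. fst (\<tau> M z))"
    have M': "?M \<in> pos m" and tgt: "tgt \<Theta>op (\<tau> M z) = ?M"
      using tau_out [OF M z] by (simp_all add: tau_eq)
    have K: "cls c lan.L lan.L ?J (z, w) \<in> dir LL ?J"
      using z w by (intro cls_mem_dir) simp_all
    note tz = tau_out [OF M z] and tw = tau_out [OF M' w]
    have "bwd ?r M (cls c lan.L lan.L ?J (z, w)) = bwd ?\<delta> M (cls c lan.L lan.L ?J (z, w))"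
      using M K fwd [OF M] by (simp add: restrict_lens_def)
    then have r: "bwd ?r M (cls c lan.L lan.L ?J (z, w)) =
        \<sigma> M (bwd (cof_comult \<Theta>op) M (bwd ?w (M, \<lambda>h\<in>out \<Theta>op M. tgt \<Theta>op h) (cls c lan.L lan.L ?J (z, w))))"
      by (simp add: lcomp_def of_L_def pr.cof_comult_fwd)
    have "bwd ?w (M, \<lambda>h\<in>out \<Theta>op M. tgt \<Theta>op h) (cls c lan.L lan.L ?J (z, w)) =
        cls c B B (M, \<lambda>h\<in>out \<Theta>op M. tgt \<Theta>op h) (bwd to_L M z, bwd to_L ((\<lambda>h\<in>out \<Theta>op M. tgt \<Theta>op h) (bwd to_L M z)) w)"
    proof (rule tt.bwd_bicomp_map)
      show "M \<in> pos B" using M by simp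
      then show "(\<lambda>h\<in>out \<Theta>op M. tgt \<Theta>op h) \<in> Hom c (dirs B M) (poss B)"
        by (intro pr.tgt_Hom) simp
      show "?J = (fwd to_L M, \<lambda>x\<in>dir lan.L (fwd to_L M). fwd to_L ((\<lambda>h\<in>out \<Theta>op M. tgt \<Theta>op h) (bwd to_L M x)))"
        unfolding fwd [OF M, symmetric] lcomp_def of_L_def pr.cof_comult_fwd lens.simps bicomp_map_fwd by simp
    qed
    then have t: "bwd ?w (M, \<lambda>h\<in>out \<Theta>op M. tgt \<Theta>op h) (cls c lan.L lan.L ?J (z, w)) =
        cls c B B (M, \<lambda>h\<in>out \<Theta>op M. tgt \<Theta>op h) (\<tau> M z, \<tau> ?M w)"
      using tz tgt by (simp add: to_L_def)
    have d: "bwd (cof_comult \<Theta>op) M (cls c B B (M, \<lambda>h\<in>out \<Theta>op M. tgt \<Theta>op h) (\<tau> M z, \<tau> ?M w)) =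
        cmp \<Theta>op (\<tau> ?M w) (\<tau> M z)"
      using M tz tw tgt by (intro pr.cof_comult_bwd refl) simp_all
    have "\<tau> M (\<sigma> M (cmp \<Theta>op (\<tau> ?M w) (\<tau> M z))) = cmp \<Theta>op (\<tau> ?M w) (\<tau> M z)"
      using tz tw tgt by (intro sigma_mem(2) pr.out_dom(4)) simp_all
    then show "\<tau> M (bwd ?r M (cls c lan.L lan.L (fwd ?r M) (z, w))) = cmp \<Theta> (\<tau> M z) (\<tau> ?M w)"
      unfolding fwdr r t d by simp
  qed
  then show ?thesis by blast
qed

text \<open>All directions of \<open>L \<triangleleft> L\<close> are classes of pairs
  \<open>(z, w)\<close>, and on these the value under \<tau> is prescribed as a Kleisli
  composite.\<close>

lemma is_comult_unique:
  assumes d: "is_comult \<delta>" "is_comult \<delta>'"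
  shows "\<delta> = \<delta>'"
proof (rule is_lens_eqI)
  show "is_lens lan.L LL \<delta>" "is_lens lan.L LL \<delta>'"
    using assms by (simp_all add: is_comult_def bimod_hom_iff)
  note e = is_comult_bimap [OF d(1)] is_comult_bimap [OF d(2)]
  show "lens_eq lan.L LL \<delta> \<delta>'"
    unfolding lens_eq_def
  proof (intro ballI conjI)
    fix M assume "M \<in> pos lan.L"
    then have M: "M \<in> pos m" by simp
    let ?J = "(M, \<lambda>z\<in>L_dir M. fst (\<tau> M z))"
    have J: "fwd \<delta> M = ?J" "fwd \<delta>' M = ?J"
      using d M by (simp_all only: is_comult_def)
    then show "fwd \<delta> M = fwd \<delta>' M" by simp
    fix K assume K: "K \<in> dir LL (fwd \<delta> M)"
    then obtain z w where z: "z \<in> L_dir M" and w: "w \<in> L_dir (fst (\<tau> M z))"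
      and K': "K = cls c lan.L lan.L ?J (z, w)"
      unfolding J by (auto elim!: dir_bicompE)
    have "\<tau> M (bwd \<delta> M (cls c lan.L lan.L (fwd \<delta> M) (z, w))) = cmp \<Theta> (\<tau> M z) (\<tau> (fst (\<tau> M z)) w)"
      "\<tau> M (bwd \<delta>' M (cls c lan.L lan.L (fwd \<delta>' M) (z, w))) = cmp \<Theta> (\<tau> M z) (\<tau> (fst (\<tau> M z)) w)"
      using d M z w unfolding is_comult_def by blast+
    then have eq: "\<tau> M (bwd \<delta> M K) = \<tau> M (bwd \<delta>' M K)"
      unfolding J K' by (simp only:)
    have "bwd \<delta> M K \<in> dir lan.L M" "bwd \<delta>' M K \<in> dir lan.L M"
      using bimap.bwd_simps(1) [OF e(1), of M K] bimap.bwd_simps(1) [OF e(2), of M K] M K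
      by (simp_all add: J)
    then show "bwd \<delta> M K = bwd \<delta>' M K"
      using eq by (intro tau_inj [of _ M]) simp_all
  qed
qed

lemma Lan_counit: "is_counit (Lan_counit c m \<eta>)"
  unfolding Lan_counit_def Lan_eq counit_iff
  by (rule theI [of is_counit, OF is_counit_ex is_counit_unique [OF _ is_counit_ex]])

lemma Lan_comult: "is_comult (Lan_comult c m \<mu>)"
proof -
  have "\<exists>!\<delta>. is_comult \<delta>"
    using is_comult_ex is_comult_unique by blast
  then show ?thesis
    unfolding Lan_comult_def Lan_eq comult_iff by (rule theI')
qed

lemma Lan_counit_eq: "Lan_counit c m \<eta> = restrict_lens lan.L (unit_bimod c) (proj \<odot> of_L)"
  by (rule is_counit_unique [OF Lan_counit is_counit_ex])

section \<open>The carrier comonoid of \<open>L\<close> and its category\<close>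

abbreviation E where "E \<equiv> Lan_comonoid c m \<eta> \<mu>"

lemma E_simps [simp]:
  "pos E = pos m" "dir E M = L_dir M"
  by (simp_all add: Lan_comonoid_def carrier_comonoid_def Lan_eq)

lemma fwd_comult_E:
  "M \<in> pos m \<Longrightarrow> fwd (comult E) M = (M, \<lambda>z\<in>L_dir M. fst (\<tau> M z))"
  using Lan_comult
  by (simp add: Lan_comonoid_def carrier_comonoid_def Lan_eq restrict_lens_def equalizer_incl_def
      lcomp_def is_comult_def)

lemma bwd_counit_E: "M \<in> pos m \<Longrightarrow> bwd (counit E) M () = bwd (Lan_counit c m \<eta>) M (ide c (anc m M))"
proof -
  assume M: "M \<in> pos m"
  from bimap.fwd_simps(2) [OF is_counit_bimap [OF Lan_counit], of M] have "fwd (Lan_counit c m \<eta>) M = anc m M"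
    using M by simp
  then show ?thesis
    using M
    by (simp add: Lan_comonoid_def carrier_comonoid_def Lan_eq restrict_lens_def lcomp_def
        comonoid_of_cat_def ypoly_def)
qed

lemma bwd_comult_E:
  assumes M: "M \<in> pos m" and z: "z \<in> L_dir M"
    and w: "w \<in> L_dir (fst (\<tau> M z))"
  shows "bwd (comult E) M (z, w) =
    bwd (Lan_comult c m \<mu>) M (cls c lan.L lan.L (fwd (Lan_comult c m \<mu>) M) (z, w))"
proof -
  have "fwd (Lan_comult c m \<mu>) M = (M, \<lambda>z\<in>L_dir M. fst (\<tau> M z))"
    using Lan_comult M by (simp add: is_comult_def)
  then show ?thesis
    using M z w
    by (simp add: Lan_comonoid_def carrier_comonoid_def Lan_eq restrict_lens_def equalizer_incl_def
        lcomp_def pcomp_def)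
qed

lemma tau_ide_E:
  assumes M: "M \<in> pos m"
  shows "bwd (counit E) M () \<in> L_dir M" "\<tau> M (bwd (counit E) M ()) = ide \<Theta> M"
proof -
  interpret \<epsilon>: bimap c c lan.L "unit_bimod c" "Lan_counit c m \<eta>"
    by (rule is_counit_bimap [OF Lan_counit])
  show "bwd (counit E) M () \<in> L_dir M" "\<tau> M (bwd (counit E) M ()) = ide \<Theta> M"
    using M Lan_counit \<epsilon>.bwd_simps(1) [of M "ide c (anc m M)"] \<epsilon>.fwd_simps(2) [of M]
    by (simp_all add: bwd_counit_E is_counit_def)
qed

lemma tau_cmp_E:
  assumes M: "M \<in> pos m" and z: "z \<in> L_dir M"
    and w: "w \<in> L_dir (fst (\<tau> M z))"
  shows "bwd (comult E) M (z, w) \<in> L_dir M"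
    and "\<tau> M (bwd (comult E) M (z, w)) = cmp \<Theta> (\<tau> M z) (\<tau> (fst (\<tau> M z)) w)"
proof -
  interpret \<delta>: bimap c c lan.L LL "Lan_comult c m \<mu>"
    by (rule is_comult_bimap [OF Lan_comult])
  have J: "fwd (Lan_comult c m \<mu>) M = (M, \<lambda>z\<in>L_dir M. fst (\<tau> M z))"
    using Lan_comult M by (simp add: is_comult_def)
  have "cls c lan.L lan.L (fwd (Lan_comult c m \<mu>) M) (z, w) \<in> dir LL (fwd (Lan_comult c m \<mu>) M)"
    unfolding J using z w by (intro cls_mem_dir) simp_all
  then show "bwd (comult E) M (z, w) \<in> L_dir M"
    unfolding bwd_comult_E [OF assms] using M \<delta>.bwd_simps(1) [of M] by simp
  show "\<tau> M (bwd (comult E) M (z, w)) = cmp \<Theta> (\<tau> M z) (\<tau> (fst (\<tau> M z)) w)"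
    unfolding bwd_comult_E [OF assms] using Lan_comult M z w unfolding is_comult_def by blast
qed

abbreviation catE where "catE \<equiv> cat_of_comonoid E"

lemma catE_simps [simp]:
  "Ob catE = pos m" "(M, z) \<in> Ar catE \<longleftrightarrow> M \<in> pos m \<and> z \<in> L_dir M"
  "src catE (M, z) = M"
  "ide catE M = (M, bwd (counit E) M ())"
  "cmp catE (N, w) (M, z) = (M, bwd (comult E) M (z, w))"
  by (simp_all add: cat_of_comonoid_def)

lemma tgt_catE [simp]: "M \<in> pos m \<Longrightarrow> z \<in> L_dir M \<Longrightarrow> tgt catE (M, z) = fst (\<tau> M z)"
  by (simp add: cat_of_comonoid_def fwd_comult_E)

lemma Theta_arr_tau: "Theta_arr c m (M, z) = \<tau> M z"
  by (simp add: \<tau>_def)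

lemma tau_Ar:
  assumes "M \<in> pos m" "z \<in> L_dir M"
  shows "\<tau> M z \<in> Ar \<Theta>" "src \<Theta> (\<tau> M z) = fst (\<tau> M z)" "tgt \<Theta> (\<tau> M z) = M" "fst (\<tau> M z) \<in> pos m"
  using tau_out [OF assms] by (simp_all add: tau_eq)

text \<open>The position is recorded as the codomain of the arrow, which keeps different positions
  apart; for a fixed position \<sigma> is the inverse.\<close>

lemma bij_Theta_arr: "bij_betw (Theta_arr c m) (Ar catE) (Ar \<Theta>)"
proof (rule bij_betwI')
  fix f g assume "f \<in> Ar catE" "g \<in> Ar catE"
  then obtain M z N w where "f = (M, z)" "g = (N, w)" "z \<in> L_dir M"
    "w \<in> L_dir N" by (cases f, cases g) simp
  then show "Theta_arr c m f = Theta_arr c m g \<longleftrightarrow> f = g"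
    using tau_inj [of z M w] by (auto simp: Theta_arr_tau tau_eq)
next
  fix f assume "f \<in> Ar catE"
  then show "Theta_arr c m f \<in> Ar \<Theta>"
    by (cases f) (simp add: Theta_arr_tau tau_Ar)
next
  fix f assume "f \<in> Ar \<Theta>"
  then obtain M' M k where f: "f = (M', M, k)" "M' \<in> pos m" "M \<in> pos m" "k \<in> Hom c (dirs m M') (T (dirs m M))"
    by (rule ArE)
  then have "f \<in> out \<Theta>op M" by simp
  note sigma_mem [OF this]
  then show "\<exists>x\<in>Ar catE. f = Theta_arr c m x"
    using f by (intro bexI [of _ "(M, \<sigma> M f)"]) (simp_all add: Theta_arr_tau)
qed

text \<open>The axioms are reflected from the opposite of \<Theta> along \<open>Theta_arr\<close>,
  so that the associative law reduces to that of Kleisli composition.\<close>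

lemma category_catE: "category catE"
proof (rule category_transport [OF category_Thetaop, of "\<lambda>M. M" catE "Theta_arr c m"])
  show "inj_on (Theta_arr c m) (Ar catE)" using bij_Theta_arr by (rule bij_betw_imp_inj_on)
  fix f assume f: "f \<in> Ar catE"
  obtain M z where Mz: "f = (M, z)" "M \<in> pos m" "z \<in> L_dir M"
    using f by (cases f) simp
  note tau = tau_Ar [OF Mz(2,3)]
  show "src catE f \<in> Ob catE" "tgt catE f \<in> Ob catE" "Theta_arr c m f \<in> Ar \<Theta>op"
    "src \<Theta>op (Theta_arr c m f) = src catE f" "tgt \<Theta>op (Theta_arr c m f) = tgt catE f"
    using Mz tau by (simp_all add: Theta_arr_tau)
  fix g assume "g \<in> Ar catE" "src catE g = tgt catE f"
  then obtain w where w: "g = (fst (\<tau> M z), w)" "w \<in> L_dir (fst (\<tau> M z))"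
    using Mz by (cases g) simp
  show "cmp catE g f \<in> Ar catE" "Theta_arr c m (cmp catE g f) = cmp \<Theta>op (Theta_arr c m g) (Theta_arr c m f)"
    using Mz w tau_cmp_E [OF Mz(2,3) w(2)] by (simp_all add: Theta_arr_tau)
qed (use tau_ide_E in \<open>simp_all add: Theta_arr_tau\<close>)

lemma cat_iso_catE: "cat_iso catE \<Theta>op (\<lambda>M. M) (Theta_arr c m)"
  unfolding cat_iso_def
proof (intro conjI ballI impI category_catE category_Thetaop)
  show "bij_betw (\<lambda>M. M) (Ob catE) (Ob \<Theta>op)" by (simp add: bij_betw_def)
  show "bij_betw (Theta_arr c m) (Ar catE) (Ar \<Theta>op)" using bij_Theta_arr by simp
  fix f assume f: "f \<in> Ar catE"
  obtain M z where Mz: "f = (M, z)" "M \<in> pos m" "z \<in> L_dir M"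
    using f by (cases f) simp
  note tau = tau_Ar [OF Mz(2,3)]
  show "src \<Theta>op (Theta_arr c m f) = src catE f" "tgt \<Theta>op (Theta_arr c m f) = tgt catE f"
    using Mz tau by (simp_all add: Theta_arr_tau)
  fix g assume "g \<in> Ar catE" "src catE g = tgt catE f"
  then obtain w where w: "g = (fst (\<tau> M z), w)" "w \<in> L_dir (fst (\<tau> M z))"
    using Mz by (cases g) simp
  show "Theta_arr c m (cmp catE g f) = cmp \<Theta>op (Theta_arr c m g) (Theta_arr c m f)"
    using Mz w tau_cmp_E [OF Mz(2,3) w(2)] by (simp add: Theta_arr_tau)
next
  fix M assume "M \<in> Ob catE"
  then show "Theta_arr c m (ide catE M) = ide \<Theta>op M"
    using tau_ide_E by (simp add: Theta_arr_tau)
qed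

lemma comonoid_E: "comonoid E"
proof (rule comonoidI)
  show "is_lens E ypoly (counit E)"
  proof -
    \<comment> \<open>The definition of the carrier comonoid has already normalised the counit, so
      restricting it again changes nothing, and only its values on the carrier have to be
      checked.\<close>
    have "counit E = restrict_lens E ypoly (counit E)"
      by (simp add: Lan_comonoid_def carrier_comonoid_def Lan_eq restrict_lens_def fun_eq_iff)
    moreover have "is_lens E ypoly (restrict_lens E ypoly (counit E))"
      using tau_ide_E by (intro is_lens_restrict_lens) (simp_all add: ypoly_def)
    ultimately show ?thesis by simp
  qed
  show "is_lens E (pcomp E E) (comult E)"
  proof -
    have "comult E = restrict_lens E (pcomp E E) (comult E)"
      by (simp add: Lan_comonoid_def carrier_comonoid_def Lan_eq restrict_lens_def fun_eq_iff pcomp_def)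
    moreover have "is_lens E (pcomp E E) (restrict_lens E (pcomp E E) (comult E))"
      using tau_cmp_E tau_Ar by (intro is_lens_restrict_lens) (auto simp: pcomp_def fwd_comult_E)
    ultimately show ?thesis by simp
  qed
qed (simp_all add: fwd_comult_E category_catE)

end

section \<open>Cofunctors out of the opposite theory category and their transposes\<close>

context fam_monad
begin

text \<open>The counit of \<open>L\<close> is \<open>proj\<close> after \<open>of_L\<close>, so
  transporting it along \<open>Theta_arr\<close> cancels \<sigma> against \<tau>.\<close>

lemma Theta_proj_eq: "Theta_proj c m \<eta> \<mu> = proj"
proof -
  let ?k = "cof_of_inv_iso catE (\<lambda>M. M) (Theta_arr c m)"
  have inv: "inv_into (pos m) (\<lambda>M. M) M = M" if "M \<in> pos m" for M
    using inv_into_f_f [of "\<lambda>M. M" "pos m" M] that by simp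
  have fwd: "fwd (Lan_counit c m \<eta>) M = anc m M"
    "g \<in> out c (anc m M) \<Longrightarrow> bwd (Lan_counit c m \<eta>) M g = \<sigma> M (lift M g)" if "M \<in> pos m" for M g
    using that by (simp_all add: Lan_counit_eq restrict_lens_def lcomp_def of_L_def)
  have "\<tau> M (\<sigma> M (lift M g)) = lift M g" if "M \<in> pos m" "g \<in> out c (anc m M)" for M g
    using that by (intro sigma_mem(2) lift_out)
  then show ?thesis
    by (simp add: Theta_proj_def proj_def restrict_lens_def fwd inv lcomp_def cof_of_inv_iso_def tag_def
        Theta_arr_tau fun_eq_iff)
qed

text \<open>The map out of \<open>L\<close> inside \<open>Theta_transpose\<close>, before it is
  transposed.\<close>

definition along where
  "along F = F \<odot> cof_of_iso catE (\<lambda>M. M) (Theta_arr c m) \<odot> untag"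

text \<open>One side inverts \<open>Theta_arr\<close> by \<open>inv_into\<close> on tagged arrows,
  the other by \<sigma>; injectivity of \<open>Theta_arr\<close> makes them agree.\<close>

lemma along_eq: "lens_eq lan.L (cat_poly a) (along F) (F \<odot> of_L)"
  if "is_lens (cat_poly \<Theta>op) (cat_poly a) F" for a :: "('b, 'e) cat"
  unfolding lens_eq_def
proof (intro ballI conjI)
  fix M assume "M \<in> pos lan.L"
  then have M: "M \<in> pos m" by simp
  show "fwd (along F) M = fwd (F \<odot> of_L) M"
    by (simp add: along_def lcomp_def cof_of_iso_def untag_def of_L_def)
  fix x assume "x \<in> dir (cat_poly a) (fwd (along F) M)"
  then have x: "x \<in> out a (fwd F M)"
    by (simp add: along_def lcomp_def cof_of_iso_def untag_def)
  have "bwd F \<in> (\<Pi>\<^sub>E M\<in>pos m. out a (fwd F M) \<rightarrow>\<^sub>E out \<Theta>op M)"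
    using that by (simp add: is_lens_def)
  from PiE_mem [OF this M] x have f: "bwd F M x \<in> out \<Theta>op M" by auto
  have "inv_into (out catE M) (Theta_arr c m) (Theta_arr c m (M, \<sigma> M (bwd F M x))) = (M, \<sigma> M (bwd F M x))"
    using sigma_mem(1) [OF f] M
    by (intro inv_into_f_f inj_on_subset [OF bij_betw_imp_inj_on [OF bij_Theta_arr]]) (auto simp: out_def)
  then show "bwd (along F) M x = bwd (F \<odot> of_L) M x"
    using sigma_mem(2) [OF f]
    by (simp add: along_def lcomp_def cof_of_iso_def untag_def of_L_def Theta_arr_tau)
qed

lemma is_lens_cofunctor: "cofunctor a b F \<Longrightarrow> is_lens (cat_poly a) (cat_poly b) F"
  by (simp add: cofunctor_def)

end

locale fam_monad_cof = fam_monad c m \<eta> \<mu> + \<alpha>: cofun a c \<alpha>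
  for c :: "('o, 'a) cat" and m :: "('i, 'd, 'o, 'a, 'o, 'a) bimod"
    and \<eta> :: "('o, 'a, 'i, 'd) lens"
    and \<mu> :: "('i \<times> ('d \<Rightarrow> 'i), ('d \<times> 'd) set, 'i, 'd) lens"
    and a :: "('b, 'e) cat" and \<alpha> :: "('b, 'e, 'o, 'a) lens"
begin

abbreviation Ca where "Ca \<equiv> cof_bimod a \<alpha>"

sublocale adj: adj c c c m mm Ca by unfold_locales

abbreviation Cmm where "Cmm \<equiv> Ca \<triangleleft>\<^bsub>c\<^esub> mm"

abbreviation cofs where
  "cofs \<equiv> {F. cofunctor \<Theta>op a F \<and> lens_eq (cat_poly \<Theta>op) (cat_poly c) (\<alpha> \<odot> F) proj}"

abbreviation trans where
  "trans \<equiv> {\<phi>. bimod_hom c c m Cmm \<phi> \<and>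
     counit_condition c m \<eta> Ca (cof_counit \<alpha>) \<phi> \<and>
     comult_condition c m \<mu> Ca (cof_comult a) \<phi>}"

lemma transpose_eq:
  "Theta_transpose c m \<eta> \<mu> a \<alpha> F = restrict_lens m Cmm (adj.transpose (along F))"
  by (simp add: Theta_transpose_def along_def adj.transpose_def Lan_eq)

lemma along_Ca:
  "is_lens (cat_poly \<Theta>op) (cat_poly a) F \<Longrightarrow> lens_eq lan.L Ca (along F) (F \<odot> of_L)"
  using along_eq [of a F] by (simp add: lens_eq_def)

lemma bimap_along:
  assumes l: "is_lens (cat_poly \<Theta>op) (cat_poly a) F" and F: "bimap c c B Ca F"
  shows "bimap c c lan.L Ca (along F)"
  by (rule bimap_cong [OF bimap_lcomp [OF bimap_of_L F] lens_eq_sym [OF along_Ca [OF l]]])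

lemma over_Ca:
  assumes "bimap c c lan.L Ca \<psi>" "lens_eq m Cmm (adj.transpose \<psi>) \<phi>"
  shows "fam_monad_over c m \<eta> \<mu> Ca \<psi> \<phi>"
  using assms unfolding adj.transpose_def
  by (intro fam_monad_over.intro fam_monad_axioms \<alpha>.bicom_cof fam_monad_over_axioms.intro) (simp_all only: Lan_eq)

text \<open>Under \<tau> the evaluated conditions become the cofunctor laws of \<open>F\<close>.
  Both halves of the bijection use this, with \<psi> obtained from \<open>F\<close> by
  \<open>along\<close> and with \<open>F\<close> obtained from the mate \<psi> of a given \<phi>;
  hence the links between \<open>F\<close>, \<psi> and \<phi> are stated by
  \<open>lens_eq\<close>.\<close>

lemma conditions_iff:
  assumes F: "is_lens (cat_poly \<Theta>op) (cat_poly a) F" "bimap c c B Ca F"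
    and \<psi>: "bimap c c lan.L Ca \<psi>" "lens_eq lan.L Ca \<psi> (F \<odot> of_L)"
    and \<phi>: "lens_eq m Cmm (adj.transpose \<psi>) \<phi>"
  shows "counit_condition c m \<eta> Ca (cof_counit \<alpha>) \<phi> \<and> comult_condition c m \<mu> Ca (cof_comult a) \<phi> \<longleftrightarrow>
    F \<in> cofs"
proof -
  interpret o: fam_monad_over c m \<eta> \<mu> Ca \<psi> \<phi> by (rule over_Ca [OF \<psi>(1) \<phi>])
  interpret F: bimap c c B Ca F by (rule F)
  have FM: "fwd F M \<in> Ob a" "fwd \<alpha> (fwd F M) = anc m M" "fwd \<psi> M = fwd F M" if "M \<in> pos m" for M
    using that F.fwd_simps [of M] \<psi>(2) by (simp_all add: lens_eq_def lcomp_def of_L_def)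
  have Fx: "bwd F M x \<in> out \<Theta>op M" "\<tau> M (bwd \<psi> M x) = bwd F M x" if "M \<in> pos m" "x \<in> out a (fwd F M)" for M x
  proof -
    show *: "bwd F M x \<in> out \<Theta>op M" using that F.bwd_simps(1) [of M x] by simp
    have "bwd \<psi> M x = \<sigma> M (bwd F M x)"
      using that \<psi>(2) FM by (simp add: lens_eq_def lcomp_def of_L_def)
    then show "\<tau> M (bwd \<psi> M x) = bwd F M x" using sigma_mem(2) [OF *] by simp
  qed
  have Fx': "fst (bwd F M x) \<in> pos m" "src \<Theta> (bwd F M x) = fst (bwd F M x)"
    if "M \<in> pos m" "x \<in> out a (fwd F M)" for M x
    using Fx(1) [OF that] by (cases "bwd F M x"; simp)+
  have ide: "bwd \<alpha> (fwd F M) (ide c (anc m M)) = ide a (fwd F M)" "ide a (fwd F M) \<in> out a (fwd F M)"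
    if "M \<in> pos m" for M
    using \<alpha>.cof_simps(2) [OF FM(1) [OF that]] FM [OF that] by (simp_all add: \<alpha>.out_dom)
  have counit: "counit_condition c m \<eta> Ca (cof_counit \<alpha>) \<phi> \<longleftrightarrow>
      (\<forall>M\<in>pos m. bwd F M (ide a (fwd F M)) = ide \<Theta>op M)"
    unfolding cof_counit_def o.counit_condition_iff [OF \<alpha>.bimap_counit]
    by (rule ball_cong [OF refl]) (simp add: FM ide Fx)
  have comult: "comult_condition c m \<mu> Ca (cof_comult a) \<phi> \<longleftrightarrow>
      (\<forall>M\<in>pos m. \<forall>x\<in>out a (fwd F M). tgt a x = fwd F (tgt \<Theta>op (bwd F M x)) \<and>
        (\<forall>w\<in>out a (tgt a x). bwd F M (cmp a w x) = cmp \<Theta>op (bwd F (tgt \<Theta>op (bwd F M x)) w) (bwd F M x)))"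
    unfolding o.comult_condition_iff [OF \<alpha>.bimap_comult]
  proof (rule ball_cong [OF refl])
    fix M assume M: "M \<in> pos m"
    have "bwd \<psi> M (bwd (cof_comult a) (fwd F M) (cls c Ca Ca (fwd F M, \<lambda>h\<in>out a (fwd F M). tgt a h) (x, w))) =
        bwd \<psi> M (cmp a w x)" "cmp a w x \<in> out a (fwd F M)"
      if "x \<in> out a (fwd F M)" "w \<in> out a (tgt a x)" for x w
      using \<alpha>.cof_comult_bwd [OF refl FM(1) [OF M] that] \<alpha>.out_dom(4) [OF that] by simp_all
    then show "(fst (fwd (cof_comult a) (fwd \<psi> M)) = fwd \<psi> M \<and> (\<forall>x\<in>dir Ca (fwd \<psi> M).
        snd (fwd (cof_comult a) (fwd \<psi> M)) x = fwd \<psi> (o.nxt M x) \<and>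
        (\<forall>w\<in>dir Ca (fwd \<psi> (o.nxt M x)).
          \<tau> M (bwd \<psi> M (bwd (cof_comult a) (fwd \<psi> M) (cls c Ca Ca (fwd (cof_comult a) (fwd \<psi> M)) (x, w)))) =
          cmp \<Theta> (\<tau> M (bwd \<psi> M x)) (\<tau> (o.nxt M x) (bwd \<psi> (o.nxt M x) w))))) \<longleftrightarrow>
      (\<forall>x\<in>out a (fwd F M). tgt a x = fwd F (tgt \<Theta>op (bwd F M x)) \<and>
        (\<forall>w\<in>out a (tgt a x). bwd F M (cmp a w x) = cmp \<Theta>op (bwd F (tgt \<Theta>op (bwd F M x)) w) (bwd F M x)))"
      using M by (simp add: FM Fx Fx' \<alpha>.cof_comult_fwd cong: conj_cong)
  qed
  have "F \<in> cofs" if c: "counit_condition c m \<eta> Ca (cof_counit \<alpha>) \<phi>" "comult_condition c m \<mu> Ca (cof_comult a) \<phi>"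
  proof -
    have "cofunctor \<Theta>op a F" "lens_eq (cat_poly \<Theta>op) (cat_poly c) (\<alpha> \<odot> F) proj"
      by (rule cofunctor_bimap [OF \<alpha>.cat_dom category_Thetaop category \<alpha>.cofunctor cofunctor_proj F];
          use c counit comult in simp)+
    then show ?thesis by simp
  qed
  moreover have "counit_condition c m \<eta> Ca (cof_counit \<alpha>) \<phi> \<and> comult_condition c m \<mu> Ca (cof_comult a) \<phi>"
    if "F \<in> cofs"
  proof -
    interpret Fc: cofun \<Theta>op a F using that by (intro cofun.intro category_Thetaop \<alpha>.cat_dom) simp
    show ?thesis
      unfolding counit comult using Fc.cof_simps by simp
  qed
  ultimately show ?thesis by blast
qed

lemma bimap_cofs: "F \<in> cofs \<Longrightarrow> bimap c c B Ca F"
  by (intro bimap_cofunctor \<alpha>.cat_dom \<alpha>.cofunctor category_Thetaop category cofunctor_proj) simp_all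

lemma bij_transpose: "bij_betw (Theta_transpose c m \<eta> \<mu> a \<alpha>) cofs trans"
proof (rule bij_betwI')
  fix F assume F: "F \<in> cofs"
  then have l: "is_lens (cat_poly \<Theta>op) (cat_poly a) F" by (simp add: is_lens_cofunctor)
  note map = bimap_along [OF l bimap_cofs [OF F]]
  show "Theta_transpose c m \<eta> \<mu> a \<alpha> F \<in> trans"
    unfolding transpose_eq
    using conditions_iff [OF l bimap_cofs [OF F] map along_Ca [OF l] restrict_lens_eq(1)] F
      bimod_hom_restrict_lens [OF adj.bimap_transpose [OF map]]
    by blast
  fix F' assume F': "F' \<in> cofs"
  then have l': "is_lens (cat_poly \<Theta>op) (cat_poly a) F'" by (simp add: is_lens_cofunctor)
  note map' = bimap_along [OF l' bimap_cofs [OF F']]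
  show "Theta_transpose c m \<eta> \<mu> a \<alpha> F = Theta_transpose c m \<eta> \<mu> a \<alpha> F' \<longleftrightarrow> F = F'"
  proof
    assume eq: "Theta_transpose c m \<eta> \<mu> a \<alpha> F = Theta_transpose c m \<eta> \<mu> a \<alpha> F'"
    \<comment> \<open>Injectivity: the equation is traced back through the normal form, the
      transposition and \<sigma>, each of which loses nothing.\<close>
    have "lens_eq m Cmm (adj.transpose (along F)) (adj.transpose (along F'))"
      using restrict_lens_eq(2) [of m Cmm "adj.transpose (along F')"]
      unfolding eq [unfolded transpose_eq, symmetric]
      by (rule lens_eq_trans [OF restrict_lens_eq(1)])
    then have "lens_eq lan.L Ca (along F) (along F')"
      by (simp only: adj.transpose_lens_eq_iff [OF map map'])
    then have e: "lens_eq lan.L Ca (F \<odot> of_L) (F' \<odot> of_L)"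
      by (rule lens_eq_trans [OF lens_eq_sym [OF along_Ca [OF l]] lens_eq_trans [OF _ along_Ca [OF l']]])
    interpret Fc: cofun \<Theta>op a F using F by (intro cofun.intro category_Thetaop \<alpha>.cat_dom) simp
    interpret Fc': cofun \<Theta>op a F' using F' by (intro cofun.intro category_Thetaop \<alpha>.cat_dom) simp
    have "lens_eq (cat_poly \<Theta>op) (cat_poly a) F F'"
      unfolding lens_eq_def
    proof (intro ballI conjI)
      fix M assume "M \<in> pos (cat_poly \<Theta>op)"
      then have M: "M \<in> pos m" by simp
      show fwd: "fwd F M = fwd F' M" 
        using bspec [OF e [unfolded lens_eq_def], of M] M by (simp add: lcomp_def of_L_def)
      fix x assume "x \<in> dir (cat_poly a) (fwd F M)"
      then have x: "x \<in> out a (fwd F M)" by simp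
      have "\<sigma> M (bwd F M x) = \<sigma> M (bwd F' M x)"
        using bspec [OF e [unfolded lens_eq_def], of M] M x by (simp add: lcomp_def of_L_def)
      moreover have "bwd F M x \<in> out \<Theta>op M" "bwd F' M x \<in> out \<Theta>op M"
        using Fc.cof_simps(3) [of M x] Fc'.cof_simps(3) [of M x] M x fwd by auto
      ultimately show "bwd F M x = bwd F' M x"
        by (metis sigma_mem(2))
    qed
    then show "F = F'" by (rule is_lens_eqI [OF l l'])
  qed (erule arg_cong)
next
  fix \<phi> assume \<phi>: "\<phi> \<in> trans"
  then have map: "bimap c c m Cmm \<phi>" and len: "is_lens m Cmm \<phi>"
    by (simp_all add: bimap_hom m.bicom_axioms adj.rq.pq.bicom_axioms bimod_hom_iff)
  let ?\<psi> = "adj.mate \<phi>"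
  note \<psi> = adj.bimap_mate [OF map] and mate = adj.transpose_mate [OF map]
  \<comment> \<open>The preimage is the mate of \<phi>, carried from \<open>L\<close> to the
    opposite theory category by \<open>to_L\<close> and normalised.\<close>
  let ?F = "restrict_lens (cat_poly \<Theta>op) (cat_poly a) (?\<psi> \<odot> to_L)"
  have Feq: "?F = restrict_lens B Ca (?\<psi> \<odot> to_L)"
    by (simp add: restrict_lens_def)
  have "bimod_hom c c B Ca ?F"
    unfolding Feq by (rule bimod_hom_restrict_lens [OF bimap_lcomp [OF bimap_to_L \<psi>]])
  then have F: "is_lens (cat_poly \<Theta>op) (cat_poly a) ?F" "bimap c c B Ca ?F"
    by (simp_all add: bimap_hom cofun.bicom_cof cofun_proj \<alpha>.bicom_cof bimod_hom_iff is_lens_def)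
  interpret \<psi>: bimap c c lan.L Ca ?\<psi> by (rule \<psi>)
  have e: "lens_eq lan.L Ca ?\<psi> (?F \<odot> of_L)"
    unfolding lens_eq_def
  proof (intro ballI conjI)
    fix M assume "M \<in> pos lan.L"
    then have M: "M \<in> pos m" by simp
    show "fwd ?\<psi> M = fwd (?F \<odot> of_L) M"
      using M by (simp add: restrict_lens_def lcomp_def of_L_def to_L_def)
    fix x assume "x \<in> dir Ca (fwd ?\<psi> M)"
    then show "bwd ?\<psi> M x = bwd (?F \<odot> of_L) M x"
      using M \<psi>.bwd_simps(1) [of M x] sigma_tau [of "bwd ?\<psi> M x" M]
      by (simp add: restrict_lens_def lcomp_def of_L_def to_L_def)
  qed
  have "?F \<in> cofs"
    using conditions_iff [OF F \<psi> e mate] \<phi> by blast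
  moreover have "\<phi> = Theta_transpose c m \<eta> \<mu> a \<alpha> ?F"
    unfolding transpose_eq
  proof (rule is_lens_eqI [OF len])
    note map' = bimap_along [OF F]
    have "bimod_hom c c m Cmm (restrict_lens m Cmm (adj.transpose (along ?F)))"
      by (rule bimod_hom_restrict_lens [OF adj.bimap_transpose [OF map']])
    then show "is_lens m Cmm (restrict_lens m Cmm (adj.transpose (along ?F)))"
      by (simp add: bimod_hom_iff)
    have "lens_eq lan.L Ca ?\<psi> (along ?F)"
      by (rule lens_eq_trans [OF e lens_eq_sym [OF along_Ca [OF F(1)]]])
    then have "lens_eq m Cmm (adj.transpose ?\<psi>) (adj.transpose (along ?F))"
      by (simp only: adj.transpose_lens_eq_iff [OF \<psi> map'])
    then show "lens_eq m Cmm \<phi> (restrict_lens m Cmm (adj.transpose (along ?F)))"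
      by (rule lens_eq_trans [OF lens_eq_sym [OF mate] lens_eq_trans [OF _ restrict_lens_eq(1)]])
  qed
  ultimately show "\<exists>F\<in>cofs. \<phi> = Theta_transpose c m \<eta> \<mu> a \<alpha> F" by blast
qed

end

theorem corollary4p2:
  fixes c :: "('o, 'a) cat"
    and m :: "('i, 'd, 'o, 'a, 'o, 'a) bimod"
    and \<eta> :: "('o, 'a, 'i, 'd) lens"
    and \<mu> :: "('i \<times> ('d \<Rightarrow> 'i), ('d \<times> 'd) set, 'i, 'd) lens"
  assumes "category c"
    and "familial_monad c m \<eta> \<mu>"
  shows "comonoid (Lan_comonoid c m \<eta> \<mu>) \<and>
    cat_iso (cat_of_comonoid (Lan_comonoid c m \<eta> \<mu>)) (op_cat (Theta c m \<eta> \<mu>))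
      (\<lambda>M. M) (Theta_arr c m) \<and>
    cofunctor (op_cat (Theta c m \<eta> \<mu>)) c (Theta_proj c m \<eta> \<mu>) \<and>
    (\<forall>(a :: ('b, 'e) cat) \<alpha>. category a \<and> cofunctor a c \<alpha> \<longrightarrow>
       bij_betw (Theta_transpose c m \<eta> \<mu> a \<alpha>)
         {F. cofunctor (op_cat (Theta c m \<eta> \<mu>)) a F \<and>
             lens_eq (cat_poly (op_cat (Theta c m \<eta> \<mu>))) (cat_poly c)
               (\<alpha> \<odot> F) (Theta_proj c m \<eta> \<mu>)}
         {\<phi>. bimod_hom c c m (cof_bimod a \<alpha> \<triangleleft>\<^bsub>c\<^esub> m \<triangleleft>\<^bsub>c\<^esub> m) \<phi> \<and>
             counit_condition c m \<eta> (cof_bimod a \<alpha>) (cof_counit \<alpha>) \<phi> \<and>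
             comult_condition c m \<mu> (cof_bimod a \<alpha>) (cof_comult a) \<phi>})"
proof -
  interpret fam_monad c m \<eta> \<mu> by (intro fam_monad.intro assms)
  have "bij_betw (Theta_transpose c m \<eta> \<mu> a \<alpha>)
      {F. cofunctor \<Theta>op a F \<and> lens_eq (cat_poly \<Theta>op) (cat_poly c) (\<alpha> \<odot> F) proj}
      {\<phi>. bimod_hom c c m (cof_bimod a \<alpha> \<triangleleft>\<^bsub>c\<^esub> m \<triangleleft>\<^bsub>c\<^esub> m) \<phi> \<and>
        counit_condition c m \<eta> (cof_bimod a \<alpha>) (cof_counit \<alpha>) \<phi> \<and>
        comult_condition c m \<mu> (cof_bimod a \<alpha>) (cof_comult a) \<phi>}"
    if "category a" "cofunctor a c \<alpha>" for a :: "('b, 'e) cat" and \<alpha>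
    by (intro fam_monad_cof.bij_transpose fam_monad_cof.intro fam_monad_axioms cofun.intro that category)
  then show ?thesis
    unfolding Theta_proj_eq using comonoid_E cat_iso_catE cofunctor_proj by blast
qed

end
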